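(* For every $\ell\in\mathbb{N}$, the class of locally finite Cayley graphs of finitely generated groups that have a finite presentation with relations of length at most $\ell$ has the coarse Menger property.
   Context: $\mathbb{N}$ is the set of natural numbers. A finite presentation $\langle S\mid R\rangle$ of a group is one in which both the set $S$ of generators and the set $R$ of relations are finite; the length of a relation is its length as a word over $S\cup S^{-1}$. A Cayley graph of a group $\Gamma$ is, for a generating set $T$ of $\Gamma$, the simple undirected graph with vertex set $\Gamma$ in which two distinct elements $g,h$ are adjacent if and only if $h=gt$ for some $t\in T\cup T^{-1}$; it is locally finite if every vertex has finite degree. Coarse Menger property: a class $\mathcal{G}$ of graphs has the coarse Menger property if there is a function $g:\mathbb{N}^2\to\mathbb{N}$ (which may depend on $\mathcal{G}$) such that for all $k,d\in\mathbb{N}$, every $G\in\mathcal{G}$, and every two sets $X,Y\subseteq V(G)$, at least one of the following holds: (i) there are $k$ disjoint $X$–$Y$ paths in $G$ that are pairwise at distance at least $d$ from each other; (ii) there is a set $Z\subseteq V(G)$ of size at most $k-1$ such that every $X$–$Y$ path is at distance at most $g(k,d)$ from $Z$. Here an $X$–$Y$ path is a path meeting $X$ precisely in its first vertex and $Y$ precisely in its last vertex, and the distance between two sets of vertices (or paths) is the minimum graph distance in $G$ between a vertex of one and a vertex of the other.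
   Formalization: The Cayley graphs are taken with respect to the generators S of the finite presentation whose relations have length at most ℓ; for arbitrary finite generating sets the claim is false, since every finite connected graph is a block of some Cayley graph of a free group. *)

theory Defs
  imports "HOL-Algebra.Generated_Groups" "HOL-Library.Extended_Nat"
begin

section \<open>Graphs and the coarse Menger property\<close>

record 'a sgraph =
  verts :: "'a set"
  edges :: "'a set set"

definition simple_graph :: "'a sgraph \<Rightarrow> bool" where
  "simple_graph G \<longleftrightarrow>
     edges G \<subseteq> {{u, v} | u v. u \<in> verts G \<and> v \<in> verts G \<and> u \<noteq> v}"

definition locally_finite :: "'a sgraph \<Rightarrow> bool" where
  "locally_finite G \<longleftrightarrow> (\<forall>v\<in>verts G. finite {u \<in> verts G. {u, v} \<in> edges G})"

definition is_walk :: "'a sgraph \<Rightarrow> 'a list \<Rightarrow> bool" where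
  "is_walk G p \<longleftrightarrow>
     p \<noteq> [] \<and> set p \<subseteq> verts G \<and> successively (\<lambda>u v. {u, v} \<in> edges G) p"

definition is_path :: "'a sgraph \<Rightarrow> 'a list \<Rightarrow> bool" where
  "is_path G p \<longleftrightarrow> is_walk G p \<and> distinct p"

text \<open>The distance between vertices in different components is \<open>\<infinity>\<close>, and so is the
  distance between two sets of vertices one of which is empty.\<close>

definition vdist :: "'a sgraph \<Rightarrow> 'a \<Rightarrow> 'a \<Rightarrow> enat" where
  "vdist G u v = (INF p \<in> {p. is_walk G p \<and> hd p = u \<and> last p = v}. enat (length p - 1))"

definition sdist :: "'a sgraph \<Rightarrow> 'a set \<Rightarrow> 'a set \<Rightarrow> enat" where
  "sdist G A B = (INF u \<in> A. INF v \<in> B. vdist G u v)"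

text \<open>A single vertex of \<open>X \<inter> Y\<close> is also an \<open>X\<close>-\<open>Y\<close> path.\<close>

definition is_XY_path :: "'a sgraph \<Rightarrow> 'a set \<Rightarrow> 'a set \<Rightarrow> 'a list \<Rightarrow> bool" where
  "is_XY_path G X Y p \<longleftrightarrow> is_path G p \<and> set p \<inter> X = {hd p} \<and> set p \<inter> Y = {last p}"

text \<open>\<open>card Z < k\<close> says \<open>card Z \<le> k - 1\<close> without truncated subtraction; for \<open>k = 0\<close> the
  first alternative holds trivially.\<close>

definition coarse_Menger_property :: "'a sgraph set \<Rightarrow> bool" where
  "coarse_Menger_property \<G> \<longleftrightarrow>
     (\<exists>g :: nat \<Rightarrow> nat \<Rightarrow> nat. \<forall>k d. \<forall>G\<in>\<G>. \<forall>X Y. X \<subseteq> verts G \<longrightarrow> Y \<subseteq> verts G \<longrightarrow>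
        (\<exists>P :: nat \<Rightarrow> 'a list.
            (\<forall>i<k. is_XY_path G X Y (P i)) \<and>
            (\<forall>i<k. \<forall>j<k. i \<noteq> j \<longrightarrow>
               set (P i) \<inter> set (P j) = {} \<and> sdist G (set (P i)) (set (P j)) \<ge> enat d)) \<or>
        (\<exists>Z \<subseteq> verts G. finite Z \<and> card Z < k \<and>
            (\<forall>p. is_XY_path G X Y p \<longrightarrow> sdist G (set p) Z \<le> enat (g k d))))"


section \<open>Free groups and group presentations\<close>

text \<open>The letter \<open>(s, True)\<close> stands for \<open>s\<close> and \<open>(s, False)\<close> for its formal inverse.\<close>

type_synonym 's word = "('s \<times> bool) list"

definition inv_letter :: "'s \<times> bool \<Rightarrow> 's \<times> bool" where
  "inv_letter x = (fst x, \<not> snd x)"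

definition words :: "'s set \<Rightarrow> 's word set" where
  "words S = lists (S \<times> UNIV)"

definition freely_reduced :: "'s word \<Rightarrow> bool" where
  "freely_reduced w \<longleftrightarrow> successively (\<lambda>x y. y \<noteq> inv_letter x) w"

fun cons_reduce :: "'s \<times> bool \<Rightarrow> 's word \<Rightarrow> 's word" where
  "cons_reduce x [] = [x]"
| "cons_reduce x (y # w) = (if y = inv_letter x then w else x # y # w)"

definition free_reduce :: "'s word \<Rightarrow> 's word" where
  "free_reduce w = foldr cons_reduce w []"

definition free_group :: "'s set \<Rightarrow> 's word monoid" where
  "free_group S =
     \<lparr>carrier = {w \<in> words S. freely_reduced w},
      mult = (\<lambda>u v. free_reduce (u @ v)),
      one = []\<rparr>"

definition normal_closure :: "('a, 'b) monoid_scheme \<Rightarrow> 'a set \<Rightarrow> 'a set" where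
  "normal_closure G A =
     generate G {g \<otimes>\<^bsub>G\<^esub> a \<otimes>\<^bsub>G\<^esub> inv\<^bsub>G\<^esub> g | g a. g \<in> carrier G \<and> a \<in> A}"

definition relator_subgroup :: "'s set \<Rightarrow> 's word set \<Rightarrow> 's word set" where
  "relator_subgroup S R = normal_closure (free_group S) (free_reduce ` R)"

definition presented_group :: "'s set \<Rightarrow> 's word set \<Rightarrow> 's word set monoid" where
  "presented_group S R = free_group S Mod relator_subgroup S R"

definition presented_gen :: "'s set \<Rightarrow> 's word set \<Rightarrow> 's \<Rightarrow> 's word set" where
  "presented_gen S R s = relator_subgroup S R #>\<^bsub>free_group S\<^esub> [(s, True)]"

text \<open>\<open>\<phi>\<close> identifies \<open>\<langle>S | R\<rangle>\<close> with \<open>\<Gamma>\<close>. Relators need not be reduced, and it is their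
  length as written that is bounded.\<close>

definition finite_presentation ::
    "('a, 'b) monoid_scheme \<Rightarrow> 's set \<Rightarrow> 's word set \<Rightarrow> ('s word set \<Rightarrow> 'a) \<Rightarrow> bool" where
  "finite_presentation \<Gamma> S R \<phi> \<longleftrightarrow>
     finite S \<and> finite R \<and> R \<subseteq> words S \<and> \<phi> \<in> iso (presented_group S R) \<Gamma>"


section \<open>Cayley graphs\<close>

definition Cayley_graph :: "('a, 'b) monoid_scheme \<Rightarrow> 'a set \<Rightarrow> 'a sgraph" where
  "Cayley_graph \<Gamma> T =
     \<lparr>verts = carrier \<Gamma>,
      edges = {{g, h} | g h. g \<in> carrier \<Gamma> \<and> h \<in> carrier \<Gamma> \<and> g \<noteq> h \<and>
                 (\<exists>t \<in> T \<union> m_inv \<Gamma> ` T. h = g \<otimes>\<^bsub>\<Gamma>\<^esub> t)}\<rparr>"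

text \<open>The generating set \<open>T\<close> of the Cayley graph is the set of generators of the presentation
  whose relators have length at most \<open>l\<close>. If \<open>T\<close> were unrelated to the presentation, the bound
  \<open>l\<close> would carry no information about the graph: every finite connected graph \<open>H\<close> on
  vertices \<open>1, \<dots>, n\<close> is a union of blocks in a Cayley graph of the free group on
  \<open>s\<^sub>2, \<dots>, s\<^sub>n\<close>, which needs no relators, namely for
  \<open>T = {s\<^sub>i\<inverse> s\<^sub>j | ij \<in> E(H)}\<close> with \<open>s\<^sub>1 = 1\<close>; and the coarse Menger property
  fails for the class of all finite connected graphs (Nguyen, Scott and Seymour).

  Generator symbols are natural numbers, which suffices since \<open>S\<close> is finite. That \<open>\<Gamma>\<close> is
  finitely generated is implied by \<open>S\<close> being finite. All groups concerned are countable, so at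
  \<open>'a = nat\<close> the class contains every such Cayley graph up to isomorphism.\<close>

definition finpres_Cayley_graphs :: "nat \<Rightarrow> 'a sgraph set" where
  "finpres_Cayley_graphs l =
     {Cayley_graph \<Gamma> T | (\<Gamma> :: 'a monoid) T.
        group \<Gamma> \<and> T \<subseteq> carrier \<Gamma> \<and> generate \<Gamma> T = carrier \<Gamma> \<and>
        locally_finite (Cayley_graph \<Gamma> T) \<and>
        (\<exists>(S :: nat set) R \<phi>. finite_presentation \<Gamma> S R \<phi> \<and> (\<forall>r\<in>R. length r \<le> l) \<and>
            T = (\<phi> \<circ> presented_gen S R) ` S)}"


section \<open>Well-definedness\<close>

lemma inv_letter_inv_letter [simp]: "inv_letter (inv_letter x) = x"
  by (simp add: inv_letter_def)

lemma inv_letter_neq [simp]: "inv_letter x \<noteq> x" "x \<noteq> inv_letter x"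
  by (auto simp: inv_letter_def prod_eq_iff)

lemma freely_reduced_Nil [simp]: "freely_reduced []"
  by (simp add: freely_reduced_def)

lemma freely_reduced_Cons:
  "freely_reduced (x # w) \<longleftrightarrow> freely_reduced w \<and> (w = [] \<or> hd w \<noteq> inv_letter x)"
  by (cases w) (auto simp: freely_reduced_def)

lemma cons_reduce_freely_reduced: "freely_reduced w \<Longrightarrow> freely_reduced (cons_reduce x w)"
  by (cases w) (auto simp: freely_reduced_Cons)

lemma cons_reduce_words: "x \<in> S \<times> UNIV \<Longrightarrow> w \<in> words S \<Longrightarrow> cons_reduce x w \<in> words S"
  by (cases w) (auto simp: words_def)

lemma cons_reduce_cancel:
  "freely_reduced w \<Longrightarrow> cons_reduce x (cons_reduce (inv_letter x) w) = w"
  by (cases w rule: list.exhaust; cases "tl w")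
     (auto simp: freely_reduced_Cons)

lemma foldr_cons_reduce_freely_reduced:
  "freely_reduced v \<Longrightarrow> freely_reduced (foldr cons_reduce u v)"
  by (induction u) (auto intro: cons_reduce_freely_reduced)

lemma foldr_cons_reduce_words:
  "u \<in> words S \<Longrightarrow> v \<in> words S \<Longrightarrow> foldr cons_reduce u v \<in> words S"
proof (induction u)
  case (Cons x u)
  then show ?case using cons_reduce_words[of x S] by (auto simp: words_def)
qed auto

lemma free_reduce_in:
  assumes "w \<in> words S" shows "free_reduce w \<in> carrier (free_group S)"
  using assms foldr_cons_reduce_words[of w S "[]"] foldr_cons_reduce_freely_reduced[of "[]" w]
  by (auto simp: free_group_def free_reduce_def words_def)

lemma free_reduce_id: "freely_reduced w \<Longrightarrow> free_reduce w = w"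
proof (induction w)
  case (Cons x w)
  then show ?case by (cases w) (auto simp: freely_reduced_Cons free_reduce_def)
qed (simp add: free_reduce_def)

lemma foldr_cons_reduce_cons_reduce:
  assumes "freely_reduced u" "freely_reduced v"
  shows "foldr cons_reduce (cons_reduce x u) v = cons_reduce x (foldr cons_reduce u v)"
proof (cases u)
  case (Cons y u')
  then show ?thesis
    using assms cons_reduce_cancel[of "foldr cons_reduce u' v" x]
      foldr_cons_reduce_freely_reduced[of v u'] by auto
qed auto

lemma foldr_free_reduce:
  "freely_reduced v \<Longrightarrow> foldr cons_reduce (free_reduce u) v = foldr cons_reduce u v"
proof (induction u)
  case (Cons x u)
  have "freely_reduced (free_reduce u)"
    by (simp add: free_reduce_def foldr_cons_reduce_freely_reduced)
  with Cons show ?case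
    using foldr_cons_reduce_cons_reduce[of "free_reduce u" v x] by (simp add: free_reduce_def)
qed (simp add: free_reduce_def)

lemma free_reduce_append: "free_reduce (u @ v) = foldr cons_reduce u (free_reduce v)"
  by (simp add: free_reduce_def)

lemma freely_reduced_free_reduce: "freely_reduced (free_reduce w)"
  by (simp add: free_reduce_def foldr_cons_reduce_freely_reduced)

lemma free_reduce_append_left: "free_reduce (free_reduce u @ v) = free_reduce (u @ v)"
  by (simp add: free_reduce_append foldr_free_reduce freely_reduced_free_reduce)

lemma free_reduce_append_right: "free_reduce (u @ free_reduce v) = free_reduce (u @ v)"
  by (simp add: free_reduce_append free_reduce_id freely_reduced_free_reduce)

lemma free_reduce_inverse: "free_reduce (rev (map inv_letter w) @ w) = []"
proof (induction w)
  case (Cons x w)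
  have "freely_reduced (free_reduce w)"
    by (simp add: free_reduce_def foldr_cons_reduce_freely_reduced)
  then have "cons_reduce (inv_letter x) (cons_reduce x (free_reduce w)) = free_reduce w"
    using cons_reduce_cancel[of "free_reduce w" "inv_letter x"] by simp
  with Cons show ?case by (simp add: free_reduce_def)
qed (simp add: free_reduce_def)

lemma group_free_group: "group (free_group S)"
proof (rule groupI)
  fix u v assume "u \<in> carrier (free_group S)" "v \<in> carrier (free_group S)"
  then show "u \<otimes>\<^bsub>free_group S\<^esub> v \<in> carrier (free_group S)"
    using free_reduce_in[of "u @ v" S] by (simp add: free_group_def words_def)
next
  show "\<one>\<^bsub>free_group S\<^esub> \<in> carrier (free_group S)"
    by (simp add: free_group_def words_def)
next
  fix u v w
  show "u \<otimes>\<^bsub>free_group S\<^esub> v \<otimes>\<^bsub>free_group S\<^esub> w =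
    u \<otimes>\<^bsub>free_group S\<^esub> (v \<otimes>\<^bsub>free_group S\<^esub> w)"
    by (simp add: free_group_def free_reduce_append_left free_reduce_append_right)
next
  fix u assume "u \<in> carrier (free_group S)"
  then show "\<one>\<^bsub>free_group S\<^esub> \<otimes>\<^bsub>free_group S\<^esub> u = u"
    by (simp add: free_group_def free_reduce_id)
next
  fix u assume u: "u \<in> carrier (free_group S)"
  let ?v = "free_reduce (rev (map inv_letter u))"
  have "rev (map inv_letter u) \<in> words S"
    using u by (auto simp: free_group_def words_def inv_letter_def in_lists_conv_set)
  then have "?v \<in> carrier (free_group S)" by (rule free_reduce_in)
  moreover have "?v \<otimes>\<^bsub>free_group S\<^esub> u = \<one>\<^bsub>free_group S\<^esub>"
    by (simp add: free_group_def free_reduce_append_left free_reduce_inverse)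
  ultimately show "\<exists>v\<in>carrier (free_group S). v \<otimes>\<^bsub>free_group S\<^esub> u = \<one>\<^bsub>free_group S\<^esub>" ..
qed

lemma normal_normal_closure:
  assumes "group G" "A \<subseteq> carrier G"
  shows "normal_closure G A \<lhd> G"
proof -
  interpret group G by fact
  show ?thesis unfolding normal_closure_def
  proof (rule normal_generateI)
    show "{g \<otimes>\<^bsub>G\<^esub> a \<otimes>\<^bsub>G\<^esub> inv\<^bsub>G\<^esub> g | g a. g \<in> carrier G \<and> a \<in> A} \<subseteq> carrier G"
      using assms by auto
  next
    fix h g assume "h \<in> {g \<otimes>\<^bsub>G\<^esub> a \<otimes>\<^bsub>G\<^esub> inv\<^bsub>G\<^esub> g | g a. g \<in> carrier G \<and> a \<in> A}"
      and g: "g \<in> carrier G"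
    then obtain k a where "h = k \<otimes>\<^bsub>G\<^esub> a \<otimes>\<^bsub>G\<^esub> inv\<^bsub>G\<^esub> k" and k: "k \<in> carrier G" "a \<in> A" by blast
    moreover have "a \<in> carrier G" using k assms by auto
    ultimately have "g \<otimes>\<^bsub>G\<^esub> h \<otimes>\<^bsub>G\<^esub> inv\<^bsub>G\<^esub> g =
        (g \<otimes>\<^bsub>G\<^esub> k) \<otimes>\<^bsub>G\<^esub> a \<otimes>\<^bsub>G\<^esub> inv\<^bsub>G\<^esub> (g \<otimes>\<^bsub>G\<^esub> k)"
      using g by (simp add: inv_mult_group m_assoc)
    with g k show "g \<otimes>\<^bsub>G\<^esub> h \<otimes>\<^bsub>G\<^esub> inv\<^bsub>G\<^esub> g \<in>
        {g \<otimes>\<^bsub>G\<^esub> a \<otimes>\<^bsub>G\<^esub> inv\<^bsub>G\<^esub> g | g a. g \<in> carrier G \<and> a \<in> A}" by blast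
  qed
qed

lemma relator_subgroup_normal:
  "R \<subseteq> words S \<Longrightarrow> relator_subgroup S R \<lhd> free_group S"
  unfolding relator_subgroup_def
  by (intro normal_normal_closure group_free_group) (auto intro: free_reduce_in)

lemma group_presented_group: "R \<subseteq> words S \<Longrightarrow> group (presented_group S R)"
  unfolding presented_group_def by (intro normal.factorgroup_is_group relator_subgroup_normal)

lemma simple_graph_Cayley_graph: "simple_graph (Cayley_graph \<Gamma> T)"
  by (auto simp: simple_graph_def Cayley_graph_def)

end

(* Distances between paths only matter for connected sets meeting X and Y. The geometric input is
   that relators of length at most l make the inner boundary of a connected set with connected
   complement connected by jumps of length at most l: otherwise the edges leaving one part of the
   boundary are met an even number of times by every relator, hence by every closed walk, but a walk
   leaving the set through that part and returning through the rest meets them once. This property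
   passes to the graph in which a connected set is contracted to a vertex.

   Two far apart sets are found along an X-Y geodesic P. If no ball separates X from Y, then
   around every position on P some component of the complement of a tube around P attaches to P
   on both sides, and its boundary contains a lane parallel to P. One strand follows P, the other
   one the lanes; where a lane ends, the second strand jumps to the next lane if the two come close,
   and otherwise the strands swap roles.

   For k > 2, take k - 1 sets that are very far apart and let W be the component containing one of
   them in the complement of a tube around another one. Then W and its complement U are connected
   and share the sets as a + b = k - 1 with a, b > 0, so the induction hypothesis applies with a + 1 and
   b + 1 to the graphs obtained by contracting W and U. Two sets through the contracted vertices are
   glued along the boundary between U and W, and balls that cover a far apart sets cannot reach the
   contracted vertex. *)

theory Submission
  imports Defs
begin

section \<open>Connected sets and distances\<close>

text \<open>The obstacle in the induction is that contracting a set shortens distances. A ball of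
  bounded radius in the quotient that contains the contracted vertex may have an unbounded trace in
  the graph, so a cover of the quotient need not give a cover of the graph. This is why k - 1 very
  far apart sets are produced first: a cover of one side by at most a balls has to hit each of the a
  sets there, these sets are too far apart to share a ball, and so every ball sits at one of them.
  Around such a ball the quotient and the graph have the same short distances. The target distance
  \<open>D\<close> varies in the induction because the sets must be farther apart than the radii
  obtained for smaller k. Quotients of Cayley graphs are no longer Cayley graphs, so everything is
  proved uniformly for connected graphs with the cut property.

  In the case of two sets, positions on the geodesic serve as a coordinate: objects attached near
  distant positions are far apart. The constants form a hierarchy, each one large against the
  earlier ones, and depend only on \<open>l\<close> and \<open>D\<close>.\<close>

definition gdist :: "('a \<times> 'a) set \<Rightarrow> 'a \<Rightarrow> 'a \<Rightarrow> nat" where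
  "gdist E u v = (LEAST n. (u, v) \<in> E ^^ n)"

definition conn :: "('a \<times> 'a) set \<Rightarrow> 'a set \<Rightarrow> bool" where
  "conn E S \<longleftrightarrow> (\<forall>u\<in>S. \<forall>v\<in>S. (u, v) \<in> (E \<inter> S \<times> S)\<^sup>*)"

definition bdry :: "('a \<times> 'a) set \<Rightarrow> 'a set \<Rightarrow> 'a set \<Rightarrow> 'a set" where
  "bdry E U W = {u \<in> U. \<exists>w\<in>W. (u, w) \<in> E}"

definition near :: "('a \<times> 'a) set \<Rightarrow> nat \<Rightarrow> 'a set \<Rightarrow> ('a \<times> 'a) set" where
  "near E l B = {(x, y). x \<in> B \<and> y \<in> B \<and> gdist E x y \<le> l}"

text \<open>The form in which connectedness is mostly used: to confine \<open>S\<close> to a region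
  \<open>L\<close>, only single edges have to be checked.\<close>

lemma conn_closed_subset:
  assumes "conn E S" "x \<in> S" "x \<in> L"
    and "\<And>u v. u \<in> S \<Longrightarrow> u \<in> L \<Longrightarrow> v \<in> S \<Longrightarrow> (u, v) \<in> E \<Longrightarrow> v \<in> L"
  shows "S \<subseteq> L"
proof
  fix y assume "y \<in> S"
  then have "(x, y) \<in> (E \<inter> S \<times> S)\<^sup>*" using assms(1,2) by (auto simp: conn_def)
  then show "y \<in> L" by (induction rule: rtrancl_induct) (use assms in auto)
qed

lemma conn_exit:
  assumes "conn E S" "x \<in> S" "x \<in> L" "y \<in> S" "y \<notin> L"
  obtains u v where "u \<in> S" "u \<in> L" "v \<in> S" "v \<notin> L" "(u, v) \<in> E"
  using conn_closed_subset[OF assms(1-3)] assms(4,5) by blast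

lemma rtrancl_restrict_mono: "S \<subseteq> T \<Longrightarrow> (u, v) \<in> (E \<inter> S \<times> S)\<^sup>* \<Longrightarrow> (u, v) \<in> (E \<inter> T \<times> T)\<^sup>*"
  by (rule rtrancl_mono[THEN subsetD, rotated]) auto

lemma conn_empty [simp]: "conn E {}" and conn_singleton [simp]: "conn E {x}"
  by (auto simp: conn_def)

lemma connI_root:
  assumes "sym E" "\<And>v. v \<in> S \<Longrightarrow> (c, v) \<in> (E \<inter> S \<times> S)\<^sup>*"
  shows "conn E S"
  unfolding conn_def
proof (intro ballI)
  fix u v assume uv: "u \<in> S" "v \<in> S"
  have "sym (E \<inter> S \<times> S)" using assms(1) by (auto simp: sym_def)
  then have "sym ((E \<inter> S \<times> S)\<^sup>*)" by (rule sym_rtrancl)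
  then have "(u, c) \<in> (E \<inter> S \<times> S)\<^sup>*" using assms(2)[OF uv(1)] by (auto dest: symD)
  then show "(u, v) \<in> (E \<inter> S \<times> S)\<^sup>*" using assms(2)[OF uv(2)] by simp
qed

lemma conn_Un:
  assumes "conn E S" "conn E T" "x \<in> S" "x \<in> T" "sym E"
  shows "conn E (S \<union> T)"
proof (rule connI_root[OF assms(5), where c = x])
  fix v assume "v \<in> S \<union> T"
  then show "(x, v) \<in> (E \<inter> (S \<union> T) \<times> (S \<union> T))\<^sup>*"
    using assms rtrancl_restrict_mono[of S "S \<union> T" x v E] rtrancl_restrict_mono[of T "S \<union> T" x v E]
    by (auto simp: conn_def)
qed

lemma conn_edge: "sym E \<Longrightarrow> (x, y) \<in> E \<Longrightarrow> conn E {x, y}"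
  by (rule connI_root[where c = x]) auto

lemma conn_Un_edge:
  assumes "conn E S" "conn E T" "x \<in> S" "y \<in> T" "(x, y) \<in> E" "sym E"
  shows "conn E (S \<union> T)"
proof -
  have "conn E (S \<union> {x, y})" using conn_Un[OF assms(1) conn_edge[OF assms(6,5)]] assms by auto
  then have "conn E ((S \<union> {x, y}) \<union> T)" using conn_Un[of E "S \<union> {x, y}" T y] assms by auto
  moreover have "(S \<union> {x, y}) \<union> T = S \<union> T" using assms by auto
  ultimately show ?thesis by simp
qed

lemma conn_UN:
  assumes "sym E" "\<And>i. i \<in> I \<Longrightarrow> conn E (S i)" "\<And>i. i \<in> I \<Longrightarrow> c \<in> S i"
  shows "conn E (\<Union>i\<in>I. S i)"
proof (rule connI_root[OF assms(1), where c = c])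
  fix v assume "v \<in> (\<Union>i\<in>I. S i)"
  then obtain i where i: "i \<in> I" "v \<in> S i" by auto
  then have "(c, v) \<in> (E \<inter> S i \<times> S i)\<^sup>*" using assms(2,3) by (auto simp: conn_def)
  then show "(c, v) \<in> (E \<inter> (\<Union>i\<in>I. S i) \<times> (\<Union>i\<in>I. S i))\<^sup>*"
    by (rule rtrancl_restrict_mono[rotated]) (use i in auto)
qed

lemma relpow_sym: "sym E \<Longrightarrow> (u, v) \<in> E ^^ n \<Longrightarrow> (v, u) \<in> E ^^ n"
proof (induction n arbitrary: v)
  case (Suc n)
  then obtain w where "(u, w) \<in> E ^^ n" "(w, v) \<in> E" by auto
  then have "(w, u) \<in> E ^^ n" "(v, w) \<in> E" using Suc by (auto dest: symD)
  then show ?case using relpow_Suc_I2 by metis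
qed auto

section \<open>Distances, intervals, balls and components in a connected graph\<close>

locale cgraph =
  fixes V :: "'a set" and E :: "('a \<times> 'a) set"
  assumes E_sub: "E \<subseteq> V \<times> V" and sym: "sym E"
    and connected: "\<And>u v. u \<in> V \<Longrightarrow> v \<in> V \<Longrightarrow> (u, v) \<in> E\<^sup>*"
begin

abbreviation d :: "'a \<Rightarrow> 'a \<Rightarrow> nat" where "d \<equiv> gdist E"

lemma E_V: "(u, v) \<in> E \<Longrightarrow> u \<in> V" "(u, v) \<in> E \<Longrightarrow> v \<in> V"
  using E_sub by auto

lemma E_sym: "(u, v) \<in> E \<Longrightarrow> (v, u) \<in> E"
  using sym by (auto dest: symD)

text \<open>Connectedness makes \<open>gdist\<close> meaningful; without it, \<open>LEAST\<close>
  may range over no \<open>n\<close> at all.\<close>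

lemma relpow_d: "u \<in> V \<Longrightarrow> v \<in> V \<Longrightarrow> (u, v) \<in> E ^^ d u v"
  unfolding gdist_def using connected[of u v] rtrancl_imp_relpow[of "(u,v)" E]
  by (metis LeastI_ex)

lemma d_le: "(u, v) \<in> E ^^ n \<Longrightarrow> d u v \<le> n"
  unfolding gdist_def by (rule Least_le)

lemma d_refl [simp]: "d u u = 0"
  using d_le[of u u 0] by simp

lemma d_eq0: "u \<in> V \<Longrightarrow> v \<in> V \<Longrightarrow> d u v = 0 \<Longrightarrow> u = v"
  using relpow_d[of u v] by simp

lemma d_sym: "u \<in> V \<Longrightarrow> v \<in> V \<Longrightarrow> d u v = d v u"
  using relpow_d[of u v] relpow_d[of v u] relpow_sym[OF sym] d_le by (metis le_antisym)

lemma d_tri: "u \<in> V \<Longrightarrow> v \<in> V \<Longrightarrow> w \<in> V \<Longrightarrow> d u w \<le> d u v + d v w"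
  using relpow_d[of u v] relpow_d[of v w] by (intro d_le) (auto simp: relpow_add)

lemma d_edge: "(u, v) \<in> E \<Longrightarrow> d u v \<le> 1"
  by (rule d_le) auto

lemma d_edge_tri: "x \<in> V \<Longrightarrow> (u, v) \<in> E \<Longrightarrow> d x v \<le> d x u + 1"
  using d_tri[of x u v] d_edge[of u v] E_V[of u v] by auto

lemma d_pred:
  assumes "u \<in> V" "v \<in> V" "d u v = Suc n"
  obtains w where "w \<in> V" "(w, v) \<in> E" "d u w = n"
proof -
  obtain w where w: "(u, w) \<in> E ^^ n" "(w, v) \<in> E" using relpow_d[OF assms(1,2)] assms(3) by auto
  then have "w \<in> V" "d u w \<le> n" using E_V d_le by auto
  moreover have "d u v \<le> d u w + 1" using d_edge_tri assms(1) w by auto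
  ultimately show thesis using that w assms(3) by auto
qed

text \<open>The metric interval, that is, the union of all geodesics from \<open>u\<close> to
  \<open>v\<close>. Taking all of them avoids a choice and keeps the distance bounds of a single
  one.\<close>

definition seg :: "'a \<Rightarrow> 'a \<Rightarrow> 'a set" where
  "seg u v = {z \<in> V. d u z + d z v = d u v}"

lemma seg_V: "z \<in> seg u v \<Longrightarrow> z \<in> V" by (simp add: seg_def)

lemma seg_ends [simp]: "u \<in> V \<Longrightarrow> u \<in> seg u v" "v \<in> V \<Longrightarrow> v \<in> seg u v"
  by (auto simp: seg_def)

lemma seg_d: "z \<in> seg u v \<Longrightarrow> d u z + d z v = d u v" by (simp add: seg_def)

text \<open>Closure under steps towards \<open>u\<close> links every vertex of \<open>S\<close> to
  \<open>u\<close>, by induction on its distance. Intervals and balls are both of this kind.\<close>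

lemma conn_geodesic_down:
  assumes "u \<in> V" "\<And>z w. z \<in> S \<Longrightarrow> (w, z) \<in> E \<Longrightarrow> d u z = Suc (d u w) \<Longrightarrow> w \<in> S" "S \<subseteq> V"
  shows "conn E S"
proof (rule connI_root[OF sym, where c = u])
  fix v assume "v \<in> S"
  then show "(u, v) \<in> (E \<inter> S \<times> S)\<^sup>*"
  proof (induction "d u v" arbitrary: v)
    case 0
    then have "u = v" using d_eq0[of u v] assms by auto
    then show ?case by simp
  next
    case (Suc n)
    have "v \<in> V" using Suc assms(3) by auto
    then obtain w where w: "w \<in> V" "(w, v) \<in> E" "d u w = n"
      using d_pred[of u v n] assms(1) Suc(2) by metis
    then have "w \<in> S" using assms(2)[of v w] Suc by auto
    then have "(u, w) \<in> (E \<inter> S \<times> S)\<^sup>*" using Suc(1)[of w] w by auto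
    moreover have "(w, v) \<in> E \<inter> S \<times> S" using w \<open>w \<in> S\<close> Suc by auto
    ultimately show ?case by (rule rtrancl_into_rtrancl)
  qed
qed

lemma conn_seg: assumes "u \<in> V" "v \<in> V" shows "conn E (seg u v)"
proof (rule conn_geodesic_down[OF assms(1)])
  fix z w assume *: "z \<in> seg u v" "(w, z) \<in> E" "d u z = Suc (d u w)"
  have "w \<in> V" using * E_V by auto
  moreover have "d w v \<le> d z v + 1"
    using d_edge_tri[OF assms(2) E_sym[OF *(2)]] d_sym[of w v] d_sym[of z v] assms(2)
      \<open>w \<in> V\<close> seg_V[OF *(1)] by simp
  moreover have "d u v \<le> d u w + d w v" using d_tri assms calculation by auto
  ultimately show "w \<in> seg u v" using * seg_d[OF *(1)] by (auto simp: seg_def)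
qed (auto simp: seg_def)

definition cball :: "'a \<Rightarrow> nat \<Rightarrow> 'a set" where
  "cball u r = {z \<in> V. d u z \<le> r}"

lemma conn_cball: "u \<in> V \<Longrightarrow> conn E (cball u r)"
  by (rule conn_geodesic_down[of u]) (auto simp: cball_def dest: E_V)

lemma cball_self [simp]: "u \<in> V \<Longrightarrow> u \<in> cball u r" by (simp add: cball_def)

text \<open>Consecutive points of a chain lie in a common ball, so the balls fill the jumps. This
  turns a boundary that \<open>cut_conn\<close> connects by jumps into a connected set.\<close>

lemma conn_chain_balls:
  assumes "Z \<subseteq> V" "x \<in> Z" "\<And>z. z \<in> Z \<Longrightarrow> (x, z) \<in> (near E l Z)\<^sup>*"
  shows "conn E (\<Union>z\<in>Z. cball z l)" (is "conn E ?M")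
proof -
  have ball: "(z, v) \<in> (E \<inter> ?M \<times> ?M)\<^sup>*" if zv: "z \<in> Z" "v \<in> cball z l" for z v
  proof -
    have "cball z l \<subseteq> ?M" using zv by auto
    moreover have "(z, v) \<in> (E \<inter> cball z l \<times> cball z l)\<^sup>*"
      using conn_cball[of z l] zv assms(1) by (auto simp: conn_def)
    ultimately show ?thesis using rtrancl_restrict_mono by metis
  qed
  have chain: "(x, z) \<in> (E \<inter> ?M \<times> ?M)\<^sup>*" if "(x, z) \<in> (near E l Z)\<^sup>*" for z
    using that
  proof (induction rule: rtrancl_induct)
    case (step y z)
    then have "y \<in> Z" "z \<in> cball y l" using assms(1) by (auto simp: near_def cball_def)
    then show ?case using ball step.IH by (meson rtrancl_trans)
  qed simp
  show ?thesis
  proof (rule connI_root[OF sym, where c = x])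
    fix v assume "v \<in> ?M"
    then obtain z where "z \<in> Z" "v \<in> cball z l" by auto
    then show "(x, v) \<in> (E \<inter> ?M \<times> ?M)\<^sup>*" using ball chain assms(3) by (meson rtrancl_trans)
  qed
qed

lemma conn_V: "conn E V"
proof (rule connI_root[OF sym, where c = "SOME x. x \<in> V"])
  fix v assume "v \<in> V"
  then have "(SOME x. x \<in> V) \<in> V" by (meson someI)
  moreover have "E \<inter> V \<times> V = E" using E_sub by auto
  ultimately show "(SOME x. x \<in> V, v) \<in> (E \<inter> V \<times> V)\<^sup>*" using connected \<open>v \<in> V\<close> by auto
qed

lemma exit_point:
  assumes "v \<in> C" "z \<in> V" "z \<notin> C" "v \<in> V"
  obtains b w where "b \<in> C" "w \<notin> C" "(b, w) \<in> E" "b \<in> seg v z" "w \<in> seg v z"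
proof -
  have "\<exists>b w. b \<in> seg v z \<and> b \<in> C \<and> w \<in> seg v z \<and> w \<notin> C \<and> (b, w) \<in> E"
    using conn_exit[OF conn_seg[of v z], of v C z] assms by (metis seg_ends)
  then show thesis using that by blast
qed

definition ccomp :: "'a set \<Rightarrow> 'a \<Rightarrow> 'a set" where
  "ccomp S v = {u. (v, u) \<in> (E \<inter> S \<times> S)\<^sup>*}"

lemma ccomp_self [simp]: "v \<in> ccomp S v" by (simp add: ccomp_def)

lemma ccomp_sub: "v \<in> S \<Longrightarrow> ccomp S v \<subseteq> S"
proof
  fix u assume "v \<in> S" "u \<in> ccomp S v"
  then have "(v, u) \<in> (E \<inter> S \<times> S)\<^sup>*" by (simp add: ccomp_def)
  then show "u \<in> S" using \<open>v \<in> S\<close> by (induction rule: rtrancl_induct) auto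
qed

lemma ccomp_step: "v \<in> S \<Longrightarrow> u \<in> ccomp S v \<Longrightarrow> (u, w) \<in> E \<Longrightarrow> w \<in> S \<Longrightarrow> w \<in> ccomp S v"
  using ccomp_sub[of v S] by (auto simp: ccomp_def intro: rtrancl_into_rtrancl)

lemma conn_ccomp: "v \<in> S \<Longrightarrow> conn E (ccomp S v)"
proof (rule connI_root[OF sym, where c = v])
  fix u assume v: "v \<in> S" and "u \<in> ccomp S v"
  then have "(v, u) \<in> (E \<inter> S \<times> S)\<^sup>*" by (simp add: ccomp_def)
  then show "(v, u) \<in> (E \<inter> ccomp S v \<times> ccomp S v)\<^sup>*"
  proof (induction rule: rtrancl_induct)
    case (step y z)
    then have "y \<in> ccomp S v" "z \<in> ccomp S v"
      by (auto simp: ccomp_def intro: rtrancl_into_rtrancl)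
    then show ?case using step by (auto intro: rtrancl_into_rtrancl)
  qed simp
qed

lemma conn_sub_ccomp: "conn E T \<Longrightarrow> T \<subseteq> S \<Longrightarrow> v \<in> T \<Longrightarrow> T \<subseteq> ccomp S v"
  by (rule conn_closed_subset[of E T v]) (auto intro: ccomp_step)

text \<open>Every other component of \<open>V - N\<close> has an edge to \<open>N\<close>, as the
  graph is connected, and \<open>N\<close> ties them together. This supplies the connected
  complement that \<open>cut_conn\<close> asks for.\<close>

lemma conn_Diff_ccomp:
  assumes "conn E N" "N \<subseteq> V" "N \<noteq> {}" "v \<in> V - N"
  shows "conn E (V - ccomp (V - N) v)"
proof -
  let ?C = "ccomp (V - N) v"
  obtain c where c: "c \<in> N" using assms by auto
  have NC: "N \<subseteq> V - ?C" using ccomp_sub[OF assms(4)] assms(2) by auto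
  show ?thesis
  proof (rule connI_root[OF sym, where c = c])
    fix u assume u: "u \<in> V - ?C"
    show "(c, u) \<in> (E \<inter> (V - ?C) \<times> (V - ?C))\<^sup>*"
    proof (cases "u \<in> N")
      case True
      then show ?thesis using assms(1) c NC rtrancl_restrict_mono by (metis conn_def)
    next
      case False
      let ?D = "ccomp (V - N) u"
      have uS: "u \<in> V - N" using u False by auto
      have DC: "?D \<inter> ?C = {}"
      proof (rule ccontr)
        assume "?D \<inter> ?C \<noteq> {}"
        then obtain z where z: "z \<in> ?D" "z \<in> ?C" by auto
        have "?D \<subseteq> ccomp (V - N) z" using conn_sub_ccomp[OF conn_ccomp[OF uS]] ccomp_sub[OF uS] z by auto
        then have "u \<in> ccomp (V - N) z" by auto
        then have "u \<in> ?C" using z by (auto simp: ccomp_def)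
        then show False using u by auto
      qed
      have "c \<notin> ?D" "c \<in> V" "u \<in> V" using uS ccomp_sub[OF uS] c assms(2) by auto
      then obtain b w where bw: "b \<in> ?D" "w \<notin> ?D" "(b, w) \<in> E"
        using exit_point[of u ?D c, OF ccomp_self] by metis
      have "w \<in> N" using ccomp_step[OF uS bw(1) bw(3)] bw E_V by blast
      have "conn E (N \<union> ?D)" using conn_Un_edge[OF assms(1) conn_ccomp[OF uS] \<open>w \<in> N\<close> bw(1) E_sym[OF bw(3)] sym] .
      then have "(c, u) \<in> (E \<inter> (N \<union> ?D) \<times> (N \<union> ?D))\<^sup>*" using c by (auto simp: conn_def)
      moreover have "N \<union> ?D \<subseteq> V - ?C" using NC DC ccomp_sub[OF uS] by auto
      ultimately show ?thesis using rtrancl_restrict_mono by metis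
    qed
  qed
qed

end

text \<open>All that the coarse argument knows about the presentation. Unlike being a Cayley graph,
  it passes to contractions.\<close>

definition cut_conn :: "nat \<Rightarrow> 'a set \<Rightarrow> ('a \<times> 'a) set \<Rightarrow> bool" where
  "cut_conn l V E \<longleftrightarrow> (\<forall>U\<subseteq>V. conn E U \<and> conn E (V - U) \<longrightarrow>
     (\<forall>b\<in>bdry E U (V - U). \<forall>b'\<in>bdry E U (V - U). (b, b') \<in> (near E l (bdry E U (V - U)))\<^sup>*))"

section \<open>Two far apart sets along a geodesic\<close>

text \<open>The inequality is strict, so that even \<open>D = 0\<close> forces disjointness.\<close>

definition far :: "('a \<times> 'a) set \<Rightarrow> nat \<Rightarrow> 'a set \<Rightarrow> 'a set \<Rightarrow> bool" where
  "far E D A B \<longleftrightarrow> (\<forall>u\<in>A. \<forall>v\<in>B. D < gdist E u v)"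

lemma far_Un [simp]:
  "far E D (A \<union> A') B \<longleftrightarrow> far E D A B \<and> far E D A' B"
  "far E D A (B \<union> B') \<longleftrightarrow> far E D A B \<and> far E D A B'"
  by (auto simp: far_def)

lemma farI: "(\<And>u v. u \<in> A \<Longrightarrow> v \<in> B \<Longrightarrow> D < gdist E u v) \<Longrightarrow> far E D A B"
  by (simp add: far_def)

lemma farD: "far E D A B \<Longrightarrow> u \<in> A \<Longrightarrow> v \<in> B \<Longrightarrow> D < gdist E u v"
  by (simp add: far_def)

lemma far_mono: "far E m A B \<Longrightarrow> m' \<le> m \<Longrightarrow> far E m' A B"
  by (fastforce simp: far_def)

context cgraph
begin

lemma far_sym: "A \<subseteq> V \<Longrightarrow> B \<subseteq> V \<Longrightarrow> far E D A B \<Longrightarrow> far E D B A"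
proof (rule farI)
  fix u v assume "A \<subseteq> V" "B \<subseteq> V" "far E D A B" "u \<in> B" "v \<in> A"
  then show "D < d u v" using farD[of E D A B v u] d_sym[of u v] subsetD[of A V v] subsetD[of B V u] by auto
qed

text \<open>Add the triangle inequalities from \<open>v\<close> through \<open>z\<close> to both
  ends. It serves for segments so long that the distance of \<open>v\<close> to one end alone would
  give no bound.\<close>

lemma seg_far:
  assumes "z \<in> seg x y" "x \<in> V" "y \<in> V" "v \<in> V"
  shows "d v x + d v y \<le> 2 * d v z + d x y"
proof -
  have zV: "z \<in> V" using assms(1) by (rule seg_V)
  show ?thesis using d_tri[OF assms(4) zV assms(2)] d_tri[OF assms(4) zV assms(3)] seg_d[OF assms(1)]
      d_sym[OF assms(2) zV] by linarith
qed

lemma seg_le: "z \<in> seg x y \<Longrightarrow> d x z \<le> d x y" "z \<in> seg x y \<Longrightarrow> d z y \<le> d x y"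
  by (auto dest: seg_d)

lemma seg_le': "z \<in> seg x y \<Longrightarrow> x \<in> V \<Longrightarrow> y \<in> V \<Longrightarrow> d z x \<le> d x y \<and> d y z \<le> d x y"
  using d_sym[of x z] d_sym[of y z] seg_V[of z x y] seg_le[of z x y] by auto

definition two_far :: "nat \<Rightarrow> 'a set \<Rightarrow> 'a set \<Rightarrow> bool" where
  "two_far D X Y \<longleftrightarrow> (\<exists>A B. A \<subseteq> V \<and> B \<subseteq> V \<and> conn E A \<and> conn E B \<and>
     A \<inter> X \<noteq> {} \<and> A \<inter> Y \<noteq> {} \<and> B \<inter> X \<noteq> {} \<and> B \<inter> Y \<noteq> {} \<and> far E D A B)"

end

text \<open>\<open>s\<close> is the radius of the tube around the geodesic \<open>p\<close>; lanes lie at distance between \<open>D1 + th\<close>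
  and \<open>s + c\<close> from it. Sets within distance \<open>th\<close> are joined by a jump, and a jump between lanes still
  has distance \<open>D1\<close> from the geodesic. \<open>D2\<close> is the distance to unused parts of the geodesic, \<open>g\<close>, \<open>w\<close>,
  \<open>w0\<close> and \<open>R1\<close> are lengths along it: \<open>w0\<close> of the overlap of consecutive lanes, \<open>R1\<close> of a step.\<close>

locale geodesic = cgraph +
  fixes X Y :: "'a set" and n :: nat and p :: "nat \<Rightarrow> 'a"
    and l D c th th2 th3 D1 D2 s e g w w0 R1 :: nat
  assumes XV: "X \<subseteq> V" and YV: "Y \<subseteq> V"
    and pV: "i \<le> n \<Longrightarrow> p i \<in> V"
    and geod: "i \<le> j \<Longrightarrow> j \<le> n \<Longrightarrow> d (p i) (p j) = j - i"
    and p0: "p 0 \<in> X" and pn: "p n \<in> Y"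
    and short: "x \<in> X \<Longrightarrow> y \<in> Y \<Longrightarrow> n \<le> d x y"
    and cutc: "cut_conn l V E"
    and params: "c = l + 1" "2 * D + 2 * c + 2 \<le> th" "th + c + 2 * D + 2 \<le> th2"
      "2 * th2 + 2 * D + c + 2 \<le> th3" "th3 + D + 2 \<le> D1" "s = D1 + th + c" "e = l + 2 * s + 2"
      "th3 + th + 2 * s + 2 * c + D + 3 \<le> D2" "D2 + e + 2 * s + 2 * c + th + 2 \<le> g"
      "2 * s + 2 * c + D + 2 \<le> w" "e + 2 * w + D2 + 2 * s + 2 * c + D + g \<le> w0"
      "w0 + g + th + s + c + D2 + w + e \<le> R1"
begin

lemma D_less: "D < D1" "D \<le> th"
  and D2_large: "D + th + s + c < D2"
  and w0_large: "e + w + D + D1 + 2 * s + 2 * c < w0"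
  and g_large: "D2 + e + s + c + th + th \<le> g"
  and R1_large: "w0 + g + th + s + c + D2 \<le> R1"
  and th_large: "2 * D + 2 * c + 2 \<le> th" "s = D1 + th + c"
  using params by linarith+

lemma p_lb: assumes "i \<le> n" "j \<le> n" shows "i \<le> j + d (p i) (p j)"
proof (cases "i \<le> j")
  case False
  then have "d (p j) (p i) = i - j" using geod[of j i] assms by simp
  then show ?thesis using d_sym[OF pV[OF assms(1)] pV[OF assms(2)]] by simp
qed simp

text \<open>Positions on a geodesic differ by at most the length of a detour through
  \<open>v\<close>; this is how differences of positions become lower bounds for distances.\<close>

lemma p_near_lb:
  assumes "v \<in> V" "i \<le> n" "j \<le> n" "d v (p j) \<le> m"
  shows "i \<le> j + m + d v (p i)" "j \<le> i + m + d v (p i)"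
proof -
  note P = pV[OF assms(2)] pV[OF assms(3)]
  have *: "d (p i) (p j) \<le> d v (p i) + m"
    using d_tri[OF P(1) assms(1) P(2)] d_sym[OF P(1) assms(1)] assms(4) by linarith
  show "i \<le> j + m + d v (p i)" using p_lb[OF assms(2,3)] * by linarith
  show "j \<le> i + m + d v (p i)" using p_lb[OF assms(3,2)] * d_sym[OF P] by linarith
qed

lemma conn_p: assumes "b \<le> n" shows "conn E (p ` {a..b})"
proof (cases "a \<le> b")
  case True
  then show ?thesis using assms
  proof (induction b rule: dec_induct)
    case (step b)
    have "(p b, p (Suc b)) \<in> E ^^ 1"
      using relpow_d[of "p b" "p (Suc b)"] geod[of b "Suc b"] pV[of b] pV[of "Suc b"] step(4) by simp
    then have "(p b, p (Suc b)) \<in> E" by simp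
    then have "conn E (p ` {a..b} \<union> {p (Suc b)})"
      using conn_Un_edge[of E "p ` {a..b}" "{p (Suc b)}" "p b" "p (Suc b)"] step(1,3,4) sym by simp
    moreover have "p ` {a..b} \<union> {p (Suc b)} = p ` {a..Suc b}" using step(1)
      by (auto simp: atLeastAtMostSuc_conv)
    ultimately show ?case by simp
  qed simp
qed simp

lemma p_sub: "b \<le> n \<Longrightarrow> p ` {a..b} \<subseteq> V"
  using pV by auto

section \<open>Two strands advancing along the geodesic\<close>

definition deep :: "nat \<Rightarrow> 'a \<Rightarrow> bool" where
  "deep m v \<longleftrightarrow> (\<forall>i\<le>n. m \<le> d v (p i))"

lemma deepD: "deep m v \<Longrightarrow> i \<le> n \<Longrightarrow> m \<le> d v (p i)"
  by (simp add: deep_def)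

lemma far_pI:
  assumes "\<And>v i. v \<in> S \<Longrightarrow> a \<le> i \<Longrightarrow> i \<le> b \<Longrightarrow> D < d v (p i)"
  shows "far E D S (p ` {a..b})"
  using assms by (auto simp: far_def)

text \<open>The strand \<open>A\<close> has reached the position \<open>a\<close> on the geodesic and \<open>B\<close> has reached the end,
  near position \<open>h\<close>, of its current lane \<open>L\<close>. Both stay away from what is still to be used: \<open>A\<close> from
  the positions after \<open>a\<close>, and \<open>B\<close> from the geodesic after \<open>a\<close> (by \<open>D1\<close>), from everything near
  positions after \<open>h\<close> and, outside \<open>L\<close>, from the zone before \<open>h\<close> in which the next lane starts.\<close>

definition state :: "'a set \<Rightarrow> 'a set \<Rightarrow> 'a set \<Rightarrow> nat \<Rightarrow> nat \<Rightarrow> bool" where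
  "state A B L a h \<longleftrightarrow> A \<subseteq> V \<and> B \<subseteq> V \<and> conn E A \<and> conn E B \<and> A \<inter> X \<noteq> {} \<and> B \<inter> X \<noteq> {} \<and>
     p a \<in> A \<and> h \<le> n \<and> L \<subseteq> B \<and> (\<forall>v\<in>L. deep (D1 + th) v) \<and> (\<exists>v\<in>L. d v (p h) \<le> s + c) \<and>
     far E D A B \<and>
     (\<forall>v\<in>B. \<forall>i\<le>n. a \<le> i + w \<longrightarrow> D1 \<le> d v (p i)) \<and>
     (\<forall>v\<in>A. \<forall>i\<le>n. a + g \<le> i \<longrightarrow> D2 \<le> d v (p i)) \<and>
     (\<forall>v\<in>B. \<forall>i\<le>n. h + g \<le> i \<longrightarrow> D2 \<le> d v (p i)) \<and>
     (\<forall>v\<in>B - L. \<forall>i\<le>n. h \<le> i + w0 \<longrightarrow> D2 \<le> d v (p i)) \<and>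
     a + g + w0 \<le> h"

text \<open>A lane starts before position \<open>h\<close>, so that it overlaps the lane ending at \<open>h\<close>, and ends at
  \<open>h'\<close>.\<close>

definition lane :: "'a set \<Rightarrow> nat \<Rightarrow> nat \<Rightarrow> bool" where
  "lane M h h' \<longleftrightarrow> M \<subseteq> V \<and> conn E M \<and> (\<forall>v\<in>M. deep (D1 + th) v) \<and>
     (\<forall>v\<in>M. \<exists>j\<le>n. d v (p j) \<le> s + c \<and> h \<le> j + w0 \<and> j \<le> h' + e) \<and>
     (\<exists>m\<in>M. \<exists>u\<le>n. d m (p u) \<le> s + c \<and> h \<le> u + w0 \<and> u + w0 \<le> h + e) \<and>
     (\<exists>m\<in>M. d m (p h') \<le> s + c) \<and> h + R1 \<le> h' \<and> h' \<le> n"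

text \<open>In the swap, \<open>B\<close> returns from the end of its lane to the geodesic at
  \<open>h\<close> and becomes the new \<open>A\<close>, while the old \<open>A\<close> runs along
  the geodesic to the start of \<open>M\<close>, about \<open>w0\<close> before \<open>h\<close>,
  and continues on \<open>M\<close> as the new \<open>B\<close>. The last clause says that the new
  \<open>A\<close> consists of old material and one segment; \<open>run\<close> needs this to keep
  it away from \<open>K\<close>.\<close>

lemma state_step:
  assumes st: "state A B L a h" and la: "lane M h h'"
  obtains A' B' a' where "state A' B' M a' h'" "a' \<le> h"
    "\<And>z. z \<in> A' \<Longrightarrow> z \<in> A \<or> (\<exists>v\<in>B. d v (p h) \<le> s + c \<and> z \<in> seg v (p h)) \<or> z \<in> B"
proof -
  from st have AV: "A \<subseteq> V" and BV: "B \<subseteq> V" and cA: "conn E A" and cB: "conn E B"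
    and AX: "A \<inter> X \<noteq> {}" and BX: "B \<inter> X \<noteq> {}" and pa: "p a \<in> A" and hn: "h \<le> n" and LB: "L \<subseteq> B"
    and Ld: "\<And>v. v \<in> L \<Longrightarrow> deep (D1 + th) v" and AB: "far E D A B"
    and I3: "\<And>v i. v \<in> B \<Longrightarrow> i \<le> n \<Longrightarrow> a \<le> i + w \<Longrightarrow> D1 \<le> d v (p i)"
    and I4: "\<And>v i. v \<in> A \<Longrightarrow> i \<le> n \<Longrightarrow> a + g \<le> i \<Longrightarrow> D2 \<le> d v (p i)"
    and I5: "\<And>v i. v \<in> B \<Longrightarrow> i \<le> n \<Longrightarrow> h + g \<le> i \<Longrightarrow> D2 \<le> d v (p i)"
    and I6: "\<And>v i. v \<in> B \<Longrightarrow> v \<notin> L \<Longrightarrow> i \<le> n \<Longrightarrow> h \<le> i + w0 \<Longrightarrow> D2 \<le> d v (p i)"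
    and ah: "a + g + w0 \<le> h" and Lh: "\<exists>v\<in>L. d v (p h) \<le> s + c"
    unfolding state_def by auto
  have agh: "a + g \<le> h" using ah by linarith
  obtain v1 where v1: "v1 \<in> L" "d v1 (p h) \<le> s + c" using Lh by auto
  from la have MV: "M \<subseteq> V" and cM: "conn E M" and Md: "\<And>v. v \<in> M \<Longrightarrow> deep (D1 + th) v"
    and Mp: "\<And>v. v \<in> M \<Longrightarrow> \<exists>j\<le>n. d v (p j) \<le> s + c \<and> h \<le> j + w0 \<and> j \<le> h' + e"
    and Mh: "\<exists>m\<in>M. d m (p h') \<le> s + c" and hh: "h + R1 \<le> h'" and hn': "h' \<le> n"
    unfolding lane_def by auto
  from la obtain m0 u0 where m0: "m0 \<in> M" "u0 \<le> n" "d m0 (p u0) \<le> s + c" "h \<le> u0 + w0" "u0 + w0 \<le> h + e"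
    unfolding lane_def by auto
  \<comment> \<open>Vertices of \<open>M\<close> are near positions from \<open>h - w0\<close> on.
    These are beyond \<open>a + g\<close>, where \<open>A\<close> keeps distance \<open>D2\<close>
    from the geodesic.\<close>
  have far_AM: "D2 \<le> s + c + d v m" if am: "v \<in> A" "m \<in> M" for v m
  proof -
    obtain j where j: "j \<le> n" "d m (p j) \<le> s + c" "h \<le> j + w0" using Mp[OF am(2)] by auto
    have "D2 \<le> d v (p j)" using I4[OF am(1) j(1)] j ah by linarith
    moreover have "v \<in> V" "m \<in> V" using am AV MV by auto
    ultimately show ?thesis using d_tri[OF \<open>v \<in> V\<close> \<open>m \<in> V\<close> pV[OF j(1)]] j(2) by linarith
  qed
  have Mfar: "i \<le> h' + e + s + c + d z (p i)" if zi: "z \<in> M" "i \<le> n" for z i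
  proof -
    obtain j where j: "j \<le> n" "d z (p j) \<le> s + c" "j \<le> h' + e" using Mp[OF zi(1)] by auto
    have "z \<in> V" using zi MV by auto
    then show ?thesis using p_near_lb(1)[OF _ zi(2) j(1,2)] j by linarith
  qed
  show thesis
  proof (cases "\<exists>v\<in>L. \<exists>m\<in>M. d v m \<le> th")
    case True
    then obtain v m where vm: "v \<in> L" "m \<in> M" "d v m \<le> th" by auto
    have vV: "v \<in> V" "m \<in> V" using vm LB BV MV by auto
    have sp: "z \<in> V" "d z m \<le> th" "d v z \<le> th" if "z \<in> seg v m" for z
      using that vm seg_le[OF that] seg_V by auto
    have sd: "D1 \<le> d z (p i)" if "z \<in> seg v m" "i \<le> n" for z i
      using deepD[OF Ld[OF vm(1)] that(2)] d_tri[OF vV(1) sp(1)[OF that(1)] pV[OF that(2)]] sp(3)[OF that(1)] by linarith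
    \<comment> \<open>The jump starts in \<open>B\<close>, which is at least \<open>D2\<close> away
      from positions after \<open>h + g\<close>. So the position \<open>j\<close> near its other end
      is below \<open>h + g\<close>, and \<open>z\<close> is near that position.\<close>
    have sfar: "i \<le> h + g + th + s + c + d z (p i)" if zi: "z \<in> seg v m" "i \<le> n" for z i
    proof -
      obtain j where j: "j \<le> n" "d m (p j) \<le> s + c" using Mp[OF vm(2)] by auto
      have "d v (p j) \<le> th + s + c" using d_tri[OF vV pV[OF j(1)]] j(2) vm(3) by linarith
      moreover have "h + g \<le> j \<Longrightarrow> D2 \<le> d v (p j)" using I5[of v j] vm LB j by auto
      ultimately have "j < h + g" using D2_large by linarith
      moreover have "d z (p j) \<le> th + s + c" using d_tri[OF sp(1)[OF zi(1)] vV(2) pV[OF j(1)]] sp(2)[OF zi(1)] j(2) by linarith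
      ultimately show ?thesis using p_near_lb(1)[OF sp(1)[OF zi(1)] zi(2) j(1), of "th + s + c"] by linarith
    qed
    let ?B = "B \<union> seg v m \<union> M"
    have c1: "conn E (B \<union> seg v m)" using conn_Un[OF cB conn_seg[OF vV], of v] vm LB vV sym by auto
    have c2: "conn E ?B" using conn_Un[OF c1 cM, of m] vV vm sym by auto
    have "far E D A (seg v m)"
    proof (rule farI)
      fix x z assume x: "x \<in> A" and z: "z \<in> seg v m"
      have xV: "x \<in> V" using x AV by auto
      show "D < d x z" using far_AM[OF x vm(2)] d_tri[OF xV sp(1)[OF z] vV(2)] sp(2)[OF z] D2_large by linarith
    qed
    moreover have "far E D A M"
    proof (rule farI)
      fix x z assume "x \<in> A" "z \<in> M"
      then have "D2 \<le> s + c + d x z" by (rule far_AM)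
      then show "D < d x z" using D2_large by linarith
    qed
    ultimately have fAB: "far E D A ?B" using AB by simp
    have "state A ?B M a h'"
      unfolding state_def
    proof (intro conjI ballI allI impI)
      show "A \<subseteq> V" "?B \<subseteq> V" "conn E A" "conn E ?B" "A \<inter> X \<noteq> {}" "?B \<inter> X \<noteq> {}" "p a \<in> A" "h' \<le> n"
        "M \<subseteq> ?B" "\<exists>v\<in>M. d v (p h') \<le> s + c" "far E D A ?B"
        using AV BV MV seg_V cA c2 AX BX pa hn' Mh fAB by auto
      show "a + g + w0 \<le> h'" using ah hh by auto
    next
      fix x assume "x \<in> M" then show "deep (D1 + th) x" by (rule Md)
    next
      fix x i assume x: "x \<in> ?B" and i: "i \<le> n" "a \<le> i + w"
      show "D1 \<le> d x (p i)"
        using x I3[of x i] sd[of x i] deepD[OF Md[of x], of i] i by auto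
    next
      fix x i assume x: "x \<in> A" and i: "i \<le> n" "a + g \<le> i"
      then show "D2 \<le> d x (p i)" using I4 by auto
    next
      fix x i assume x: "x \<in> ?B" and i: "i \<le> n" "h' + g \<le> i"
      consider "x \<in> B" | "x \<in> seg v m" | "x \<in> M" using x by auto
      then show "D2 \<le> d x (p i)"
      proof cases
        case 1
        have "h + g \<le> i" using i hh by linarith
        then show ?thesis using I5[OF 1 i(1)] by linarith
      next
        case 2 show ?thesis using sfar[OF 2 i(1)] i hh R1_large by linarith
      next
        case 3 show ?thesis using Mfar[OF 3 i(1)] i hh g_large by linarith
      qed
    next
      fix x i assume x: "x \<in> ?B - M" and i: "i \<le> n" "h' \<le> i + w0"
      consider "x \<in> B" | "x \<in> seg v m" using x by auto
      then show "D2 \<le> d x (p i)"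
      proof cases
        case 1
        have "h + g \<le> i" using i hh R1_large by linarith
        then show ?thesis using I5[OF 1 i(1)] by linarith
      next
        case 2 show ?thesis using sfar[OF 2 i(1)] i hh R1_large by linarith
      qed
    qed
    then show thesis using that[of A ?B a] ah by auto
  next
    case False
    then have LM: "th < d v m" if "v \<in> L" "m \<in> M" for v m using that by force
    have V0: "m0 \<in> V" "p u0 \<in> V" "p h \<in> V" "v1 \<in> V" using m0 MV pV hn v1 LB BV by auto
    have au: "a \<le> u0" using ah m0(4) by linarith
    let ?T = "seg (p u0) m0" and ?T' = "seg v1 (p h)"
    let ?B = "A \<union> p ` {a..u0} \<union> ?T \<union> M" and ?A = "B \<union> ?T'"
    have T: "z \<in> V" "d z (p u0) \<le> s + c" if "z \<in> ?T" for z
      using that seg_V seg_le'[OF that] V0 m0 d_sym[of m0 "p u0"] by auto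
    have T': "z \<in> V" "d z (p h) \<le> s + c" if "z \<in> ?T'" for z
      using that seg_V seg_le[OF that] v1 by auto
    have c1: "conn E (A \<union> p ` {a..u0})"
      using conn_Un[OF cA conn_p[OF m0(2)], of "p a" a] pa au sym by auto
    have c2: "conn E (A \<union> p ` {a..u0} \<union> ?T)"
      using conn_Un[OF c1 conn_seg[of "p u0" m0], of "p u0"] V0 au sym by auto
    have cB': "conn E ?B" using conn_Un[OF c2 cM, of m0] V0 m0 sym by auto
    have cA': "conn E ?A" using conn_Un[OF cB conn_seg[of v1 "p h"], of v1] V0 v1 LB sym by auto
    have Tfar: "i \<le> u0 + (s + c) + d z (p i)" if z: "z \<in> p ` {a..u0} \<union> ?T" "i \<le> n" for z i
    proof (cases "z \<in> ?T")
      case True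
      then show ?thesis using p_near_lb(1)[OF T(1) z(2) m0(2) T(2)] by simp
    next
      case False
      then obtain j where "z = p j" "j \<le> u0" using z by auto
      then show ?thesis using p_lb[OF z(2), of j] d_sym[OF pV[OF z(2)] pV[of j]] m0(2) by simp
    qed
    have T'far: "i \<le> h + (s + c) + d z (p i)" "h \<le> i + (s + c) + d z (p i)" if "z \<in> ?T'" "i \<le> n" for z i
      using p_near_lb[of z i h "s + c"] T'[OF that(1)] that hn by auto
    have f1: "far E D B A" using far_sym[OF AV BV AB] .
    have f2: "far E D ?T' A"
    proof (rule farI)
      fix z x assume z: "z \<in> ?T'" and x: "x \<in> A"
      have xV: "x \<in> V" using x AV by auto
      show "D < d z x" using I4[OF x hn agh] d_tri[OF xV T'(1)[OF z] V0(3)] d_sym[OF xV T'(1)[OF z]] T'(2)[OF z] D2_large by linarith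
    qed
    have f3: "far E D B (p ` {a..u0})"
    proof (rule far_pI)
      fix x i assume x: "x \<in> B" and i: "a \<le> i" "i \<le> u0"
      have "D1 \<le> d x (p i)" using I3[OF x, of i] i m0(2) by auto
      then show "D < d x (p i)" using D_less by linarith
    qed
    have f4: "far E D ?T' (p ` {a..u0})"
    proof (rule far_pI)
      fix z i assume z: "z \<in> ?T'" and i: "a \<le> i" "i \<le> u0"
      show "D < d z (p i)" using T'far(2)[OF z order_trans[OF i(2) m0(2)]] i m0(5) w0_large by linarith
    qed
    have f5: "far E D B ?T"
    proof (rule farI)
      fix x z assume x: "x \<in> B" and z: "z \<in> ?T"
      have xV: "x \<in> V" using x BV by auto
      show "D < d x z"
      proof (cases "x \<in> L")
        case True
        \<comment> \<open>The segment has length at most \<open>s + c = D1 + th + 2 * c\<close>. Its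
          ends are at distance at least \<open>D1 + th\<close> and more than \<open>th\<close> from
          \<open>x\<close>, so the surplus is more than \<open>th - 2 * c\<close>, which exceeds
          \<open>2 * D\<close>.\<close>
        show ?thesis using seg_far[OF z V0(2,1) xV] LM[OF True m0(1)] deepD[OF Ld[OF True] m0(2)]
            m0(3) d_sym[OF V0(1,2)] th_large by linarith
      next
        case False
        show ?thesis using I6[OF x False m0(2) m0(4)] d_tri[OF xV T(1)[OF z] V0(2)] T(2)[OF z] D2_large by linarith
      qed
    qed
    have f6: "far E D ?T' ?T"
    proof (rule farI)
      fix x z assume x: "x \<in> ?T'" and z: "z \<in> ?T"
      show "D < d x z" using T'far(2)[OF x m0(2)] d_tri[OF T'(1)[OF x] T(1)[OF z] V0(2)] T(2)[OF z] m0(5) w0_large by linarith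
    qed
    have f7: "far E D B M"
    proof (rule farI)
      fix x m assume x: "x \<in> B" and m: "m \<in> M"
      have xV: "x \<in> V" "m \<in> V" using x BV m MV by auto
      show "D < d x m"
      proof (cases "x \<in> L")
        case True
        show ?thesis using LM[OF True m] D_less by linarith
      next
        case False
        obtain j where j: "j \<le> n" "d m (p j) \<le> s + c" "h \<le> j + w0" using Mp[OF m] by auto
        show ?thesis using I6[OF x False j(1) j(3)] j(2) d_tri[OF xV pV[OF j(1)]] D2_large by linarith
      qed
    qed
    have f8: "far E D ?T' M"
    proof (rule farI)
      fix z m assume z: "z \<in> ?T'" and m: "m \<in> M"
      have mV: "m \<in> V" using m MV by auto
      show "D < d z m"
        using seg_far[OF z V0(4,3) mV] LM[OF v1(1) m] deepD[OF Md[OF m] hn] v1(2) d_sym[OF mV V0(4)]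
          d_sym[OF mV T'(1)[OF z]] th_large by linarith
    qed
    have st': "state ?A ?B M h h'"
      unfolding state_def
    proof (intro conjI ballI allI impI)
      show "?A \<subseteq> V" "?B \<subseteq> V" "conn E ?A" "conn E ?B" "?A \<inter> X \<noteq> {}" "?B \<inter> X \<noteq> {}" "p h \<in> ?A" "h' \<le> n"
        "M \<subseteq> ?B" "\<exists>v\<in>M. d v (p h') \<le> s + c"
        using AV BV MV seg_V cA' cB' AX BX hn' Mh p_sub[OF m0(2)] V0 by auto
      show "far E D ?A ?B" using f1 f2 f3 f4 f5 f6 f7 f8 by simp
      show "h + g + w0 \<le> h'" using hh R1_large by linarith
    next
      fix x assume "x \<in> M" then show "deep (D1 + th) x" by (rule Md)
    next
      fix x i assume x: "x \<in> ?B" and i: "i \<le> n" "h \<le> i + w"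
      consider "x \<in> A" | "x \<in> p ` {a..u0} \<union> ?T" | "x \<in> M" using x by blast
      then show "D1 \<le> d x (p i)"
      proof cases
        case 1
        have "a + g \<le> i" using i ah w0_large by linarith
        then show ?thesis using I4[OF 1 i(1)] D2_large th_large(2) by linarith
      next
        case 2 then show ?thesis using Tfar[OF 2 i(1)] i m0 w0_large by linarith
      next
        case 3 then show ?thesis using deepD[OF Md[OF 3] i(1)] by auto
      qed
    next
      fix x i assume x: "x \<in> ?A" and i: "i \<le> n" "h + g \<le> i"
      consider "x \<in> B" | "x \<in> ?T'" using x by auto
      then show "D2 \<le> d x (p i)"
      proof cases
        case 1 then show ?thesis using I5 i by auto
      next
        case 2 then show ?thesis using T'far(1)[OF 2 i(1)] i g_large by linarith
      qed
    next
      fix x i assume x: "x \<in> ?B" and i: "i \<le> n" "h' + g \<le> i"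
      consider "x \<in> A" | "x \<in> p ` {a..u0} \<union> ?T" | "x \<in> M" using x by blast
      then show "D2 \<le> d x (p i)"
      proof cases
        case 1
        have "a + g \<le> i" using i ah hh by linarith
        then show ?thesis using I4[OF 1 i(1)] by linarith
      next
        case 2 then show ?thesis using Tfar[OF 2 i(1)] i m0 hh w0_large g_large by linarith
      next
        case 3 then show ?thesis using Mfar[OF 3 i(1)] i g_large by linarith
      qed
    next
      fix x i assume x: "x \<in> ?B - M" and i: "i \<le> n" "h' \<le> i + w0"
      consider "x \<in> A" | "x \<in> p ` {a..u0} \<union> ?T" using x by blast
      then show "D2 \<le> d x (p i)"
      proof cases
        case 1
        have "a + g \<le> i" using i ah hh R1_large by linarith
        then show ?thesis using I4[OF 1 i(1)] by linarith
      next
        case 2 then show ?thesis using Tfar[OF 2 i(1)] i m0 hh w0_large R1_large by linarith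
      qed
    qed
    show thesis
    proof (rule that[OF st'])
      fix z assume "z \<in> ?A"
      moreover have "v1 \<in> B" using v1 LB by auto
      ultimately show "z \<in> A \<or> (\<exists>v\<in>B. d v (p h) \<le> s + c \<and> z \<in> seg v (p h)) \<or> z \<in> B"
        using v1(2) by blast
    qed simp
  qed
qed

end

section \<open>Finishing with a component that reaches \<open>Y\<close>\<close>

context geodesic
begin

text \<open>The bound is the least possible: a component outside the tube of radius \<open>s\<close>
  stays at distance at least \<open>s + 1\<close> from the geodesic.\<close>

definition ends_at :: "'a set \<Rightarrow> nat \<Rightarrow> bool" where
  "ends_at C i \<longleftrightarrow> i \<le> n \<and> (\<exists>b\<in>C. d b (p i) \<le> s + 1)"

lemma th_chain: "th3 + D + 2 \<le> D1" "D1 + th + c = s" "1 \<le> c" "th + c + 2 * D + 2 \<le> th2" "2 * th2 + 2 * D + c + 2 \<le> th3"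
  using params by linarith+

text \<open>Here \<open>K\<close> attaches to the geodesic at \<open>t\<close>. If \<open>B\<close>
  comes within \<open>th2\<close> of \<open>K\<close>, it jumps into \<open>K\<close> and
  \<open>A\<close> takes the rest of the geodesic. Otherwise \<open>A\<close> goes along the
  geodesic to \<open>t\<close> and enters \<open>K\<close>, while \<open>B\<close> returns to the
  geodesic at \<open>h\<close>, beyond \<open>t\<close>, and follows it to the end.\<close>

lemma final_state:
  assumes st: "state A B L a h" and K: "K \<subseteq> V" "conn E K" "K \<inter> Y \<noteq> {}"
    and Kd: "\<And>v. v \<in> K \<Longrightarrow> deep (s + 1) v" and m0: "m0 \<in> K" "t \<le> n" "d m0 (p t) \<le> s + 1"
    and at: "a \<le> t + w" and th: "t + w \<le> h" and J: "far E (th2 + D) A K"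
  shows "two_far D X Y"
proof -
  from st have AV: "A \<subseteq> V" and BV: "B \<subseteq> V" and cA: "conn E A" and cB: "conn E B"
    and AX: "A \<inter> X \<noteq> {}" and BX: "B \<inter> X \<noteq> {}" and pa: "p a \<in> A" and hn: "h \<le> n" and LB: "L \<subseteq> B"
    and AB: "far E D A B"
    and I3: "\<And>v i. v \<in> B \<Longrightarrow> i \<le> n \<Longrightarrow> a \<le> i + w \<Longrightarrow> D1 \<le> d v (p i)"
    and I4: "\<And>v i. v \<in> A \<Longrightarrow> i \<le> n \<Longrightarrow> a + g \<le> i \<Longrightarrow> D2 \<le> d v (p i)"
    and ah: "a + g + w0 \<le> h" and Lh: "\<exists>v\<in>L. d v (p h) \<le> s + c"
    unfolding state_def by auto
  obtain v1 where v1: "v1 \<in> L" "d v1 (p h) \<le> s + c" using Lh by auto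
  have an: "a \<le> n" using ah hn by linarith
  have V0: "m0 \<in> V" "p t \<in> V" "p h \<in> V" "v1 \<in> V" "p a \<in> V" using m0 K pV hn v1 LB BV an by auto
  have fBA: "far E D B A" using far_sym[OF AV BV AB] .
  have fAK: "D + th2 < d x y" if "x \<in> A" "y \<in> K" for x y using farD[OF J that] by simp
  show ?thesis
  proof (cases "\<exists>v\<in>B. \<exists>m\<in>K. d v m \<le> th2")
    case True
    then obtain v m where vm: "v \<in> B" "m \<in> K" "d v m \<le> th2" by auto
    have vV: "v \<in> V" "m \<in> V" using vm BV K by auto
    have sp: "z \<in> V" "d z m \<le> th2" if "z \<in> seg v m" for z
      using that vm seg_le[OF that] seg_V by auto
    let ?B = "B \<union> seg v m \<union> K" and ?A = "A \<union> p ` {a..n}"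
    have c1: "conn E (B \<union> seg v m)" using conn_Un[OF cB conn_seg[OF vV], of v] vm vV sym by auto
    have c2: "conn E ?B" using conn_Un[OF c1 K(2), of m] vV vm sym by auto
    have c3: "conn E ?A" using conn_Un[OF cA conn_p[of n a], of "p a"] pa an sym by auto
    have f1: "far E D (seg v m) A"
    proof (rule farI)
      fix z x assume x: "x \<in> A" and z: "z \<in> seg v m"
      have xV: "x \<in> V" using x AV by auto
      show "D < d z x" using fAK[OF x vm(2)] d_tri[OF xV sp(1)[OF z] vV(2)] sp(2)[OF z]
          d_sym[OF xV sp(1)[OF z]] by linarith
    qed
    have f2: "far E D K A" using fAK d_sym AV K by (intro farI) (metis add_lessD1 subsetD)
    have f3: "far E D B (p ` {a..n})"
    proof (rule far_pI)
      fix x i assume x: "x \<in> B" and i: "a \<le> i" "i \<le> n"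
      have "D1 \<le> d x (p i)" using I3[OF x i(2)] i by auto
      then show "D < d x (p i)" using D_less by linarith
    qed
    have f4: "far E D (seg v m) (p ` {a..n})"
    proof (rule far_pI)
      fix z i assume z: "z \<in> seg v m" and i: "a \<le> i" "i \<le> n"
      have "d m (p i) \<le> d z m + d z (p i)" using d_tri[OF vV(2) sp(1)[OF z] pV[OF i(2)]] d_sym[OF vV(2) sp(1)[OF z]] by simp
      then show "D < d z (p i)" using sp(2)[OF z] deepD[OF Kd[OF vm(2)] i(2)] th_chain by linarith
    qed
    have f5: "far E D K (p ` {a..n})"
    proof (rule far_pI)
      fix z i assume z: "z \<in> K" and i: "a \<le> i" "i \<le> n"
      show "D < d z (p i)" using deepD[OF Kd[OF z] i(2)] th_chain by linarith
    qed
    show ?thesis unfolding two_far_def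
    proof (intro exI conjI)
      show "?B \<subseteq> V" "?A \<subseteq> V" using AV BV K seg_V pV by auto
      show "conn E ?B" "conn E ?A" by fact+
      show "?B \<inter> X \<noteq> {}" "?A \<inter> X \<noteq> {}" "?B \<inter> Y \<noteq> {}" using AX BX K by auto
      have "p n \<in> ?A" using an by auto
      then show "?A \<inter> Y \<noteq> {}" using pn by blast
      show "far E D ?B ?A" using fBA f1 f2 f3 f4 f5 by simp
    qed
  next
    case False
    then have BK: "th2 < d v m" if "v \<in> B" "m \<in> K" for v m using that by force
    \<comment> \<open>\<open>A\<close> may have overshot \<open>t\<close> by up to \<open>w\<close>,
      so the stretch between \<open>a\<close> and \<open>t\<close> can run in either
      direction.\<close>
    let ?i = "min a t" and ?j = "max a t"
    have jn: "?j \<le> n" using an m0(2) by simp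
    let ?T = "seg (p t) m0" and ?T' = "seg v1 (p h)"
    let ?A = "A \<union> p ` {?i..?j} \<union> ?T \<union> K" and ?B = "B \<union> ?T' \<union> p ` {h..n}"
    have T: "z \<in> V" "d z (p t) \<le> s + 1" if "z \<in> ?T" for z
      using that seg_V seg_le'[OF that] V0 m0 d_sym[of m0 "p t"] by auto
    have T': "z \<in> V" "d z (p h) \<le> s + c" if "z \<in> ?T'" for z
      using that seg_V seg_le[OF that] v1 by auto
    have c1: "conn E (A \<union> p ` {?i..?j})"
      using conn_Un[OF cA conn_p[OF jn], of "p a" ?i] pa sym by auto
    have c2: "conn E (A \<union> p ` {?i..?j} \<union> ?T)"
      using conn_Un[OF c1 conn_seg[of "p t" m0], of "p t"] V0 sym by auto
    have cA': "conn E ?A" using conn_Un[OF c2 K(2), of m0] V0 m0 sym by auto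
    have c3: "conn E (B \<union> ?T')" using conn_Un[OF cB conn_seg[of v1 "p h"], of v1] V0 v1 LB sym by auto
    have cB': "conn E ?B" using conn_Un[OF c3 conn_p[of n h], of "p h"] V0 hn sym by auto
    have v1B: "v1 \<in> B" using v1 LB by auto
    let ?E = "?T' \<union> p ` {h..n}"
    have E: "z \<in> V" "h \<le> i + (s + c) + d z (p i)" if z: "z \<in> ?E" "i \<le> n" for z i
    proof -
      have "z \<in> V \<and> h \<le> i + (s + c) + d z (p i)"
      proof (cases "z \<in> ?T'")
        case True
        then show ?thesis using p_near_lb(2)[OF T'(1) z(2) hn T'(2)] T'(1) by simp
      next
        case False
        then obtain k where "z = p k" "h \<le> k" "k \<le> n" using z by auto
        then show ?thesis using p_lb[of k i] z(2) pV by simp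
      qed
      then show "z \<in> V" "h \<le> i + (s + c) + d z (p i)" by auto
    qed
    have wbig: "2 * s + 2 * c + D + 2 \<le> w" using params by linarith
    have jh: "?j + w \<le> h"
      using th ah w0_large g_large params(10,11) by (simp add: max_def)
    have f2: "far E D ?T' A"
    proof (rule farI)
      fix z x assume z: "z \<in> ?T'" and x: "x \<in> A"
      have xV: "x \<in> V" using x AV by auto
      have "D2 \<le> d x (p h)" using I4[OF x hn] ah by linarith
      then show "D < d z x" using d_tri[OF xV T'(1)[OF z] V0(3)] d_sym[OF xV T'(1)[OF z]] T'(2)[OF z] D2_large by linarith
    qed
    have f2': "far E D (p ` {h..n}) A"
    proof (rule farI)
      fix z x assume z: "z \<in> p ` {h..n}" and x: "x \<in> A"
      obtain i where i: "z = p i" "h \<le> i" "i \<le> n" using z by auto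
      have "D2 \<le> d x (p i)" using I4[OF x i(3)] ah i by linarith
      moreover have "x \<in> V" using x AV by auto
      ultimately show "D < d z x" using d_sym[OF _ pV[OF i(3)]] i(1) D2_large by fastforce
    qed
    have f3: "far E D B (p ` {?i..?j})"
    proof (rule far_pI)
      fix x i assume x: "x \<in> B" and i: "?i \<le> i" "i \<le> ?j"
      have "D1 \<le> d x (p i)" using I3[OF x, of i] i jn at by auto
      then show "D < d x (p i)" using D_less by linarith
    qed
    have f4: "far E D ?E (p ` {?i..?j})"
    proof (rule far_pI)
      fix z i assume z: "z \<in> ?E" and i: "?i \<le> i" "i \<le> ?j"
      show "D < d z (p i)" using E(2)[OF z order_trans[OF i(2) jn]] i(2) jh wbig by linarith
    qed
    have f5: "far E D B ?T"
    proof (rule farI)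
      fix x z assume x: "x \<in> B" and z: "z \<in> ?T"
      have xV: "x \<in> V" using x BV by auto
      have "D1 \<le> d x (p t)" using I3[OF x m0(2) at] .
      then show "D < d x z" using seg_far[OF z V0(2,1) xV] BK[OF x m0(1)]
            m0(3) d_sym[OF V0(1,2)] th_chain(2,4) by linarith
    qed
    have f6: "far E D ?E ?T"
    proof (rule farI)
      fix x z assume x: "x \<in> ?E" and z: "z \<in> ?T"
      show "D < d x z" using E(2)[OF x m0(2)] d_tri[OF E(1)[OF x m0(2)] T(1)[OF z] V0(2)] T(2)[OF z] th wbig th_chain(3) by linarith
    qed
    have f7: "far E D B K" using BK th_chain by (intro farI) fastforce
    have f8: "far E D ?T' K"
    proof (rule farI)
      fix z m assume z: "z \<in> ?T'" and m: "m \<in> K"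
      have mV: "m \<in> V" using m K by auto
      show "D < d z m"
        using seg_far[OF z V0(4,3) mV] BK[OF v1B m] deepD[OF Kd[OF m] hn] v1(2) d_sym[OF mV V0(4)]
          d_sym[OF mV T'(1)[OF z]] th_chain(4) by linarith
    qed
    have f8': "far E D (p ` {h..n}) K"
    proof (rule farI)
      fix x z assume x: "x \<in> p ` {h..n}" and z: "z \<in> K"
      obtain k where k: "x = p k" "h \<le> k" "k \<le> n" using x by auto
      have "z \<in> V" using z K by auto
      then show "D < d x z" using deepD[OF Kd[OF z] k(3)] d_sym[OF _ pV[OF k(3)], of z] th_chain(1,2) k(1) by simp
    qed
    show ?thesis unfolding two_far_def
    proof (intro exI conjI)
      show "?B \<subseteq> V" "?A \<subseteq> V" using AV BV K seg_V pV jn by auto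
      show "conn E ?B" "conn E ?A" by fact+
      show "?B \<inter> X \<noteq> {}" "?A \<inter> X \<noteq> {}" "?A \<inter> Y \<noteq> {}" using AX BX K by auto
      have "p n \<in> ?B" using hn by auto
      then show "?B \<inter> Y \<noteq> {}" using pn by blast
      show "far E D ?B ?A" using fBA f2 f2' f3 f4 f5 f6 f7 f8 f8' by simp
    qed
  qed
qed

section \<open>The tube around the geodesic and the components outside it\<close>

definition N :: "'a set" where
  "N = {v \<in> V. \<exists>i\<le>n. d v (p i) \<le> s}"

definition is_comp :: "'a set \<Rightarrow> bool" where
  "is_comp C \<longleftrightarrow> (\<exists>v\<in>V - N. C = ccomp (V - N) v)"

lemma is_compD:
  assumes "is_comp C"
  shows "C \<subseteq> V" "C \<inter> N = {}" "conn E C" "C \<noteq> {}"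
    and "u \<in> C \<Longrightarrow> (u, v) \<in> E \<Longrightarrow> v \<notin> C \<Longrightarrow> v \<in> N"
proof -
  obtain x where x: "x \<in> V - N" "C = ccomp (V - N) x" using assms by (auto simp: is_comp_def)
  show "C \<subseteq> V" "C \<inter> N = {}" using x ccomp_sub[OF x(1)] by auto
  show "conn E C" using conn_ccomp[OF x(1)] x by simp
  show "C \<noteq> {}" using x ccomp_self[of x "V - N"] by blast
  show "v \<in> N" if "u \<in> C" "(u, v) \<in> E" "v \<notin> C"
    using ccomp_step[OF x(1), of u v] that x E_V(2) by blast
qed

lemma comp_deep: "is_comp C \<Longrightarrow> v \<in> C \<Longrightarrow> deep (s + 1) v"
proof -
  assume "is_comp C" "v \<in> C"
  then have "v \<in> V" "v \<notin> N" using is_compD(1,2)[of C] by auto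
  then have "s < d v (p i)" if "i \<le> n" for i using that by (auto simp: N_def dest!: spec[of _ i])
  then show "deep (s + 1) v" by (simp add: deep_def Suc_le_eq)
qed

lemma p_in_N: "i \<le> n \<Longrightarrow> p i \<in> N"
  using pV by (auto simp: N_def intro!: exI[of _ i])

lemma conn_N: "conn E N"
proof -
  have "N = (\<Union>i\<in>{..n}. cball (p i) s \<union> p ` {0..n})"
    using pV d_sym by (fastforce simp: N_def cball_def)
  moreover have "conn E (\<Union>i\<in>{..n}. cball (p i) s \<union> p ` {0..n})"
  proof (rule conn_UN[OF sym, where c = "p 0"])
    fix i assume "i \<in> {..n}"
    then show "conn E (cball (p i) s \<union> p ` {0..n})"
      using conn_Un[OF conn_cball[of "p i" s] conn_p[of n 0], of "p i"] pV sym by auto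
  qed auto
  ultimately show ?thesis by simp
qed

lemma conn_Diff_is_comp:
  assumes "is_comp C" shows "conn E (V - C)"
proof -
  obtain x where x: "x \<in> V - N" "C = ccomp (V - N) x" using assms by (auto simp: is_comp_def)
  have "N \<subseteq> V" "N \<noteq> {}" using p_in_N[of 0] by (auto simp: N_def)
  then show ?thesis using conn_Diff_ccomp[OF conn_N _ _ x(1)] x by simp
qed

lemma in_comp: assumes "v \<in> V - N" obtains C where "is_comp C" "v \<in> C"
  using assms unfolding is_comp_def by (metis ccomp_self)

text \<open>A geodesic from \<open>v\<close> to \<open>z\<close> leaves \<open>C\<close> into the
  tube, next to a position where \<open>C\<close> attaches. Hence what is close to \<open>C\<close>
  from outside is close to such a position.\<close>

lemma comp_exit:
  assumes C: "is_comp C" and v: "v \<in> C" and z: "z \<in> V" "z \<notin> C"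
  obtains i where "ends_at C i" "d z (p i) \<le> d v z + s + 1"
proof -
  have vV: "v \<in> V" using is_compD(1)[OF C] v by auto
  obtain b y where b: "b \<in> C" "y \<notin> C" "(b, y) \<in> E" "b \<in> seg v z" "y \<in> seg v z"
    using exit_point[OF v z vV] by metis
  have "y \<in> N" using is_compD(5)[OF C b(1,3,2)] .
  then obtain i where i: "i \<le> n" "d y (p i) \<le> s" by (auto simp: N_def)
  have yV: "y \<in> V" "b \<in> V" using b seg_V by auto
  have "d b (p i) \<le> s + 1" using d_tri[OF yV(2,1) pV[OF i(1)]] d_edge[OF b(3)] i(2) by linarith
  moreover have "d z (p i) \<le> d v z + s + 1"
    using d_tri[OF z(1) yV(1) pV[OF i(1)]] seg_le'[OF b(5) vV z(1)] i(2)
      seg_le(2)[OF b(5)] d_sym[OF z(1) yV(1)] by linarith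
  ultimately show thesis using that[of i] i b by (auto simp: ends_at_def)
qed

lemma comp_neighbour:
  assumes C: "is_comp C" and "u \<in> C" "(u, v) \<in> E" "v \<in> V" "d v (p i) \<le> s" "i \<le> n"
  shows "ends_at C i"
proof -
  have "u \<in> V" using is_compD(1)[OF C] assms by auto
  then have "d u (p i) \<le> s + 1" using d_tri[of u v "p i"] pV[OF assms(6)] assms d_edge[OF assms(3)] by auto
  then show ?thesis using assms by (auto simp: ends_at_def)
qed

end

text \<open>A discrete intermediate value argument: \<open>f\<close> moves by at most
  \<open>e\<close> per step, so some stretch of the chain crosses from \<open>\<alpha>\<close> to
  \<open>\<beta>\<close> inside a window with margin \<open>e\<close>. The margin is added on the
  other side to avoid truncated subtraction.\<close>

lemma rtrancl_crossing:
  fixes f :: "'b \<Rightarrow> nat"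
  assumes "(x, y) \<in> r\<^sup>*" "f x \<le> \<alpha>" "\<beta> \<le> f y" "\<alpha> < \<beta>"
    and step: "\<And>y z. (y, z) \<in> r \<Longrightarrow> f y \<le> f z + e \<and> f z \<le> f y + e"
  defines "Q \<equiv> {z. \<alpha> \<le> f z + e \<and> f z \<le> \<beta> + e}"
  shows "\<exists>x' y'. (x', y') \<in> (r \<inter> Q \<times> Q)\<^sup>* \<and> f x' \<le> \<alpha> \<and> \<beta> \<le> f y' \<and> x' \<in> Q \<and> y' \<in> Q"
    (is ?goal)
proof (rule ccontr)
  assume neg: "\<not> ?goal"
  \<comment> \<open>Invariant of a chain without a crossing: \<open>f\<close> is still below
    \<open>\<beta>\<close> and, whenever it is above \<open>\<alpha>\<close>, the current point is
    reached inside \<open>Q\<close> from a point at or below \<open>\<alpha>\<close>.\<close>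
  have "f y < \<beta> \<and> (\<alpha> < f y \<longrightarrow> (\<exists>x'. x' \<in> Q \<and> f x' \<le> \<alpha> \<and> (x', y) \<in> (r \<inter> Q \<times> Q)\<^sup>*))"
    using assms(1)
  proof (induction rule: rtrancl_induct)
    case base then show ?case using assms by auto
  next
    case (step y z)
    note st = assms(5)[OF step(2)]
    show ?case
    proof (cases "\<alpha> < f z")
      case True
      have zQ: "z \<in> Q" using st step True by (auto simp: Q_def)
      obtain x' where x': "x' \<in> Q" "f x' \<le> \<alpha>" "(x', y) \<in> (r \<inter> Q \<times> Q)\<^sup>*" "y \<in> Q"
      proof (cases "\<alpha> < f y")
        case True
        then have "y \<in> Q" using step by (auto simp: Q_def)
        then show thesis using step True that by auto
      next
        case False
        then have "y \<in> Q" using st \<open>\<alpha> < f z\<close> assms(4) by (auto simp: Q_def)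
        then show thesis using that[of y] False by auto
      qed
      then have "(x', z) \<in> (r \<inter> Q \<times> Q)\<^sup>*" using step(2) zQ by (auto intro: rtrancl_into_rtrancl)
      then show ?thesis using neg x' zQ by (metis not_le)
    qed (use assms in auto)
  qed
  then show False using assms by auto
qed

section \<open>Lanes along the boundary of a component\<close>

context geodesic
begin

text \<open>The distance from \<open>b\<close> to \<open>p i\<close> is exactly
  \<open>s + 1\<close>, so the next vertex on a geodesic to \<open>p i\<close> is in the
  tube.\<close>

lemma ends_at_bdry:
  assumes C: "is_comp C" and b: "b \<in> C" "d b (p i) \<le> s + 1" "i \<le> n"
  shows "b \<in> bdry E C (V - C)"
proof -
  have bV: "b \<in> V" using is_compD(1)[OF C] b by auto
  have "d (p i) b = Suc s"
    using deepD[OF comp_deep[OF C b(1)] b(3)] b(2) d_sym[OF bV pV[OF b(3)]] by linarith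
  then obtain u where u: "u \<in> V" "(u, b) \<in> E" "d (p i) u = s" using d_pred[OF pV[OF b(3)] bV] by metis
  have "u \<in> N" using u b(3) d_sym[OF u(1) pV[OF b(3)]] by (auto simp: N_def)
  then have "u \<in> V - C" using is_compD(2)[OF C] u by auto
  then show ?thesis using b(1) E_sym[OF u(2)] by (auto simp: bdry_def)
qed

text \<open>Since \<open>C\<close> and its complement are connected, \<open>cutc\<close> gives a
  chain of short jumps in the inner boundary of \<open>C\<close> from near position \<open>i\<close>
  to near position \<open>j\<close>. The lane is a part of it that crosses from about
  \<open>h - w0\<close> to \<open>h + R\<close>, thickened by balls of radius
  \<open>l\<close>.\<close>

lemma lane_from_comp:
  assumes C: "is_comp C" and i: "ends_at C i" "i + w0 \<le> h"
    and j: "ends_at C j" "h + R + 2 * s + 2 \<le> j" and R: "R1 \<le> R"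
  obtains M h' where "lane M h h'" "h + R \<le> h'" "h' \<le> h + R + e"
proof -
  let ?B = "bdry E C (V - C)"
  \<comment> \<open>A coordinate along the geodesic for boundary vertices. One jump of length
    \<open>l\<close> changes it by at most \<open>l + 2 * (s + 1) = e\<close>, which is the origin
    of \<open>e\<close>.\<close>
  define f where "f b = (SOME i. i \<le> n \<and> d b (p i) \<le> s + 1)" for b
  let ?r = "near E l ?B"
  have CV: "C \<subseteq> V" by (rule is_compD[OF C])
  have BV: "?B \<subseteq> V" and BC: "?B \<subseteq> C" using CV by (auto simp: bdry_def)
  have f: "f b \<le> n \<and> d b (p (f b)) \<le> s + 1" if bB: "b \<in> ?B" for b
  proof -
    obtain u where u: "b \<in> C" "u \<in> V" "u \<notin> C" "(b, u) \<in> E" using bB by (auto simp: bdry_def)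
    then have "u \<in> N" using is_compD(5)[OF C] by metis
    then obtain i where i: "i \<le> n" "d u (p i) \<le> s" by (auto simp: N_def)
    then have "d b (p i) \<le> s + 1"
      using d_tri[OF E_V[OF u(4)] pV[OF i(1)]] d_edge[OF u(4)] by linarith
    then have "\<exists>i. i \<le> n \<and> d b (p i) \<le> s + 1" using i by blast
    then show ?thesis unfolding f_def by (rule someI_ex)
  qed
  have step: "f y \<le> f z + e" if yz: "(y, z) \<in> ?r" for y z
  proof -
    have yz': "y \<in> ?B" "z \<in> ?B" "d y z \<le> l" using yz by (auto simp: near_def)
    then have V: "y \<in> V" "z \<in> V" using BV by auto
    note fy = f[OF yz'(1)] and fz = f[OF yz'(2)]
    have "d y (p (f z)) \<le> l + (s + 1)" using d_tri[OF V pV[of "f z"]] fz yz'(3) by linarith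
    then show ?thesis using p_near_lb(1)[of y "f y" "f z" "l + (s + 1)"] V fy fz params(7) by auto
  qed
  have r_sym: "(z, y) \<in> ?r" if "(y, z) \<in> ?r" for y z
    using that d_sym[of y z] subsetD[OF BV, of y] subsetD[OF BV, of z] by (simp add: near_def)
  obtain b where b: "b \<in> C" "d b (p i) \<le> s + 1" "i \<le> n" using i by (auto simp: ends_at_def)
  obtain b' where b': "b' \<in> C" "d b' (p j) \<le> s + 1" "j \<le> n" using j by (auto simp: ends_at_def)
  have bB: "b \<in> ?B" "b' \<in> ?B" using ends_at_bdry[OF C] b b' by auto
  have "(b, b') \<in> ?r\<^sup>*"
    using cutc bB is_compD(3)[OF C] conn_Diff_is_comp[OF C] CV unfolding cut_conn_def by blast
  \<comment> \<open>With the margin \<open>e\<close> of the crossing, the lane starts between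
    \<open>h - w0\<close> and \<open>h - w0 + e\<close>, as \<open>lane\<close> prescribes. The
    subtraction is exact because \<open>i + w0 \<le> h\<close>.\<close>
  moreover define \<alpha> where "\<alpha> = h + e - w0"
  have \<alpha>: "\<alpha> + w0 = h + e" using i unfolding \<alpha>_def by linarith
  have "f b \<le> \<alpha>"
  proof -
    have "f b \<le> i + (s + 1) + d b (p (f b))" using p_near_lb(1)[of b "f b" i "s + 1"] f[OF bB(1)] b bB BV by auto
    then show ?thesis using f[OF bB(1)] i(2) \<alpha> params(7) by linarith
  qed
  moreover have "h + R \<le> f b'"
  proof -
    have "j \<le> f b' + (s + 1) + d b' (p j)" using p_near_lb(1)[of b' j "f b'" "s + 1"] f[OF bB(2)] b' bB BV by auto
    then show ?thesis using b'(2) j(2) by linarith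
  qed
  moreover have "\<alpha> < h + R" using \<alpha> w0_large R1_large R by linarith
  moreover have st: "\<And>y z. (y, z) \<in> ?r \<Longrightarrow> f y \<le> f z + e \<and> f z \<le> f y + e"
    using step r_sym by blast
  moreover define Q where "Q = {z. \<alpha> \<le> f z + e \<and> f z \<le> h + R + e}"
  ultimately have "\<exists>x' y'. (x', y') \<in> (?r \<inter> Q \<times> Q)\<^sup>* \<and> f x' \<le> \<alpha> \<and> h + R \<le> f y' \<and> x' \<in> Q \<and> y' \<in> Q"
    using rtrancl_crossing[of b b' ?r f \<alpha> "h + R" e] by simp
  then obtain x' y' where xy: "(x', y') \<in> (?r \<inter> Q \<times> Q)\<^sup>*" "f x' \<le> \<alpha>" "h + R \<le> f y'" "x' \<in> Q" "y' \<in> Q"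
    by blast
  have ne: "x' \<noteq> y'" using xy \<open>\<alpha> < h + R\<close> by auto
  define Z where "Z = {z. (x', z) \<in> (?r \<inter> Q \<times> Q)\<^sup>*}"
  have x'B: "x' \<in> ?B"
    by (rule converse_rtranclE[OF xy(1)]) (use ne in \<open>simp_all add: near_def\<close>)
  have Z: "z \<in> ?B \<and> z \<in> Q" if "z \<in> Z" for z
  proof -
    have "(x', z) \<in> (?r \<inter> Q \<times> Q)\<^sup>*" using that by (simp add: Z_def)
    then show ?thesis by (induction rule: rtrancl_induct) (use x'B xy in \<open>auto simp: near_def\<close>)
  qed
  have ZV: "Z \<subseteq> V" using Z BV by auto
  define M where "M = (\<Union>z\<in>Z. cball z l)"
  have cM: "conn E M" unfolding M_def
  proof (rule conn_chain_balls[OF ZV])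
    show "x' \<in> Z" by (simp add: Z_def)
    fix z assume "z \<in> Z"
    then have "(x', z) \<in> (?r \<inter> Q \<times> Q)\<^sup>*" by (simp add: Z_def)
    then show "(x', z) \<in> (near E l Z)\<^sup>*"
    proof (induction rule: rtrancl_induct)
      case (step y z)
      then have "y \<in> Z" "z \<in> Z" by (auto simp: Z_def intro: rtrancl_into_rtrancl)
      then have "(y, z) \<in> near E l Z" using step by (auto simp: near_def)
      with step.IH show ?case by (rule rtrancl_into_rtrancl)
    qed simp
  qed
  have ZM: "Z \<subseteq> M" using ZV by (auto simp: M_def intro!: cball_self)
  have near_z: "\<exists>z\<in>Z. z \<in> V \<and> d v z \<le> l" if vM: "v \<in> M" for v
  proof -
    obtain z where z: "z \<in> Z" "v \<in> V" "d z v \<le> l" using vM by (auto simp: M_def cball_def)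
    then have "z \<in> V" using ZV by auto
    then show ?thesis using z d_sym[of z v] by (intro bexI[of _ z]) simp_all
  qed
  have lc: "l + s + 1 = s + c" using params(1) by simp
  have "lane M h (f y')"
    unfolding lane_def
  proof (intro conjI ballI)
    show "M \<subseteq> V" by (auto simp: M_def cball_def)
    show "conn E M" by (rule cM)
  next
    fix v assume v: "v \<in> M"
    then obtain z where z: "z \<in> Z" "z \<in> V" "d v z \<le> l" using near_z by blast
    have vV: "v \<in> V" using v by (auto simp: M_def cball_def)
    show "deep (D1 + th) v" unfolding deep_def
    proof (intro allI impI)
      fix i assume i: "i \<le> n"
      have "s + 1 \<le> d z (p i)" using deepD[OF comp_deep[OF C] i] Z[OF z(1)] BC by blast
      then show "D1 + th \<le> d v (p i)" using d_tri[OF z(2) vV pV[OF i]] d_sym[OF z(2) vV] z(3) lc th_chain(2) by linarith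
    qed
    have fz: "f z \<le> n" "d z (p (f z)) \<le> s + 1" using f Z[OF z(1)] by auto
    have "d v (p (f z)) \<le> s + c" using d_tri[OF vV z(2) pV[OF fz(1)]] fz(2) z(3) lc by linarith
    moreover have "h \<le> f z + w0" "f z \<le> f y' + e" using Z[OF z(1)] \<alpha> xy(3) by (auto simp: Q_def)
    ultimately show "\<exists>j\<le>n. d v (p j) \<le> s + c \<and> h \<le> j + w0 \<and> j \<le> f y' + e" using fz(1) by blast
  next
    have "x' \<in> Z" by (simp add: Z_def)
    moreover have "f x' \<le> n" "d x' (p (f x')) \<le> s + c" using f[OF x'B] lc by auto
    moreover have "h \<le> f x' + w0" "f x' + w0 \<le> h + e" using xy(2,4) \<alpha> by (auto simp: Q_def)
    ultimately show "\<exists>m\<in>M. \<exists>u\<le>n. d m (p u) \<le> s + c \<and> h \<le> u + w0 \<and> u + w0 \<le> h + e"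
      using ZM by blast
  next
    have "y' \<in> Z" using xy(1) by (simp add: Z_def)
    moreover have y': "f y' \<le> n" "d y' (p (f y')) \<le> s + c" using f[of y'] Z[OF calculation] lc by auto
    ultimately show "\<exists>m\<in>M. d m (p (f y')) \<le> s + c" using ZM by blast
    show "f y' \<le> n" by (rule y')
    show "h + R1 \<le> f y'" using xy(3) R by linarith
  qed
  then show thesis using that xy(3,5) by (auto simp: Q_def)
qed

text \<open>The geodesic is as short as any connection of \<open>X\<close> and \<open>Y\<close>, so
  a vertex of \<open>X\<close> cannot offer a shortcut to a late position.\<close>

lemma X_N: assumes "x \<in> X" "i \<le> n" "d x (p i) \<le> s" shows "i \<le> s"
proof -
  have "x \<in> V" using assms XV by auto
  then have "n \<le> d x (p i) + d (p i) (p n)"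
    using short[OF assms(1) pn] d_tri[OF _ pV[OF assms(2)] pV[of n], of x] by simp
  then show ?thesis using geod[OF assms(2)] assms by simp
qed

lemma Y_N: assumes "y \<in> Y" "i \<le> n" "d y (p i) \<le> s" shows "n \<le> i + s"
proof -
  have yV: "y \<in> V" using assms YV by auto
  then have "n \<le> d (p 0) (p i) + d (p i) y"
    using short[OF p0 assms(1)] d_tri[OF pV[of 0] pV[OF assms(2)] yV] by simp
  then show ?thesis using geod[of 0 i] assms d_sym[OF yV pV[OF assms(2)]] by simp
qed

text \<open>Suppose that no component attaches on both sides of \<open>h\<close>. The set
  \<open>S\<close> misses the tube near \<open>h\<close>, and a component that it enters from the
  left leads back to the left. So \<open>S\<close> stays in the left part \<open>Lf\<close>, which
  contains no vertex of \<open>Y\<close> in \<open>S\<close>, because of \<open>Y_N\<close>,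
  \<open>noXY\<close> and \<open>t\<close>.\<close>

lemma lane_exists:
  assumes hn: "h \<le> n" and S: "S \<subseteq> V" "conn E S" "S \<inter> X \<noteq> {}" "S \<inter> Y \<noteq> {}"
    and Sr: "\<And>v. v \<in> S \<Longrightarrow> r < d v (p h)" and r: "w0 + s \<le> r" "R + 3 * s + 2 \<le> r"
    and noXY: "\<And>C. is_comp C \<Longrightarrow> C \<inter> X = {} \<or> C \<inter> Y = {}"
    and q: "\<And>C i. is_comp C \<Longrightarrow> C \<inter> X \<noteq> {} \<Longrightarrow> ends_at C i \<Longrightarrow> i \<le> h"
    and t: "\<And>C i. is_comp C \<Longrightarrow> C \<inter> Y \<noteq> {} \<Longrightarrow> ends_at C i \<Longrightarrow> h < i + w0"
    and R: "R1 \<le> R"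
  obtains M h' where "lane M h h'" "h + R \<le> h'" "h' \<le> h + R + e"
proof -
  have w0s: "s < w0" "2 * s + 2 \<le> w0" using w0_large params(7) by linarith+
  have w0R: "w0 \<le> R" using R1_large R by linarith
  have "\<exists>C i j. is_comp C \<and> ends_at C i \<and> i + w0 \<le> h \<and> ends_at C j \<and> h + R + 2 * s + 2 \<le> j"
  proof (rule ccontr)
    assume neg: "\<not> ?thesis"
    \<comment> \<open>A vertex of \<open>S\<close> in the tube has distance more than
      \<open>r\<close> from \<open>p h\<close>, so its position is more than \<open>r - s\<close>
      away from \<open>h\<close>.\<close>
    have side: "i + w0 \<le> h \<or> h + R + 2 * s + 2 \<le> i"
      if v: "v \<in> S" "i \<le> n" "d v (p i) \<le> s" for v i
    proof -
      have vV: "v \<in> V" using v S by auto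
      have lt: "r < s + d (p i) (p h)"
        using Sr[OF v(1)] d_tri[OF vV pV[OF v(2)] pV[OF hn]] v(3) by linarith
      show ?thesis
      proof (cases "i \<le> h")
        case True
        then have "d (p i) (p h) = h - i" using geod hn by simp
        then show ?thesis using lt r True by linarith
      next
        case False
        then have "d (p i) (p h) = i - h" using geod[of h i] v(2) d_sym[OF pV[OF v(2)] pV[OF hn]] by simp
        then show ?thesis using lt r False by linarith
      qed
    qed
    define Lf where "Lf = {u. \<exists>i\<le>n. d u (p i) \<le> s \<and> i + w0 \<le> h} \<union>
        \<Union>{C. is_comp C \<and> (C \<inter> X \<noteq> {} \<or> (\<exists>i. ends_at C i \<and> i + w0 \<le> h))}"
    obtain x where x: "x \<in> S" "x \<in> X" using S by auto
    have xL: "x \<in> Lf"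
    proof (cases "x \<in> N")
      case True
      then obtain i where i: "i \<le> n" "d x (p i) \<le> s" by (auto simp: N_def)
      have "i \<le> s" using X_N[OF x(2) i] .
      then have "i + w0 \<le> h" using side[OF x(1) i] w0s w0R by linarith
      then show ?thesis using i by (auto simp: Lf_def)
    next
      case False
      then obtain C where "is_comp C" "x \<in> C" using in_comp[of x] x S by blast
      then show ?thesis using x unfolding Lf_def by blast
    qed
    have SL: "S \<subseteq> Lf"
    proof (rule conn_closed_subset[OF S(2) x(1) xL])
      fix u v assume u: "u \<in> S" "u \<in> Lf" and v: "v \<in> S" and uv: "(u, v) \<in> E"
      have V: "u \<in> V" "v \<in> V" using u v S by auto
      from u(2) consider i where "i \<le> n" "d u (p i) \<le> s" "i + w0 \<le> h"
        | C where "is_comp C" "u \<in> C" "C \<inter> X \<noteq> {} \<or> (\<exists>i. ends_at C i \<and> i + w0 \<le> h)"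
        unfolding Lf_def by blast
      then show "v \<in> Lf"
      proof cases
        case 1
        show ?thesis
        proof (cases "v \<in> N")
          case True
          then obtain j where j: "j \<le> n" "d v (p j) \<le> s" by (auto simp: N_def)
          have "d v (p i) \<le> s + 1"
            using d_tri[OF V(2,1) pV[OF 1(1)]] d_edge[OF E_sym[OF uv]] 1 by linarith
          then have "j \<le> i + s + s + 1" using p_near_lb(2)[OF V(2) 1(1) j] by linarith
          then have "j + w0 \<le> h" using side[OF v j] 1 w0s by linarith
          then show ?thesis using j by (auto simp: Lf_def)
        next
          case False
          then obtain C where C: "is_comp C" "v \<in> C" using in_comp[of v] V by blast
          have "ends_at C i" using comp_neighbour[OF C E_sym[OF uv] V(1) 1(2,1)] .
          then show ?thesis using C 1 unfolding Lf_def by blast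
        qed
      next
        case 2
        show ?thesis
        proof (cases "v \<in> C")
          case True
          then show ?thesis using 2 unfolding Lf_def by blast
        next
          case False
          then have "v \<in> N" using is_compD(5)[OF 2(1,2) uv] by simp
          then obtain j where j: "j \<le> n" "d v (p j) \<le> s" by (auto simp: N_def)
          have ej: "ends_at C j" using comp_neighbour[OF 2(1,2) uv V(2) j(2,1)] .
          have "\<not> h + R + 2 * s + 2 \<le> j"
          proof
            assume a: "h + R + 2 * s + 2 \<le> j"
            show False
            proof (cases "C \<inter> X \<noteq> {}")
              case True
              then show False using q[OF 2(1) True ej] a by linarith
            next
              case False
              then show False using 2 neg ej a by blast
            qed
          qed
          then have "j + w0 \<le> h" using side[OF v j] by blast
          then show ?thesis using j by (auto simp: Lf_def)
        qed
      qed
    qed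
    obtain y where y: "y \<in> S" "y \<in> Y" using S by auto
    then have "y \<in> Lf" using SL by auto
    then consider i where "i \<le> n" "d y (p i) \<le> s" "i + w0 \<le> h"
        | C where "is_comp C" "y \<in> C" "C \<inter> X \<noteq> {} \<or> (\<exists>i. ends_at C i \<and> i + w0 \<le> h)"
        unfolding Lf_def by blast
    then show False
    proof cases
      case 1
      then show False using Y_N[OF y(2) 1(1,2)] w0s hn by linarith
    next
      case 2
      then have CY: "C \<inter> Y \<noteq> {}" using y by blast
      then obtain i where "ends_at C i" "i + w0 \<le> h" using 2 noXY[OF 2(1)] by blast
      then show False using t[OF 2(1) CY] by fastforce
    qed
  qed
  then obtain C i j where "is_comp C" "ends_at C i" "i + w0 \<le> h" "ends_at C j" "h + R + 2 * s + 2 \<le> j" by blast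
  then show thesis using lane_from_comp[OF _ _ _ _ _ R] that by blast
qed

end

section \<open>From the first lane to two far apart sets\<close>

context geodesic
begin

text \<open>If \<open>S\<close> comes close to \<open>K\<close> from outside, it is close to a
  position where \<open>K\<close> attaches. If it enters \<open>K\<close>, it has to leave again to
  reach \<open>X\<close>, through the tube at such a position. These positions are at least
  \<open>t\<close>, against \<open>SD\<close>.\<close>

lemma far_from_comp:
  assumes S: "S \<subseteq> V" "conn E S" "S \<inter> X \<noteq> {}" and K: "is_comp K" "K \<inter> X = {}"
    and t: "\<And>i. ends_at K i \<Longrightarrow> t \<le> i"
    and SD: "\<And>v i. v \<in> S \<Longrightarrow> i \<le> n \<Longrightarrow> t \<le> i \<Longrightarrow> D2 \<le> d v (p i)"
  shows "far E th3 S K"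
proof (rule farI, rule ccontr)
  fix u k assume u: "u \<in> S" and k: "k \<in> K" and "\<not> th3 < d u k"
  then have le: "d u k \<le> th3" by simp
  have V: "u \<in> V" "k \<in> V" using u k S is_compD(1)[OF K(1)] by auto
  have big: "th3 + s + 1 < D2" using params(8) by linarith
  show False
  proof (cases "u \<in> K")
    case False
    obtain i where i: "ends_at K i" "d u (p i) \<le> d k u + s + 1" using comp_exit[OF K(1) k V(1) False] .
    have "D2 \<le> d u (p i)" using SD[OF u _ t[OF i(1)]] i by (simp add: ends_at_def)
    then show False using i(2) le d_sym[OF V] big by linarith
  next
    case True
    obtain x where x: "x \<in> S" "x \<notin> K" using S K by auto
    obtain u' v' where uv: "u' \<in> S" "u' \<in> K" "v' \<in> S" "v' \<notin> K" "(u', v') \<in> E"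
      using conn_exit[OF S(2) u True x] .
    then have "v' \<in> N" using is_compD(5)[OF K(1)] by blast
    then obtain i where i: "i \<le> n" "d v' (p i) \<le> s" by (auto simp: N_def)
    have "ends_at K i" using comp_neighbour[OF K(1) uv(2,5) E_V(2)[OF uv(5)] i(2,1)] .
    then have "D2 \<le> d v' (p i)" using SD[OF uv(3) i(1)] t by blast
    then show False using i(2) big by linarith
  qed
qed

text \<open>While \<open>t\<close> is far ahead, lanes of length about \<open>R1\<close> are used,
  so that both strands stay far from \<open>K\<close>. Once \<open>t\<close> is within reach, one
  long lane carries \<open>B\<close> past \<open>t\<close> and \<open>final_state\<close>
  applies.\<close>

lemma run:
  assumes noXY: "\<And>C. is_comp C \<Longrightarrow> C \<inter> X = {} \<or> C \<inter> Y = {}"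
    and q: "\<And>C i. is_comp C \<Longrightarrow> C \<inter> X \<noteq> {} \<Longrightarrow> ends_at C i \<Longrightarrow> i \<le> q"
    and t: "\<And>C i. is_comp C \<Longrightarrow> C \<inter> Y \<noteq> {} \<Longrightarrow> ends_at C i \<Longrightarrow> t \<le> i"
    and K: "is_comp K" "K \<inter> Y \<noteq> {}" "ends_at K t"
    and sep: "\<And>i. i \<le> n \<Longrightarrow> \<exists>S\<subseteq>V. conn E S \<and> S \<inter> X \<noteq> {} \<and> S \<inter> Y \<noteq> {} \<and> (\<forall>v\<in>S. r < d v (p i))"
    and r: "w0 + 2 * R1 + w + e + g + 3 * s + 2 \<le> r"
    and st: "state A B L a h" "q \<le> h" "h < t + w" "far E th3 A K" "far E th3 B K"
  shows "two_far D X Y"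
  using st
proof (induction "n - h" arbitrary: A B L a h rule: less_induct)
  case less
  note st = less(2)
  have hn: "h \<le> n" and BV: "B \<subseteq> V" and AV: "A \<subseteq> V" using st by (auto simp: state_def)
  have KX: "K \<inter> X = {}" using noXY[OF K(1)] K(2) by blast
  have KV: "K \<subseteq> V" using is_compD[OF K(1)] by blast
  have ww0: "w \<le> w0" using w0_large by linarith
  obtain S where S: "S \<subseteq> V" "conn E S" "S \<inter> X \<noteq> {}" "S \<inter> Y \<noteq> {}" "\<And>v. v \<in> S \<Longrightarrow> r < d v (p h)"
    using sep[OF hn] by blast
  have q': "\<And>C i. is_comp C \<Longrightarrow> C \<inter> X \<noteq> {} \<Longrightarrow> ends_at C i \<Longrightarrow> i \<le> h"
    using q less(3) by (meson order_trans)
  have t': "h < i + w0" if "is_comp C" "C \<inter> Y \<noteq> {}" "ends_at C i" for C i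
    using t[OF that] less(4) ww0 by linarith
  show ?case
  proof (cases "h + R1 + e + g < t")
    case True
    obtain M h' where M: "lane M h h'" "h + R1 \<le> h'" "h' \<le> h + R1 + e"
    proof (rule lane_exists[OF hn S, of R1])
      show "w0 + s \<le> r" "R1 + 3 * s + 2 \<le> r" using r by linarith+
    qed (use noXY q' t' in auto)
    obtain A' B' a' where st': "state A' B' M a' h'" "a' \<le> h" using state_step[OF st M(1)] by metis
    have fA: "far E th3 A' K"
    proof (rule far_from_comp[where t = t, OF _ _ _ K(1) KX])
      fix v i assume v: "v \<in> A'" "i \<le> n" "t \<le> i"
      have "a' + g \<le> i" using v st'(2) True by linarith
      then show "D2 \<le> d v (p i)" using st'(1) v unfolding state_def by blast
    qed (use st' t[OF K(1,2)] in \<open>auto simp: state_def\<close>)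
    have fB: "far E th3 B' K"
    proof (rule far_from_comp[where t = t, OF _ _ _ K(1) KX])
      fix v i assume v: "v \<in> B'" "i \<le> n" "t \<le> i"
      have "h' + g \<le> i" using v M(3) True by linarith
      then show "D2 \<le> d v (p i)" using st'(1) v unfolding state_def by blast
    qed (use st' t[OF K(1,2)] in \<open>auto simp: state_def\<close>)
    have "h' \<le> n" using st' by (simp add: state_def)
    moreover have "0 < R1" using R1_large D2_large by linarith
    ultimately have "n - h' < n - h" "q \<le> h'" "h' < t + w" using M(2,3) True less(3) by linarith+
    then show ?thesis using less(1)[OF _ st'(1) _ _ fA fB] by blast
  next
    case False
    \<comment> \<open>Now \<open>t \<le> h + R1 + e + g\<close>, so a lane of this length ends at
      least \<open>w\<close> beyond \<open>t\<close>.\<close>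
    let ?R = "2 * R1 + e + g + w"
    obtain M h' where M: "lane M h h'" "h + ?R \<le> h'" "h' \<le> h + ?R + e"
    proof (rule lane_exists[OF hn S, of ?R])
      show "w0 + s \<le> r" "?R + 3 * s + 2 \<le> r" using r by linarith+
    qed (use noXY q' t' in auto)
    obtain A' B' a' where st': "state A' B' M a' h'" "a' \<le> h"
      and A': "\<And>z. z \<in> A' \<Longrightarrow> z \<in> A \<or> (\<exists>v\<in>B. d v (p h) \<le> s + c \<and> z \<in> seg v (p h)) \<or> z \<in> B"
      using state_step[OF st M(1)] by metis
    obtain m0 where m0: "m0 \<in> K" "t \<le> n" "d m0 (p t) \<le> s + 1" using K(3) by (auto simp: ends_at_def)
    show ?thesis
    proof (rule final_state[OF st'(1) KV is_compD(3)[OF K(1)] K(2) comp_deep[OF K(1)] m0])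
      show "a' \<le> t + w" using st'(2) less(4) by linarith
      show "t + w \<le> h'" using M(2) False by linarith
      show "far E (th2 + D) A' K"
      proof (rule farI)
        fix z k assume z: "z \<in> A'" and k: "k \<in> K"
        have kV: "k \<in> V" using k KV by auto
        from A'[OF z] consider "z \<in> A \<union> B" | v where "v \<in> B" "d v (p h) \<le> s + c" "z \<in> seg v (p h)" by auto
        then show "th2 + D < d z k"
        proof cases
          case 1
          then have "th3 < d z k" using less(5,6) k by (auto dest: farD)
          then show ?thesis using th_chain(5) by linarith
        next
          case 2
          have vV: "v \<in> V" using 2 BV by auto
          have "th3 < d v k" using farD[OF less(6) 2(1) k] .
          then show ?thesis using seg_far[OF 2(3) vV pV[OF hn] kV] deepD[OF comp_deep[OF K(1) k] hn]
              2(2) th_chain(5) d_sym[OF vV kV] d_sym[OF seg_V[OF 2(3)] kV] by linarith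
        qed
      qed
    qed
  qed
qed

text \<open>A component meeting both \<open>X\<close> and \<open>Y\<close> pairs with the geodesic
  itself. Otherwise the first lane is a component that meets \<open>X\<close> and attaches as late
  as possible, at \<open>q\<close>, and the target \<open>K\<close> meets \<open>Y\<close> and
  attaches as early as possible, at \<open>t\<close>; extremality provides the hypotheses on
  components in \<open>lane_exists\<close>.\<close>

lemma two_path:
  assumes sep: "\<And>i. i \<le> n \<Longrightarrow> \<exists>S\<subseteq>V. conn E S \<and> S \<inter> X \<noteq> {} \<and> S \<inter> Y \<noteq> {} \<and> (\<forall>v\<in>S. r < d v (p i))"
    and r: "w0 + 2 * R1 + w + e + g + 3 * s + 2 \<le> r"
  shows "two_far D X Y"
proof -
  let ?P = "p ` {0..n}"
  have P: "?P \<subseteq> V" "conn E ?P" "?P \<inter> X \<noteq> {}" "?P \<inter> Y \<noteq> {}"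
  proof -
    show "?P \<subseteq> V" "conn E ?P" using p_sub conn_p by auto
    have "p 0 \<in> ?P" "p n \<in> ?P" by auto
    then show "?P \<inter> X \<noteq> {}" "?P \<inter> Y \<noteq> {}" using p0 pn by blast+
  qed
  have easy: "two_far D X Y" if S: "S \<subseteq> V" "conn E S" "S \<inter> X \<noteq> {}" "S \<inter> Y \<noteq> {}"
    and deep: "\<And>v. v \<in> S \<Longrightarrow> deep (D + 1) v" for S
  proof -
    have "far E D S ?P" using deep by (intro far_pI) (fastforce dest: deepD)
    then show ?thesis using S P unfolding two_far_def by blast
  qed
  show ?thesis
  proof (cases "\<exists>C. is_comp C \<and> C \<inter> X \<noteq> {} \<and> C \<inter> Y \<noteq> {}")
    case True
    then obtain C where C: "is_comp C" "C \<inter> X \<noteq> {}" "C \<inter> Y \<noteq> {}" by blast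
    have sD: "D + 1 \<le> s + 1" using th_chain(1,2) by linarith
    have "deep (D + 1) v" if "v \<in> C" for v
      using comp_deep[OF C(1) that] sD unfolding deep_def by (meson order_trans)
    then show ?thesis using easy[OF is_compD(1,3)[OF C(1)] C(2,3)] by blast
  next
    case False
    then have noXY: "\<And>C. is_comp C \<Longrightarrow> C \<inter> X = {} \<or> C \<inter> Y = {}" by blast
    let ?XQ = "{i. \<exists>C. is_comp C \<and> C \<inter> X \<noteq> {} \<and> ends_at C i}"
    let ?YT = "{i. \<exists>C. is_comp C \<and> C \<inter> Y \<noteq> {} \<and> ends_at C i}"
    have fin: "finite ?XQ" "finite ?YT" by (rule finite_subset[of _ "{..n}"]; auto simp: ends_at_def)+
    \<comment> \<open>This leaves room for the initial state with \<open>a = 0\<close> and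
      \<open>h = q\<close>. Otherwise a set \<open>S\<close> avoiding the ball around
      \<open>p 0\<close> could not leave the component where it starts in \<open>X\<close>, since
      that component attaches only within the ball.\<close>
    have "\<exists>i\<in>?XQ. g + w0 \<le> i"
    proof (rule ccontr)
      assume neg: "\<not> ?thesis"
      obtain S where S: "S \<subseteq> V" "conn E S" "S \<inter> X \<noteq> {}" "S \<inter> Y \<noteq> {}" "\<And>v. v \<in> S \<Longrightarrow> r < d v (p 0)"
        using sep[of 0] by blast
      have ballr: "g + w0 < i" if "v \<in> S" "i \<le> n" "d v (p i) \<le> s" for v i
      proof -
        have "d v (p 0) \<le> d v (p i) + d (p i) (p 0)"
          using d_tri[OF _ pV[OF that(2)] pV[of 0], of v] that(1) S(1) by auto
        moreover have "d (p i) (p 0) = i" using geod[of 0 i] that(2) d_sym[OF pV[OF that(2)] pV[of 0]] by simp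
        ultimately show ?thesis using S(5)[OF that(1)] that(3) r by linarith
      qed
      obtain x where x: "x \<in> S" "x \<in> X" using S by auto
      have "x \<notin> N"
      proof
        assume "x \<in> N"
        then obtain i where i: "i \<le> n" "d x (p i) \<le> s" by (auto simp: N_def)
        then show False using X_N[OF x(2) i] ballr[OF x(1) i] g_large D2_large by linarith
      qed
      then obtain C where C: "is_comp C" "x \<in> C" using in_comp[of x] x S by blast
      have "S \<subseteq> C"
      proof (rule conn_closed_subset[OF S(2) x(1) C(2)])
        fix u v assume u: "u \<in> S" "u \<in> C" and v: "v \<in> S" and uv: "(u, v) \<in> E"
        show "v \<in> C"
        proof (rule ccontr)
          assume "v \<notin> C"
          then have "v \<in> N" using is_compD(5)[OF C(1) u(2) uv] by simp
          then obtain i where i: "i \<le> n" "d v (p i) \<le> s" "v \<in> V" by (auto simp: N_def)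
          have "ends_at C i" using comp_neighbour[OF C(1) u(2) uv i(3,2,1)] .
          then have "i < g + w0" using neg C x(2) by (fastforce simp: not_le)
          then show False using ballr[OF v i(1,2)] by linarith
        qed
      qed
      then show False using noXY[OF C(1)] C(2) x(2) S(4) by blast
    qed
    then have XQ: "?XQ \<noteq> {}" "g + w0 \<le> Max ?XQ" using Max_ge_iff[OF fin(1)] by auto
    define q where "q = Max ?XQ"
    have "q \<in> ?XQ" unfolding q_def by (rule Max_in[OF fin(1) XQ(1)])
    then obtain C where C: "is_comp C" "C \<inter> X \<noteq> {}" "ends_at C q" by blast
    have q: "i \<le> q" if "is_comp C" "C \<inter> X \<noteq> {}" "ends_at C i" for C i
      unfolding q_def by (rule Max_ge[OF fin(1)]) (use that in blast)
    have "?YT \<noteq> {}"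
    proof -
      obtain S where S: "S \<subseteq> V" "conn E S" "S \<inter> X \<noteq> {}" "S \<inter> Y \<noteq> {}" "\<And>v. v \<in> S \<Longrightarrow> r < d v (p n)"
        using sep[of n] by blast
      obtain y where y: "y \<in> S" "y \<in> Y" using S by auto
      have "y \<notin> N"
      proof
        assume "y \<in> N"
        then obtain i where i: "i \<le> n" "d y (p i) \<le> s" "y \<in> V" by (auto simp: N_def)
        have "d y (p n) \<le> s + (n - i)" using d_tri[OF i(3) pV[OF i(1)] pV[of n]] geod[OF i(1)] i(2) by simp
        then show False using Y_N[OF y(2) i(1,2)] S(5)[OF y(1)] r by linarith
      qed
      then obtain K where K: "is_comp K" "y \<in> K" using in_comp[of y] y S by blast
      have "p 0 \<notin> K" using is_compD(2)[OF K(1)] p_in_N[of 0] by auto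
      then obtain i where "ends_at K i" using comp_exit[OF K pV[of 0]] by blast
      then show ?thesis using K y by blast
    qed
    define t where "t = Min ?YT"
    have "t \<in> ?YT" unfolding t_def by (rule Min_in[OF fin(2) \<open>?YT \<noteq> {}\<close>])
    then obtain K where K: "is_comp K" "K \<inter> Y \<noteq> {}" "ends_at K t" by blast
    have t: "t \<le> i" if "is_comp K" "K \<inter> Y \<noteq> {}" "ends_at K i" for K i
      unfolding t_def by (rule Min_le[OF fin(2)]) (use that in blast)
    have CV: "C \<subseteq> V" and KV: "K \<subseteq> V" using is_compD(1) C(1) K(1) by auto
    have cC: "conn E C" and cK: "conn E K" using is_compD(3) C(1) K(1) by auto
    show ?thesis
    \<comment> \<open>If the two components are close, a segment joins them into a set that keeps
      away from the whole geodesic.\<close>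
    proof (cases "\<exists>v\<in>C. \<exists>m\<in>K. d v m \<le> th3")
      case True
      then obtain v m where vm: "v \<in> C" "m \<in> K" "d v m \<le> th3" by blast
      have vV: "v \<in> V" "m \<in> V" using vm CV KV by auto
      have c1: "conn E (C \<union> seg v m)" using conn_Un[OF cC conn_seg[OF vV], of v] vm vV sym by auto
      have c2: "conn E (C \<union> seg v m \<union> K)" using conn_Un[OF c1 cK, of m] vV vm sym by auto
      show ?thesis
      proof (rule easy[OF _ c2])
        show "C \<union> seg v m \<union> K \<subseteq> V" using CV KV seg_V by auto
        show "(C \<union> seg v m \<union> K) \<inter> X \<noteq> {}" "(C \<union> seg v m \<union> K) \<inter> Y \<noteq> {}" using C K by auto
        fix z assume "z \<in> C \<union> seg v m \<union> K"
        then consider "z \<in> C" | "z \<in> K" | "z \<in> seg v m" by auto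
        then show "deep (D + 1) z"
          unfolding deep_def
        proof (intro allI impI; cases)
          case 1 fix i assume i: "i \<le> n"
          show "D + 1 \<le> d z (p i)" using deepD[OF comp_deep[OF C(1) 1] i] th_chain(1,2) by linarith
        next
          case 2 fix i assume i: "i \<le> n"
          show "D + 1 \<le> d z (p i)" using deepD[OF comp_deep[OF K(1) 2] i] th_chain(1,2) by linarith
        next
          case 3 fix i assume i: "i \<le> n"
          show "D + 1 \<le> d z (p i)" using deepD[OF comp_deep[OF C(1) vm(1)] i]
              d_tri[OF vV(1) seg_V[OF 3] pV[OF i]] seg_le(1)[OF 3] vm(3) th_chain(1,2) by linarith
        qed
      qed
    next
      case False
      then have fCK: "far E th3 C K" by (auto simp: far_def not_le)
      have p0V: "p 0 \<in> V" using pV by simp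
      have D2: "th3 < s + 1" "th2 + D \<le> th3" "D1 + th \<le> s + 1" "D < s + 1" "D1 \<le> s + 1" "th3 + s + 1 < D2"
        using th_chain params(8) by linarith+
      have fpK: "far E th3 {p 0} K"
      proof (rule farI)
        fix u k assume u: "u \<in> {p 0}" and k: "k \<in> K"
        have kV: "k \<in> V" using k KV by blast
        show "th3 < d u k" using deepD[OF comp_deep[OF K(1) k], of 0] d_sym[OF kV p0V] D2(1) u by simp
      qed
      obtain v1 where v1: "v1 \<in> C" "d v1 (p q) \<le> s + 1" "q \<le> n" using C by (auto simp: ends_at_def)
      have Cfar: "D2 \<le> d v (p i)" if v: "v \<in> C" and i: "i \<le> n" "q + g \<le> i" for v i
      proof (rule ccontr)
        assume neg: "\<not> ?thesis"
        have "p i \<notin> C" using is_compD(2)[OF C(1)] p_in_N[OF i(1)] by auto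
        obtain b y where b: "b \<in> C" "y \<notin> C" "(b, y) \<in> E" "b \<in> seg v (p i)"
          using exit_point[OF v pV[OF i(1)] \<open>p i \<notin> C\<close> subsetD[OF CV v]] by metis
        have "y \<in> N" using is_compD(5)[OF C(1) b(1,3,2)] .
        then obtain j where j: "j \<le> n" "d y (p j) \<le> s" "y \<in> V" by (auto simp: N_def)
        have "j \<le> q" using q[OF C(1,2) comp_neighbour[OF C(1) b(1,3) j(3,2,1)]] .
        have bV: "b \<in> V" using b CV by auto
        have "d b (p j) \<le> s + 1" using d_tri[OF bV j(3) pV[OF j(1)]] d_edge[OF b(3)] j(2) by linarith
        then have "i \<le> j + (s + 1) + d b (p i)" using p_near_lb(1)[OF bV i(1) j(1)] by blast
        then show False using \<open>j \<le> q\<close> i(2) seg_le(2)[OF b(4)] neg g_large th_chain(3) params(9) by linarith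
      qed
      \<comment> \<open>\<open>A\<close> waits at the start of the geodesic, and the component
        \<open>C\<close> as a whole serves as \<open>B\<close> and as its first lane.\<close>
      have st: "state {p 0} C C 0 q"
        unfolding state_def
      proof (intro conjI ballI allI impI)
        show "{p 0} \<subseteq> V" "C \<subseteq> V" "conn E {p 0}" "conn E C" "{p 0} \<inter> X \<noteq> {}" "C \<inter> X \<noteq> {}" "p 0 \<in> {p 0}"
          "q \<le> n" "C \<subseteq> C"
          using p0V CV cC p0 C(2) v1 by auto
        show "\<exists>v\<in>C. d v (p q) \<le> s + c" using v1(1,2) th_chain(3) by (intro bexI[of _ v1]) linarith+
        show "0 + g + w0 \<le> q" using XQ(2) q_def by simp
        show "far E D {p 0} C"
        proof (rule farI)
          fix u k assume u: "u \<in> {p 0}" and k: "k \<in> C"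
          have kV: "k \<in> V" using k CV by blast
          show "D < d u k" using deepD[OF comp_deep[OF C(1) k], of 0] d_sym[OF kV p0V] D2(4) u by simp
        qed
      next
        fix v assume "v \<in> C" then show "deep (D1 + th) v"
          using comp_deep[OF C(1)] D2(3) unfolding deep_def by (meson order_trans)
      next
        fix v i assume "v \<in> C" "i \<le> n" then show "D1 \<le> d v (p i)"
          using deepD[OF comp_deep[OF C(1)]] D2(5) by (meson order_trans)
      next
        fix v i assume "v \<in> {p 0}" "i \<le> n" "0 + g \<le> i" then show "D2 \<le> d v (p i)"
          using geod[of 0 i] g_large by simp
      next
        fix v i assume "v \<in> C" "i \<le> n" "q + g \<le> i" then show "D2 \<le> d v (p i)" by (rule Cfar)
      qed auto
      show ?thesis
      proof (cases "t + w \<le> q")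
        case True
        obtain m0 where m0: "m0 \<in> K" "t \<le> n" "d m0 (p t) \<le> s + 1" using K(3) by (auto simp: ends_at_def)
        show ?thesis
          using final_state[OF st KV cK K(2) comp_deep[OF K(1)] m0 le0 True far_mono[OF fpK D2(2)]] .
      next
        case False
        show ?thesis
          by (rule run[OF noXY q t K sep r st _ _ fpK fCK]) (use False in auto)
      qed
    qed
  qed
qed

end

section \<open>Systems, covers and contractions\<close>

definition system :: "'a set \<Rightarrow> ('a \<times> 'a) set \<Rightarrow> nat \<Rightarrow> nat \<Rightarrow> 'a set \<Rightarrow> 'a set \<Rightarrow> 'a set set \<Rightarrow> bool" where
  "system V E k D X Y \<P> \<longleftrightarrow> finite \<P> \<and> card \<P> = k \<and>
     (\<forall>S\<in>\<P>. S \<subseteq> V \<and> conn E S \<and> S \<inter> X \<noteq> {} \<and> S \<inter> Y \<noteq> {}) \<and>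
     (\<forall>S\<in>\<P>. \<forall>T\<in>\<P>. S \<noteq> T \<longrightarrow> far E D S T)"

definition hits :: "('a \<times> 'a) set \<Rightarrow> nat \<Rightarrow> 'a set \<Rightarrow> 'a set \<Rightarrow> bool" where
  "hits E r Z S \<longleftrightarrow> (\<exists>v\<in>S. \<exists>z\<in>Z. gdist E v z \<le> r)"

definition covers :: "'a set \<Rightarrow> ('a \<times> 'a) set \<Rightarrow> nat \<Rightarrow> 'a set \<Rightarrow> 'a set \<Rightarrow> 'a set \<Rightarrow> bool" where
  "covers V E r X Y Z \<longleftrightarrow> (\<forall>S\<subseteq>V. conn E S \<longrightarrow> S \<inter> X \<noteq> {} \<longrightarrow> S \<inter> Y \<noteq> {} \<longrightarrow> hits E r Z S)"

text \<open>The alternative is stated for connected sets instead of paths, since these can be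
  projected, lifted and glued freely. Paths are extracted only at the end.\<close>

definition menger :: "'a set \<Rightarrow> ('a \<times> 'a) set \<Rightarrow> nat \<Rightarrow> nat \<Rightarrow> nat \<Rightarrow> 'a set \<Rightarrow> 'a set \<Rightarrow> bool" where
  "menger V E k D r X Y \<longleftrightarrow> (\<exists>\<P>. system V E k D X Y \<P>) \<or>
     (\<exists>Z\<subseteq>V. finite Z \<and> card Z < k \<and> covers V E r X Y Z)"

lemma (in cgraph) system_Un:
  assumes "system V E a D X Y \<P>" "system V E b D X Y \<Q>"
    and "\<And>S T. S \<in> \<P> \<Longrightarrow> T \<in> \<Q> \<Longrightarrow> far E D S T"
  shows "system V E (a + b) D X Y (\<P> \<union> \<Q>)"
proof -
  have "\<P> \<inter> \<Q> = {}"
  proof (rule ccontr)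
    assume "\<P> \<inter> \<Q> \<noteq> {}"
    then obtain S where S: "S \<in> \<P>" "S \<in> \<Q>" by auto
    then have "S \<noteq> {}" using assms(1) by (auto simp: system_def)
    then obtain x where "x \<in> S" by auto
    then show False using farD[OF assms(3)[OF S], of x x] by simp
  qed
  then have "card (\<P> \<union> \<Q>) = a + b" using assms(1,2) by (simp add: system_def card_Un_disjoint)
  moreover have "far E D T S" if "S \<in> \<P>" "T \<in> \<Q>" for S T
    using far_sym[OF _ _ assms(3)[OF that]] assms(1,2) that by (auto simp: system_def)
  ultimately show ?thesis using assms unfolding system_def by auto
qed

lemma (in cgraph) ex_geodesic:
  assumes "x \<in> V" "y \<in> V"
  obtains p where "p 0 = x" "p (d x y) = y" "\<And>i. i \<le> d x y \<Longrightarrow> p i \<in> V"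
    "\<And>i j. i \<le> j \<Longrightarrow> j \<le> d x y \<Longrightarrow> d (p i) (p j) = j - i"
proof -
  let ?n = "d x y"
  obtain p where p: "p 0 = x" "p ?n = y" "\<And>i. i < ?n \<Longrightarrow> (p i, p (Suc i)) \<in> E"
    using relpow_d[OF assms] unfolding relpow_fun_conv by blast
  have pV: "p i \<in> V" if "i \<le> ?n" for i
    using that p assms E_V(1)[OF p(3)[of i]] by (cases "i = ?n") auto
  have le: "d (p i) (p j) \<le> j - i" if "i \<le> j" "j \<le> ?n" for i j
    using that
  proof (induction j rule: dec_induct)
    case (step j)
    have "d (p i) (p (Suc j)) \<le> d (p i) (p j) + 1"
      using d_edge_tri[OF pV[of i] p(3)[of j]] step by simp
    moreover have "d (p i) (p j) \<le> j - i" using step by simp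
    ultimately show ?case using step(1) by linarith
  qed simp
  have "d (p i) (p j) = j - i" if ij: "i \<le> j" "j \<le> ?n" for i j
  proof -
    have "?n \<le> d x (p i) + d (p i) y" using d_tri[OF assms(1) pV[of i] assms(2)] ij by simp
    moreover have "d (p i) y \<le> d (p i) (p j) + d (p j) y"
      using d_tri[OF pV[of i] pV[of j] assms(2)] ij by simp
    moreover have "d x (p i) \<le> i" "d (p j) y \<le> ?n - j" using le[of 0 i] le[of j ?n] p ij by simp_all
    ultimately show ?thesis using le[OF ij] ij by linarith
  qed
  then show thesis using that p pV by blast
qed

lemma menger2:
  fixes l D :: nat
  shows "\<exists>r. \<forall>(V :: 'a set) E X Y. cgraph V E \<longrightarrow> cut_conn l V E \<longrightarrow> X \<subseteq> V \<longrightarrow> Y \<subseteq> V \<longrightarrow> menger V E 2 D r X Y"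
proof -
  define c where "c = l + 1"
  define th where "th = 2 * D + 2 * c + 2"
  define th2 where "th2 = th + c + 2 * D + 2"
  define th3 where "th3 = 2 * th2 + 2 * D + c + 2"
  define D1 where "D1 = th3 + D + 2"
  define s where "s = D1 + th + c"
  define e where "e = l + 2 * s + 2"
  define D2 where "D2 = th3 + th + 2 * s + 2 * c + D + 3"
  define g where "g = D2 + e + 2 * s + 2 * c + th + 2"
  define w where "w = 2 * s + 2 * c + D + 2"
  define w0 where "w0 = e + 2 * w + D2 + 2 * s + 2 * c + D + g"
  define R1 where "R1 = w0 + g + th + s + c + D2 + w + e"
  \<comment> \<open>The longest lane requested in \<open>run\<close> has
    \<open>R = 2 * R1 + e + g + w\<close>, and \<open>lane_exists\<close> needs
    \<open>R + 3 * s + 2\<close>.\<close>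
  define r where "r = w0 + 2 * R1 + w + e + g + 3 * s + 2"
  have "menger V E 2 D r X Y" if G: "cgraph V E" and cut: "cut_conn l V E" and XV: "X \<subseteq> V" and YV: "Y \<subseteq> V"
    for V :: "'a set" and E X Y
  proof (cases "X = {} \<or> Y = {}")
    case True
    then show ?thesis unfolding menger_def covers_def by (intro disjI2 exI[of _ "{}"]) auto
  next
    case False
    interpret cgraph V E by fact
    define n where "n = (LEAST n. \<exists>x\<in>X. \<exists>y\<in>Y. d x y = n)"
    have "\<exists>n. \<exists>x\<in>X. \<exists>y\<in>Y. d x y = n" using False by blast
    then have "\<exists>x\<in>X. \<exists>y\<in>Y. d x y = n" unfolding n_def by (rule LeastI_ex)
    then obtain x y where xy: "x \<in> X" "y \<in> Y" "d x y = n" by blast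
    have short: "n \<le> d x y" if "x \<in> X" "y \<in> Y" for x y
      unfolding n_def using that by (intro Least_le) blast
    obtain p where p: "p 0 = x" "p n = y" "\<And>i. i \<le> n \<Longrightarrow> p i \<in> V"
      "\<And>i j. i \<le> j \<Longrightarrow> j \<le> n \<Longrightarrow> d (p i) (p j) = j - i"
      using ex_geodesic[of x y] xy XV YV by (metis subsetD)
    interpret geodesic V E X Y n p l D c th th2 th3 D1 D2 s e g w w0 R1
      by (unfold_locales; (fact XV | fact YV | fact p(3) | fact p(4) | fact short | fact cut | use p xy in simp)?)
        (unfold c_def th_def th2_def th3_def D1_def s_def e_def D2_def g_def w_def w0_def R1_def, simp_all)
    show ?thesis
    proof (cases "\<forall>i\<le>n. \<exists>S\<subseteq>V. conn E S \<and> S \<inter> X \<noteq> {} \<and> S \<inter> Y \<noteq> {} \<and> (\<forall>v\<in>S. r < d v (p i))")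
      case True
      then have "two_far D X Y" using two_path[of r] by (simp add: r_def)
      then obtain A B where AB: "A \<subseteq> V" "B \<subseteq> V" "conn E A" "conn E B" "A \<inter> X \<noteq> {}" "A \<inter> Y \<noteq> {}"
        "B \<inter> X \<noteq> {}" "B \<inter> Y \<noteq> {}" "far E D A B" unfolding two_far_def by blast
      have BA: "far E D B A" using far_sym[OF AB(1,2,9)] .
      have "A \<noteq> B"
      proof
        assume "A = B"
        moreover obtain x where "x \<in> A" using AB(5) by blast
        ultimately show False using farD[OF AB(9), of x x] by simp
      qed
      then show ?thesis unfolding menger_def system_def
        by (intro disjI1 exI[of _ "{A, B}"]) (use AB BA in auto)
    next
      case False
      then obtain i where i: "i \<le> n" "\<And>S. S \<subseteq> V \<Longrightarrow> conn E S \<Longrightarrow> S \<inter> X \<noteq> {} \<Longrightarrow> S \<inter> Y \<noteq> {} \<Longrightarrow> \<exists>v\<in>S. d v (p i) \<le> r"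
        by (metis not_le)
      then show ?thesis unfolding menger_def covers_def hits_def
        by (intro disjI2 exI[of _ "{p i}"]) (use pV[OF i(1)] in simp)
    qed
  qed
  then show ?thesis by blast
qed

section \<open>Contracting a connected set to one of its vertices\<close>

definition cproj :: "'a set \<Rightarrow> 'a \<Rightarrow> 'a \<Rightarrow> 'a" where
  "cproj W f v = (if v \<in> W then f else v)"

text \<open>The new vertex is a member \<open>f\<close> of \<open>W\<close>, so the quotient has the
  same vertex type and the induction hypothesis applies to it.\<close>

locale contraction = cgraph +
  fixes W f
  assumes W: "W \<subseteq> V" "conn E W" "f \<in> W"
begin

abbreviation "\<pi> \<equiv> cproj W f"

definition V' where "V' = V - W \<union> {f}"
text \<open>Edges inside \<open>W\<close> become a loop at \<open>f\<close>, which
  \<open>cgraph\<close> permits.\<close>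

definition E' where "E' = (\<lambda>(u, v). (\<pi> u, \<pi> v)) ` E"

lemma f_V': "f \<in> V'" and V'_sub: "V' \<subseteq> V" using W by (auto simp: V'_def)

lemma proj_id: "v \<in> V' \<Longrightarrow> \<pi> v = v" using W by (auto simp: V'_def cproj_def)

lemma proj_V': "v \<in> V \<Longrightarrow> \<pi> v \<in> V'" by (auto simp: V'_def cproj_def)

lemma proj_eq_f: "\<pi> v = f \<longleftrightarrow> v \<in> W" using W by (auto simp: cproj_def)

lemma E'_I: "(u, v) \<in> E \<Longrightarrow> (\<pi> u, \<pi> v) \<in> E'" by (force simp: E'_def)

lemma E'_E: assumes "(a, b) \<in> E'" obtains u v where "(u, v) \<in> E" "\<pi> u = a" "\<pi> v = b"
  using assms by (auto simp: E'_def)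

lemma proj_rtrancl:
  assumes "(u, v) \<in> (E \<inter> S \<times> S)\<^sup>*" shows "(\<pi> u, \<pi> v) \<in> (E' \<inter> \<pi> ` S \<times> \<pi> ` S)\<^sup>*"
  using assms
proof (induction rule: rtrancl_induct)
  case (step y z)
  then have "(\<pi> y, \<pi> z) \<in> E' \<inter> \<pi> ` S \<times> \<pi> ` S" using E'_I by auto
  with step.IH show ?case by (rule rtrancl_into_rtrancl)
qed simp

lemma conn_proj: "conn E S \<Longrightarrow> conn E' (\<pi> ` S)"
  using proj_rtrancl by (auto simp: conn_def)

sublocale Q: cgraph V' E'
proof
  show "E' \<subseteq> V' \<times> V'" using E_sub proj_V' by (auto simp: E'_def)
  show "sym E'"
    by (rule symI) (metis E'_E E'_I E_sym)
  fix u v assume uv: "u \<in> V'" "v \<in> V'"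
  have "conn E' (\<pi> ` V)" by (rule conn_proj[OF conn_V])
  moreover have "u \<in> \<pi> ` V" "v \<in> \<pi> ` V" using uv proj_id V'_sub by (metis image_eqI subsetD)+
  ultimately have "(u, v) \<in> (E' \<inter> \<pi> ` V \<times> \<pi> ` V)\<^sup>*" by (auto simp: conn_def)
  then show "(u, v) \<in> E'\<^sup>*" by (rule rtrancl_mono[THEN subsetD, rotated]) auto
qed

lemma dist_proj: assumes "u \<in> V" "v \<in> V" shows "gdist E' (\<pi> u) (\<pi> v) \<le> d u v"
proof -
  have "(\<pi> u, \<pi> v) \<in> E' ^^ n" if "(u, v) \<in> E ^^ n" for n
    using that by (induction n arbitrary: v) (auto intro: E'_I)
  then show ?thesis using relpow_d[OF assms] Q.d_le by blast
qed

definition lift where "lift S = {v \<in> V. \<pi> v \<in> S}"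

lemma lift_f: "S \<subseteq> V' \<Longrightarrow> f \<in> S \<Longrightarrow> lift S = S - {f} \<union> W"
  using W by (auto simp: lift_def V'_def cproj_def)

lemma lift_no_f: "S \<subseteq> V' \<Longrightarrow> f \<notin> S \<Longrightarrow> lift S = S"
  using W by (auto simp: lift_def V'_def cproj_def)

text \<open>Each fibre is a single vertex or the connected set \<open>W\<close>, and each edge of
  the quotient comes from an edge between two fibres.\<close>

lemma conn_lift:
  assumes "conn E' S" "S \<subseteq> V'" shows "conn E (lift S)"
proof -
  have fibre: "(u, v) \<in> (E \<inter> lift S \<times> lift S)\<^sup>*" if "u \<in> lift S" "v \<in> lift S" "\<pi> u = \<pi> v" for u v
  proof (cases "u = v")
    case False
    then have uv: "u \<in> W" "v \<in> W" using that W(3) by (auto simp: cproj_def split: if_splits)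
    then have "f \<in> S" using that(1) by (auto simp: lift_def cproj_def)
    then have "W \<subseteq> lift S" using lift_f assms(2) by auto
    then show ?thesis using uv W(2) rtrancl_restrict_mono[of W "lift S" u v E] by (simp add: conn_def)
  qed simp
  have "(u, v) \<in> (E \<inter> lift S \<times> lift S)\<^sup>*"
    if "(a, b) \<in> (E' \<inter> S \<times> S)\<^sup>*" "u \<in> lift S" "\<pi> u = a" "v \<in> lift S" "\<pi> v = b" for a b u v
    using that
  proof (induction arbitrary: v rule: rtrancl_induct)
    case base then show ?case using fibre by auto
  next
    case (step b c)
    obtain y z where yz: "(y, z) \<in> E" "\<pi> y = b" "\<pi> z = c" using step(2) E'_E by blast
    then have "y \<in> lift S" "z \<in> lift S" using step(2) E_V by (auto simp: lift_def)
    then have "(u, y) \<in> (E \<inter> lift S \<times> lift S)\<^sup>*" "(y, z) \<in> E \<inter> lift S \<times> lift S"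
      "(z, v) \<in> (E \<inter> lift S \<times> lift S)\<^sup>*"
      using step yz fibre by auto
    then show ?case by (meson rtrancl_into_rtrancl rtrancl_trans)
  qed
  then show ?thesis using assms(1) by (auto simp: conn_def lift_def)
qed

text \<open>A cut of the quotient lifts to a cut of the graph whose boundary projects onto the given
  one, and projection does not lengthen jumps.\<close>

lemma cut_conn_contract:
  assumes "cut_conn l V E" shows "cut_conn l V' E'"
  unfolding cut_conn_def
proof (intro allI impI ballI)
  fix U b b' assume U: "U \<subseteq> V'" "conn E' U \<and> conn E' (V' - U)"
  let ?B' = "bdry E' U (V' - U)" and ?B = "bdry E (lift U) (V - lift U)"
  assume b: "b \<in> ?B'" "b' \<in> ?B'"
  have compl: "V - lift U = lift (V' - U)" using proj_V' by (auto simp: lift_def)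
  have conns: "conn E (lift U)" "conn E (V - lift U)" unfolding compl using U by (auto intro!: conn_lift)
  have pre: "\<exists>y\<in>?B. \<pi> y = a" if aB: "a \<in> ?B'" for a
  proof -
    obtain z where z: "a \<in> U" "z \<in> V' - U" "(a, z) \<in> E'" using aB by (auto simp: bdry_def)
    then obtain u v where uv: "(u, v) \<in> E" "\<pi> u = a" "\<pi> v = z" using E'_E by blast
    then have "u \<in> ?B" using z E_V[OF uv(1)] by (auto simp: bdry_def lift_def)
    then show ?thesis using uv by blast
  qed
  have img: "\<pi> y \<in> ?B'" if yB: "y \<in> ?B" for y
  proof -
    obtain z where z: "y \<in> lift U" "z \<in> V - lift U" "(y, z) \<in> E" using yB by (auto simp: bdry_def)
    then have "\<pi> y \<in> U" "\<pi> z \<in> V' - U" "(\<pi> y, \<pi> z) \<in> E'" using E'_I proj_V' by (auto simp: lift_def)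
    then show ?thesis by (auto simp: bdry_def)
  qed
  have step: "(\<pi> y, \<pi> z) \<in> near E' l ?B'" if "(y, z) \<in> near E l ?B" for y z
  proof -
    have yz: "y \<in> ?B" "z \<in> ?B" "d y z \<le> l" using that by (auto simp: near_def)
    then have "y \<in> V" "z \<in> V" by (auto simp: bdry_def lift_def)
    then have "gdist E' (\<pi> y) (\<pi> z) \<le> l" using dist_proj[of y z] yz by linarith
    then show ?thesis using img yz by (auto simp: near_def)
  qed
  obtain y where y: "y \<in> ?B" "\<pi> y = b" using pre[OF b(1)] by blast
  obtain y' where y': "y' \<in> ?B" "\<pi> y' = b'" using pre[OF b(2)] by blast
  have "lift U \<subseteq> V" by (auto simp: lift_def)
  then have "(y, y') \<in> (near E l ?B)\<^sup>*"
    using assms[unfolded cut_conn_def, rule_format, OF _ conjI[OF conns] y(1) y'(1)] by simp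
  then have "(\<pi> y, \<pi> y') \<in> (near E' l ?B')\<^sup>*"
    by (induction rule: rtrancl_induct) (auto intro: rtrancl_into_rtrancl step)
  then show "(b, b') \<in> (near E' l ?B')\<^sup>*" using y y' by simp
qed

text \<open>A shortest walk from \<open>z\<close> to \<open>v\<close> in the quotient is too short
  to reach \<open>f\<close>, so it is a walk of the graph.\<close>

lemma dist_unproj:
  assumes "z \<in> V'" "v \<in> V'" "gdist E' z v < gdist E' z f"
  shows "d z v \<le> gdist E' z v"
proof -
  have "(z, v) \<in> E ^^ n" if "(z, v) \<in> E' ^^ n" "n < gdist E' z f" for n
    using that
  proof (induction n arbitrary: v)
    case (Suc n)
    then obtain y where y: "(z, y) \<in> E' ^^ n" "(y, v) \<in> E'" by auto
    have "y \<noteq> f" "v \<noteq> f" using Q.d_le[OF y(1)] Q.d_le[OF Suc(2)] Suc(3) by auto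
    then have "(y, v) \<in> E" using y(2) by (auto simp: E'_def cproj_def split: if_splits)
    then show ?case using Suc y by auto
  qed simp
  then show ?thesis using Q.relpow_d[OF assms(1,2)] assms(3) d_le by blast
qed

end

section \<open>The two sides of a bipartition\<close>

text \<open>One side of a bipartition of the vertices into connected sets \<open>V - W\<close> and \<open>W\<close>; the
  connected set \<open>I\<close> surrounds the edges between them and replaces the vertex \<open>f\<close> when a set is
  carried back from the contracted graph.\<close>

locale side = contraction +
  fixes I :: "'a set" and l D D1 s \<rho> :: nat and \<T> :: "'a set set" and X Y :: "'a set"
  assumes I: "I \<subseteq> V" "conn E I" "I \<noteq> {}"
    and I_edge: "\<And>u w. (u, w) \<in> E \<Longrightarrow> u \<notin> W \<Longrightarrow> w \<in> W \<Longrightarrow> u \<in> I \<or> w \<in> I"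
    and I_near: "\<And>v. v \<in> I \<Longrightarrow> \<exists>w\<in>W. d v w \<le> l + 1"
    and params: "D + l + 1 \<le> D1" "2 * \<rho> < s"
    and XY: "X \<subseteq> V" "Y \<subseteq> V"
    and T_fin: "finite \<T>"
    and T: "\<And>T. T \<in> \<T> \<Longrightarrow> T \<subseteq> V - W" "\<And>T. T \<in> \<T> \<Longrightarrow> conn E T"
      "\<And>T. T \<in> \<T> \<Longrightarrow> T \<inter> X \<noteq> {}" "\<And>T. T \<in> \<T> \<Longrightarrow> T \<inter> Y \<noteq> {}"
      "\<And>T. T \<in> \<T> \<Longrightarrow> far E s T W"
    and TT: "\<And>T T'. T \<in> \<T> \<Longrightarrow> T' \<in> \<T> \<Longrightarrow> T \<noteq> T' \<Longrightarrow> far E s T T'"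
begin

lemma D_le: "D \<le> D1" using params(1) by linarith

text \<open>Follow a walk of the quotient towards \<open>f\<close>. The edge arriving there comes
  from an edge into \<open>W\<close>, and by \<open>I_edge\<close> one end of that edge is already
  in \<open>I\<close>.\<close>

lemma conn_realize:
  assumes S: "conn E' S" "S \<subseteq> V'" "f \<in> S"
  shows "conn E (S - {f} \<union> I)"
proof -
  let ?S = "S - {f} \<union> I"
  obtain c where c: "c \<in> I" using I by auto
  have Ic: "(v, c) \<in> (E \<inter> ?S \<times> ?S)\<^sup>*" if "v \<in> I" for v
    using I(2) c that rtrancl_restrict_mono[of I ?S v c E] by (simp add: conn_def)
  have sym': "sym ((E \<inter> ?S \<times> ?S)\<^sup>*)" using sym by (intro sym_rtrancl) (auto simp: sym_def)
  have path: "a \<noteq> f \<longrightarrow> (a, c) \<in> (E \<inter> ?S \<times> ?S)\<^sup>*" if "(a, f) \<in> (E' \<inter> S \<times> S)\<^sup>*" for a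
    using that
  proof (induction rule: converse_rtrancl_induct)
    case (step a b)
    show ?case
    proof
      assume a: "a \<noteq> f"
      obtain u v where uv: "(u, v) \<in> E" "\<pi> u = a" "\<pi> v = b" using step(1) E'_E by blast
      have ua: "u = a" "u \<notin> W" using uv(2) a by (auto simp: cproj_def split: if_splits)
      have aS: "a \<in> ?S" using step(1) a by auto
      show "(a, c) \<in> (E \<inter> ?S \<times> ?S)\<^sup>*"
      proof (cases "v \<in> W")
        case True
        then consider "a \<in> I" | "v \<in> I" using I_edge[OF uv(1) ua(2)] ua by auto
        then show ?thesis
        proof cases
          case 2
          then have "(a, v) \<in> E \<inter> ?S \<times> ?S" using uv ua aS by auto
          then show ?thesis using Ic[OF 2] by (rule converse_rtrancl_into_rtrancl)
        qed (use Ic in auto)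
      next
        case False
        then have vb: "v = b" "b \<noteq> f" using uv W by (auto simp: cproj_def)
        then have "(a, b) \<in> E \<inter> ?S \<times> ?S" using uv ua aS step(1) by auto
        then show ?thesis using step.IH vb by (auto intro: converse_rtrancl_into_rtrancl)
      qed
    qed
  qed simp
  show ?thesis
  proof (rule connI_root[OF sym, where c = c])
    fix v assume v: "v \<in> ?S"
    have "(v, c) \<in> (E \<inter> ?S \<times> ?S)\<^sup>*"
    proof (cases "v \<in> I")
      case False
      then have "v \<in> S" "v \<noteq> f" using v by auto
      then show ?thesis using path[of v] S by (auto simp: conn_def)
    qed (use Ic in auto)
    then show "(c, v) \<in> (E \<inter> ?S \<times> ?S)\<^sup>*" using sym' by (auto dest: symD)
  qed
qed

lemma far_unproj:
  assumes "S \<subseteq> V'" "T \<subseteq> V'" "far E' m S T"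
  shows "far E m (S - {f}) (T - {f})"
proof (rule farI)
  fix u v assume uv: "u \<in> S - {f}" "v \<in> T - {f}"
  then have "\<pi> u = u" "\<pi> v = v" "u \<in> V" "v \<in> V" using assms proj_id V'_sub by auto
  then show "m < d u v" using dist_proj[of u v] farD[OF assms(3), of u v] uv by auto
qed

lemma far_unproj_f:
  assumes "S \<subseteq> V'" "far E' m S {f}"
  shows "far E m S W"
proof (rule farI)
  fix u w assume uw: "u \<in> S" "w \<in> W"
  then have "\<pi> u = u" "\<pi> w = f" "u \<in> V" "w \<in> V" using assms proj_id V'_sub W proj_eq_f by auto
  then show "m < d u w" using dist_proj[of u w] farD[OF assms(2), of u f] uw by auto
qed

lemma far_I: 
  assumes "S \<subseteq> V" "far E (m + l + 1) S W"
  shows "far E m S I"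
proof (rule farI)
  fix u v assume uv: "u \<in> S" "v \<in> I"
  then obtain w where w: "w \<in> W" "d v w \<le> l + 1" using I_near by blast
  have V: "u \<in> V" "v \<in> V" "w \<in> V" using uv w assms I W by auto
  show "m < d u v" using d_tri[OF V] farD[OF assms(2) uv(1) w(1)] w(2) by linarith
qed

lemma not_f: "S \<subseteq> V' \<Longrightarrow> f \<notin> S \<Longrightarrow> S \<subseteq> V - W" by (auto simp: V'_def)

lemma conn_not_f: "conn E' S \<Longrightarrow> S \<subseteq> V' \<Longrightarrow> f \<notin> S \<Longrightarrow> conn E S"
  using conn_lift lift_no_f by metis

text \<open>Until its first visit to \<open>f\<close>, a walk of the quotient is a walk of the
  graph, and the edge of that first visit leads into \<open>W\<close>.\<close>

lemma dist_f: assumes "(v, y) \<in> E' ^^ n" "v \<in> V'" "v \<noteq> f"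
  shows "(y \<noteq> f \<and> (v, y) \<in> E ^^ n) \<or> (\<exists>w\<in>W. d v w \<le> n)"
  using assms(1)
proof (induction n arbitrary: y)
  case 0 then show ?case using assms by auto
next
  case (Suc n)
  then obtain z where z: "(v, z) \<in> E' ^^ n" "(z, y) \<in> E'" by auto
  show ?case
  proof (cases "\<exists>w\<in>W. d v w \<le> n")
    case False
    then have zf: "z \<noteq> f" "(v, z) \<in> E ^^ n" using Suc.IH[OF z(1)] by auto
    obtain a b where ab: "(a, b) \<in> E" "\<pi> a = z" "\<pi> b = y" using z(2) E'_E by blast
    have "a = z" using ab zf by (auto simp: cproj_def split: if_splits)
    then have vb: "(v, b) \<in> E ^^ Suc n" using zf ab by auto
    show ?thesis
    proof (cases "b \<in> W")
      case True then show ?thesis using d_le[OF vb] by blast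
    next
      case False
      then have "b = y" "y \<noteq> f" using ab W by (auto simp: cproj_def)
      then show ?thesis using vb by auto
    qed
  qed (meson le_SucI)
qed

text \<open>Only walks through \<open>f\<close> can be shortened by the contraction, and
  \<open>f\<close> itself is too far away.\<close>

lemma tube_dist:
  assumes "T \<in> \<T>" "v \<in> T" "m \<le> s"
  shows "m < gdist E' v f" "\<And>T' v'. T' \<in> \<T> \<Longrightarrow> T' \<noteq> T \<Longrightarrow> v' \<in> T' \<Longrightarrow> m < gdist E' v v'"
proof -
  have v: "v \<in> V'" "v \<noteq> f" "v \<in> V" using T(1)[OF assms(1)] assms(2) W by (auto simp: V'_def)
  obtain w where w: "w \<in> W" "d v w \<le> gdist E' v f"
    using dist_f[OF Q.relpow_d[OF v(1) f_V'] v(1,2)] by auto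
  show f: "m < gdist E' v f" using farD[OF T(5)[OF assms(1)] assms(2) w(1)] w(2) assms(3) by linarith
  fix T' v' assume T': "T' \<in> \<T>" "T' \<noteq> T" "v' \<in> T'"
  have v': "v' \<in> V'" using T(1)[OF T'(1)] T'(3) by (auto simp: V'_def)
  have "s < d v v'" using farD[OF TT[OF assms(1) T'(1) T'(2)[symmetric]] assms(2) T'(3)] .
  then show "m < gdist E' v v'" using dist_unproj[OF v(1) v'] f assms(3) by linarith
qed

text \<open>Pick for each member of \<open>\<T>\<close> a point of \<open>Z\<close> that hits it.
  The choice is injective because \<open>2 * \<rho> < s\<close>, hence onto by counting. So each
  \<open>z\<close> is within \<open>\<rho>\<close> of some member, which is farther than
  \<open>2 * \<rho>\<close> from \<open>f\<close>.\<close>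

lemma ball_avoids_f:
  assumes Z: "Z \<subseteq> V'" "finite Z" "card Z < Suc (card \<T>)" "covers V' E' \<rho> X' Y' Z"
    and XY': "X - W \<subseteq> X'" "Y - W \<subseteq> Y'" and z: "z \<in> Z"
  shows "\<rho> < gdist E' z f"
proof -
  have ex: "\<exists>z\<in>Z. \<exists>v\<in>T. gdist E' v z \<le> \<rho>" if "T \<in> \<T>" for T
  proof -
    have sub: "T \<subseteq> V'" using T(1)[OF that] by (auto simp: V'_def)
    then have "\<pi> ` T = T" using proj_id by force
    then have "conn E' T" using conn_proj[OF T(2)[OF that]] by simp
    moreover have "T \<inter> X' \<noteq> {}" "T \<inter> Y' \<noteq> {}" using T(1,3,4)[OF that] XY' by auto
    ultimately show ?thesis using Z(4) sub by (auto simp: covers_def hits_def)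
  qed
  then obtain h where h: "\<And>T. T \<in> \<T> \<Longrightarrow> h T \<in> Z \<and> (\<exists>v\<in>T. gdist E' v (h T) \<le> \<rho>)" by metis
  have inj: "inj_on h \<T>"
  proof (rule inj_onI, rule ccontr)
    fix T T' assume TT': "T \<in> \<T>" "T' \<in> \<T>" "h T = h T'" "T \<noteq> T'"
    obtain v where v: "v \<in> T" "gdist E' v (h T) \<le> \<rho>" using h[OF TT'(1)] by blast
    obtain v' where v': "v' \<in> T'" "gdist E' v' (h T) \<le> \<rho>" using h[OF TT'(2)] TT' by auto
    have V: "v \<in> V'" "v' \<in> V'" "h T \<in> V'" using v v' T(1) TT' h Z(1) by (auto simp: V'_def)
    have "gdist E' v v' \<le> 2 * \<rho>" using Q.d_tri[OF V(1,3,2)] Q.d_sym[OF V(2,3)] v v' by linarith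
    then show False using tube_dist(2)[OF TT'(1) v(1) _ TT'(2) TT'(4)[symmetric] v'(1), of "2 * \<rho>"] params by auto
  qed
  have "h ` \<T> = Z"
    by (rule card_seteq[OF Z(2)]) (use h Z(3) card_image[OF inj] in auto)
  then obtain T where T': "T \<in> \<T>" "h T = z" using z by auto
  then obtain v where v: "v \<in> T" "gdist E' v z \<le> \<rho>" using h by auto
  have V: "v \<in> V'" "z \<in> V'" using v T(1)[OF T'(1)] z Z(1) by (auto simp: V'_def)
  show ?thesis using tube_dist(1)[OF T'(1) v(1), of "2 * \<rho>"] Q.d_tri[OF V f_V'] v(2) params by linarith
qed

text \<open>The hit occurs in a ball that misses \<open>f\<close>, where distances of the quotient
  bound those of the graph, and therefore outside \<open>W\<close>.\<close>

lemma cover_hits: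
  assumes Z: "Z \<subseteq> V'" "finite Z" "card Z < Suc (card \<T>)" "covers V' E' \<rho> X' Y' Z"
    and XY': "X - W \<subseteq> X'" "Y - W \<subseteq> Y'"
    and S: "S \<subseteq> V" "conn E S" "\<pi> ` S \<inter> X' \<noteq> {}" "\<pi> ` S \<inter> Y' \<noteq> {}"
  shows "\<exists>v\<in>S - W. \<exists>z\<in>Z. d v z \<le> \<rho>"
proof -
  have "\<pi> ` S \<subseteq> V'" using S proj_V' by auto
  then obtain v z where v: "v \<in> S" "z \<in> Z" "gdist E' (\<pi> v) z \<le> \<rho>"
    using Z(4) S conn_proj[OF S(2)] unfolding covers_def hits_def by blast
  have zV: "z \<in> V'" "\<pi> v \<in> V'" "\<rho> < gdist E' z f" using v Z S proj_V' ball_avoids_f[OF Z XY'] by auto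
  have le: "gdist E' z (\<pi> v) \<le> \<rho>" using Q.d_sym[OF zV(1,2)] v(3) by simp
  then have "\<pi> v \<noteq> f" using zV(3) by auto
  then have vW: "v \<notin> W" "\<pi> v = v" using W by (auto simp: cproj_def split: if_splits)
  then have "d z v \<le> \<rho>" using dist_unproj[OF zV(1,2)] zV(3) le by simp
  then have "d v z \<le> \<rho>" using d_sym[of v z] subsetD[OF V'_sub zV(1)] subsetD[OF S(1) v(1)] by simp
  then show ?thesis using v vW by blast
qed

lemma proj_meet: "S \<inter> (A - W) \<noteq> {} \<Longrightarrow> \<pi> ` S \<inter> (A - W) \<noteq> {}"
  by (force simp: cproj_def)

text \<open>A system with one set short, and a set that only reaches \<open>Y\<close> but can be prolonged through \<open>I\<close>.\<close>

definition half :: "'a set set \<Rightarrow> 'a set \<Rightarrow> bool" where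
  "half \<Q> S0 \<longleftrightarrow> system V E (card \<T>) D X Y \<Q> \<and>
     (\<forall>S\<in>\<Q>. S \<subseteq> V - W \<and> far E (D + l + 1) S W \<and> far E D S S0) \<and>
     conn E S0 \<and> I \<subseteq> S0 \<and> S0 \<subseteq> V - W \<union> I \<and> S0 \<inter> Y \<noteq> {}"

text \<open>At most one member contains \<open>f\<close>, and it is rerouted through
  \<open>I\<close>. The others are far from \<open>f\<close>, hence from \<open>W\<close> and from
  \<open>I\<close>; the difference between \<open>D1\<close> and \<open>D\<close> pays for the
  distance \<open>l + 1\<close> from \<open>I\<close> to \<open>W\<close>.\<close>

lemma split_system:
  assumes P: "system V' E' (Suc (card \<T>)) D1 X' Y' \<P>" and XY': "X' \<subseteq> X - W \<union> {f}" "Y' \<subseteq> Y - W"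
  shows "(\<exists>\<P>. system V E (Suc (card \<T>)) D X Y \<P> \<and> (\<forall>S\<in>\<P>. S \<subseteq> V - W \<union> I)) \<or>
    (\<exists>\<Q> S0. half \<Q> S0 \<and> (f \<notin> X' \<longrightarrow> S0 \<inter> X \<noteq> {}))"
proof -
  have PV: "S \<subseteq> V'" "conn E' S" "S \<inter> X' \<noteq> {}" "S \<inter> Y' \<noteq> {}" if "S \<in> \<P>" for S
    using P that unfolding system_def by auto
  have Pfar: "far E' D1 S T" if "S \<in> \<P>" "T \<in> \<P>" "S \<noteq> T" for S T
    using P that unfolding system_def by auto
  have Pfin: "finite \<P>" "card \<P> = Suc (card \<T>)" using P by (auto simp: system_def)
  have sys: "system V E (card \<R>) D X Y \<R>" if R: "\<R> \<subseteq> \<P>" "\<And>S. S \<in> \<R> \<Longrightarrow> f \<notin> S" for \<R>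
    unfolding system_def
  proof (intro conjI ballI impI)
    show "finite \<R>" using R Pfin finite_subset by blast
  next
    fix S assume S: "S \<in> \<R>"
    note SP = PV[OF subsetD[OF R(1) S]]
    show "S \<subseteq> V" "conn E S" "S \<inter> X \<noteq> {}" "S \<inter> Y \<noteq> {}"
      using SP V'_sub conn_not_f[OF SP(2,1) R(2)[OF S]] R(2)[OF S] XY' by auto
  next
    fix S T assume ST: "S \<in> \<R>" "T \<in> \<R>" "S \<noteq> T"
    have "S - {f} = S" "T - {f} = T" using R ST by auto
    then have "far E D1 S T" using far_unproj[OF _ _ Pfar, of S T] PV(1) R ST by (metis subsetD)
    then show "far E D S T" using far_mono D_le by blast
  qed simp
  show ?thesis
  proof (cases "\<exists>S\<in>\<P>. f \<in> S")
    case False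
    then have "system V E (Suc (card \<T>)) D X Y \<P>" using sys[of \<P>] Pfin by auto
    moreover have "\<forall>S\<in>\<P>. S \<subseteq> V - W \<union> I" using False not_f PV(1) by blast
    ultimately show ?thesis by blast
  next
    case True
    then obtain S1 where S1: "S1 \<in> \<P>" "f \<in> S1" by blast
    let ?R = "\<P> - {S1}" and ?S = "S1 - {f} \<union> I"
    have nf: "f \<notin> S" if "S \<in> ?R" for S
      using farD[OF Pfar[of S S1], of f f] S1 that by auto
    have "card ?R = card \<T>" using Pfin S1 by simp
    then have "system V E (card \<T>) D X Y ?R" using sys[of ?R] nf by auto
    moreover have "S \<subseteq> V - W \<and> far E (D + l + 1) S W \<and> far E D S ?S" if S: "S \<in> ?R" for S
    proof -
      have SP: "S \<in> \<P>" "S \<noteq> S1" using S by auto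
      have "far E' D1 S {f}" using Pfar[OF SP(1) S1(1) SP(2)] S1(2) by (auto simp: far_def)
      then have fW: "far E (D + l + 1) S W" using far_unproj_f[OF PV(1)[OF SP(1)]] far_mono params(1) by blast
      have sub: "S \<subseteq> V" "S - {f} = S" using PV(1)[OF SP(1)] V'_sub nf[OF S] by auto
      have "far E D S (S1 - {f})"
        using far_mono[OF far_unproj[OF PV(1)[OF SP(1)] PV(1)[OF S1(1)] Pfar[OF SP(1) S1(1) SP(2)]] D_le] sub by simp
      then show ?thesis using far_I[OF sub(1) fW] fW not_f[OF PV(1)[OF SP(1)] nf[OF S]] by auto
    qed
    moreover have "conn E ?S" using conn_realize PV[OF S1(1)] S1 by auto
    moreover have "?S \<subseteq> V - W \<union> I" using PV(1)[OF S1(1)] by (auto simp: V'_def)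
    moreover have "?S \<inter> Y \<noteq> {}" "f \<notin> X' \<longrightarrow> ?S \<inter> X \<noteq> {}"
      using PV(3,4)[OF S1(1)] W(3) XY' by auto
    ultimately show ?thesis unfolding half_def by (intro disjI2 exI[of _ ?R] exI[of _ ?S]) auto
  qed
qed

text \<open>A set joining \<open>X\<close> to \<open>Y\<close> through \<open>W\<close> is hit, so that \<open>W\<close> cannot be reached from both.\<close>

lemma side_both:
  assumes "menger V' E' (Suc (card \<T>)) D1 \<rho> (X - W) (Y - W)"
  shows "(\<exists>\<P>. system V E (Suc (card \<T>)) D X Y \<P> \<and> (\<forall>S\<in>\<P>. S \<subseteq> V - W \<union> I)) \<or>
    (\<exists>Z\<subseteq>V. finite Z \<and> card Z \<le> card \<T> \<and> covers V E \<rho> (X - W) (Y - W) Z \<and>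
      (covers V E \<rho> (X - W) W Z \<or> covers V E \<rho> W (Y - W) Z))"
  using assms unfolding menger_def
proof (elim disjE exE conjE)
  fix \<P> assume P: "system V' E' (Suc (card \<T>)) D1 (X - W) (Y - W) \<P>"
  show ?thesis
    using split_system[OF P Un_upper1 subset_refl]
  proof (elim disjE exE conjE)
    fix \<Q> S0 assume "half \<Q> S0" and S0: "f \<notin> X - W \<longrightarrow> S0 \<inter> X \<noteq> {}"
    then have Q: "system V E (card \<T>) D X Y \<Q>" "\<And>S. S \<in> \<Q> \<Longrightarrow> S \<subseteq> V - W \<and> far E D S S0"
      and S: "conn E S0" "S0 \<subseteq> V - W \<union> I" "S0 \<inter> Y \<noteq> {}"
      by (auto simp: half_def)
    have "system V E 1 D X Y {S0}" using S S0 I(1) W(3) unfolding system_def by auto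
    then have "system V E (card \<T> + 1) D X Y (\<Q> \<union> {S0})" using system_Un[OF Q(1)] Q(2) by blast
    moreover have "\<forall>S\<in>\<Q> \<union> {S0}. S \<subseteq> V - W \<union> I" using Q(2) S(2) by blast
    ultimately show ?thesis by (intro disjI1 exI[of _ "\<Q> \<union> {S0}"]) simp
  qed blast
next
  fix Z assume Z: "Z \<subseteq> V'" "finite Z" "card Z < Suc (card \<T>)" "covers V' E' \<rho> (X - W) (Y - W) Z"
  have hit: "\<exists>v\<in>S - W. \<exists>z\<in>Z. d v z \<le> \<rho>"
    if "S \<subseteq> V" "conn E S" "S \<inter> (X - W) \<noteq> {}" "S \<inter> (Y - W) \<noteq> {}" for S
    using cover_hits[OF Z subset_refl subset_refl that(1,2) proj_meet[OF that(3)] proj_meet[OF that(4)]] .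
  have "covers V E \<rho> (X - W) (Y - W) Z" using hit unfolding covers_def hits_def by blast
  moreover have "covers V E \<rho> (X - W) W Z \<or> covers V E \<rho> W (Y - W) Z"
  proof (rule ccontr)
    assume "\<not> ?thesis"
    then obtain S1 S2 where S1: "S1 \<subseteq> V" "conn E S1" "S1 \<inter> (X - W) \<noteq> {}" "S1 \<inter> W \<noteq> {}" "\<not> hits E \<rho> Z S1"
      and S2: "S2 \<subseteq> V" "conn E S2" "S2 \<inter> (Y - W) \<noteq> {}" "S2 \<inter> W \<noteq> {}" "\<not> hits E \<rho> Z S2"
      unfolding covers_def by blast
    obtain w1 w2 where w: "w1 \<in> S1 \<inter> W" "w2 \<in> S2 \<inter> W" using S1(4) S2(4) by blast
    \<comment> \<open>Joined through \<open>W\<close>, the two sets must be hit outside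
      \<open>W\<close>, hence in \<open>S1\<close> or \<open>S2\<close>.\<close>
    have c1: "conn E (S1 \<union> W)" using conn_Un[OF S1(2) W(2), of w1] w sym by auto
    have c2: "conn E (S1 \<union> W \<union> S2)" using conn_Un[OF c1 S2(2), of w2] w sym by auto
    have "\<exists>v\<in>(S1 \<union> W \<union> S2) - W. \<exists>z\<in>Z. d v z \<le> \<rho>"
      by (rule hit) (use c2 S1 S2 W in auto)
    then show False using S1(5) S2(5) unfolding hits_def by blast
  qed
  ultimately show ?thesis using Z V'_sub by (intro disjI2 exI[of _ Z]) auto
qed

text \<open>With \<open>f\<close> as an additional terminal on the side of \<open>X\<close>, the set
  through \<open>f\<close> becomes a half set to be prolonged beyond \<open>I\<close>, while a cover
  also separates \<open>W\<close> from \<open>Y\<close>.\<close>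

lemma side_one:
  assumes "menger V' E' (Suc (card \<T>)) D1 \<rho> (X - W \<union> {f}) (Y - W)"
  shows "(\<exists>\<P>. system V E (Suc (card \<T>)) D X Y \<P> \<and> (\<forall>S\<in>\<P>. S \<subseteq> V - W \<union> I)) \<or>
    (\<exists>\<Q> S0. half \<Q> S0) \<or>
    (\<exists>Z\<subseteq>V. finite Z \<and> card Z \<le> card \<T> \<and> covers V E \<rho> (X - W) (Y - W) Z \<and> covers V E \<rho> W (Y - W) Z)"
  using assms unfolding menger_def
proof (elim disjE exE conjE)
  fix \<P> assume "system V' E' (Suc (card \<T>)) D1 (X - W \<union> {f}) (Y - W) \<P>"
  from split_system[OF this subset_refl subset_refl] show ?thesis by blast
next
  fix Z assume Z: "Z \<subseteq> V'" "finite Z" "card Z < Suc (card \<T>)" "covers V' E' \<rho> (X - W \<union> {f}) (Y - W) Z"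
  have "hits E \<rho> Z S"
    if S: "S \<subseteq> V" "conn E S" "S \<inter> (X - W) \<noteq> {} \<or> S \<inter> W \<noteq> {}" "S \<inter> (Y - W) \<noteq> {}" for S
  proof -
    have "\<pi> ` S \<inter> (X - W \<union> {f}) \<noteq> {}"
      using S(3)
    proof
      assume "S \<inter> (X - W) \<noteq> {}" then show ?thesis using proj_meet[of S X] by blast
    next
      assume "S \<inter> W \<noteq> {}"
      then obtain w where "w \<in> S" "w \<in> W" by blast
      then have "f \<in> \<pi> ` S" using proj_eq_f by (metis image_eqI)
      then show ?thesis by auto
    qed
    then show ?thesis using cover_hits[OF Z _ subset_refl S(1,2) _ proj_meet[OF S(4)]] unfolding hits_def by blast
  qed
  then have "covers V E \<rho> (X - W) (Y - W) Z \<and> covers V E \<rho> W (Y - W) Z" unfolding covers_def by blast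
  then show ?thesis using Z V'_sub by (intro disjI2 exI[of _ Z]) auto
qed

end

section \<open>Combining the two sides\<close>

lemma covers_sym: "covers V E r X Y Z \<Longrightarrow> covers V E r Y X Z"
  unfolding covers_def by blast

lemma system_sym: "system V E k D X Y \<P> \<Longrightarrow> system V E k D Y X \<P>"
  unfolding system_def by blast

lemma menger_sym: "menger V E k D r X Y \<Longrightarrow> menger V E k D r Y X"
  unfolding menger_def
  by (elim disjE exE conjE) (auto intro: covers_sym system_sym)

lemma hits_mono: "hits E r Z S \<Longrightarrow> Z \<subseteq> Z' \<Longrightarrow> hits E r Z' S"
  unfolding hits_def by blast

lemma menger_mono:
  assumes "menger V E k D r X Y" "r \<le> r'" shows "menger V E k D r' X Y"
proof -
  have "hits E r Z S \<Longrightarrow> hits E r' Z S" for Z S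
    using assms(2) unfolding hits_def by (meson order_trans)
  then have "covers V E r X Y Z \<Longrightarrow> covers V E r' X Y Z" for Z unfolding covers_def by simp
  then show ?thesis using assms(1) unfolding menger_def by blast
qed

lemma (in side) tubes:
  assumes "D \<le> s" shows "system V E (card \<T>) D X Y \<T>"
  unfolding system_def
proof (intro conjI ballI impI)
  fix S T assume "S \<in> \<T>" "T \<in> \<T>" "S \<noteq> T"
  then show "far E D S T" using far_mono[OF TT assms] by blast
qed (use T T_fin in auto)

text \<open>On the second side \<open>X\<close> and \<open>Y\<close> are exchanged, so that its half
  sets reach \<open>X\<close> and match the half sets of the first side, which reach
  \<open>Y\<close>.\<close>

locale two_sides =
  A: side V E W f I l D D1 s \<rho> \<A> X Y + B: side V E U f' I l D D1 s \<rho> \<B> Y X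
  for V :: "'a set" and E W f I l D D1 s \<rho> \<A> X Y U f' \<B> +
  assumes U: "U = V - W" and sD: "D + l + 1 \<le> s"
begin

lemma tubes: "system V E (card \<A>) D X Y \<A>" "system V E (card \<B>) D X Y \<B>"
  using A.tubes B.tubes[THEN system_sym] sD by simp_all

lemma far_other:
  assumes "S \<subseteq> V" "far E (D + l + 1) S W" "T \<subseteq> W \<union> I"
  shows "far E D S T"
proof -
  have "far E D S (W \<union> I)" using A.far_I[OF assms(1,2)] far_mono[OF assms(2), of D] by simp
  then show ?thesis using assms(3) unfolding far_def by blast
qed

lemma add_tubes:
  assumes "system V E k D X Y \<P>" "\<And>S. S \<in> \<P> \<Longrightarrow> S \<subseteq> W \<union> I"
  shows "system V E (card \<A> + k) D X Y (\<A> \<union> \<P>)"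
proof (rule A.system_Un[OF tubes(1) assms(1)])
  fix S T assume S: "S \<in> \<A>" and T: "T \<in> \<P>"
  show "far E D S T"
    using far_other[of S T] A.T(1,5)[OF S] far_mono[OF A.T(5)[OF S] sD] assms(2)[OF T] by auto
qed

text \<open>A set with its ends on different sides meets both \<open>U\<close> and \<open>W\<close>,
  so it is enough that one of the covers blocks it on its own side. The last two hypotheses treat
  the two directions of crossing.\<close>

lemma covers_Un:
  assumes "covers V E \<rho> (X - W) (Y - W) ZA" "covers V E \<rho> (X - U) (Y - U) ZB"
    and "covers V E \<rho> (X - W) W ZA \<or> covers V E \<rho> U (Y - U) ZB"
    and "covers V E \<rho> (X - U) U ZB \<or> covers V E \<rho> W (Y - W) ZA"
  shows "covers V E \<rho> X Y (ZA \<union> ZB)"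
  unfolding covers_def
proof (intro allI impI)
  fix S assume S: "S \<subseteq> V" "conn E S" "S \<inter> X \<noteq> {}" "S \<inter> Y \<noteq> {}"
  obtain x y where xy: "x \<in> S" "x \<in> X" "y \<in> S" "y \<in> Y" using S by auto
  have "hits E \<rho> ZA S \<or> hits E \<rho> ZB S"
  proof (cases "x \<in> W"; cases "y \<in> W")
    assume "x \<in> W" "y \<in> W"
    then have "S \<inter> (X - U) \<noteq> {}" "S \<inter> (Y - U) \<noteq> {}" using xy U by auto
    then show ?thesis using assms(2) S unfolding covers_def by blast
  next
    assume "x \<notin> W" "y \<notin> W"
    then have "S \<inter> (X - W) \<noteq> {}" "S \<inter> (Y - W) \<noteq> {}" using xy by auto
    then show ?thesis using assms(1) S unfolding covers_def by blast
  next
    assume "x \<notin> W" "y \<in> W"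
    then have "S \<inter> (X - W) \<noteq> {}" "S \<inter> (Y - U) \<noteq> {}" "S \<inter> W \<noteq> {}" "S \<inter> U \<noteq> {}" using xy U S by auto
    then show ?thesis using assms(3) S unfolding covers_def by blast
  next
    assume "x \<in> W" "y \<notin> W"
    then have "S \<inter> (Y - W) \<noteq> {}" "S \<inter> (X - U) \<noteq> {}" "S \<inter> W \<noteq> {}" "S \<inter> U \<noteq> {}" using xy U S by auto
    then show ?thesis using assms(4) S unfolding covers_def by blast
  qed
  then show "hits E \<rho> (ZA \<union> ZB) S" by (auto intro: hits_mono)
qed

lemma menger_covers:
  assumes "ZA \<subseteq> V" "ZB \<subseteq> V" "finite ZA" "finite ZB" "card ZA \<le> card \<A>" "card ZB \<le> card \<B>"
    "covers V E \<rho> X Y (ZA \<union> ZB)"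
  shows "menger V E (Suc (card \<A> + card \<B>)) D \<rho> X Y"
  unfolding menger_def using assms card_Un_le[of ZA ZB]
  by (intro disjI2 exI[of _ "ZA \<union> ZB"]) auto

text \<open>Both half sets contain \<open>I\<close>, so their union is connected and reaches
  \<open>X\<close> through one and \<open>Y\<close> through the other.\<close>

lemma glue:
  assumes "A.half \<P> SA" "B.half \<Q> SB"
  shows "system V E (Suc (card \<A> + card \<B>)) D X Y (\<P> \<union> \<Q> \<union> {SA \<union> SB})"
proof -
  from assms(1) have P: "system V E (card \<A>) D X Y \<P>"
      "\<And>S. S \<in> \<P> \<Longrightarrow> S \<subseteq> V - W \<and> far E (D + l + 1) S W \<and> far E D S SA"
    and SA: "conn E SA" "I \<subseteq> SA" "SA \<subseteq> V - W \<union> I" "SA \<inter> Y \<noteq> {}"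
    unfolding A.half_def by auto
  from assms(2) have Q: "system V E (card \<B>) D X Y \<Q>"
      "\<And>S. S \<in> \<Q> \<Longrightarrow> S \<subseteq> V - U \<and> far E (D + l + 1) S U \<and> far E D S SB"
    and SB: "conn E SB" "I \<subseteq> SB" "SB \<subseteq> V - U \<union> I" "SB \<inter> X \<noteq> {}"
    unfolding B.half_def by (auto intro: system_sym)
  have W: "V - U = W" and UV: "U \<subseteq> V" using U A.W by auto
  have PQ: "far E D S T" if "S \<in> \<P>" "T \<in> \<Q>" for S T
    using far_other[of S T] P(2)[OF that(1)] Q(2)[OF that(2)] W by blast
  have P0: "far E D S (SA \<union> SB)" if "S \<in> \<P>" for S
    using far_other[of S SB] P(2)[OF that] SB(3) W by auto
  have Q0: "far E D S (SA \<union> SB)" if "S \<in> \<Q>" for S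
  proof -
    have S: "S \<subseteq> V" "far E (D + l + 1) S U" "far E D S SB" using Q(2)[OF that] by auto
    have "far E D S (U \<union> I)" using B.far_I[OF S(1,2)] far_mono[OF S(2), of D] by simp
    then have "far E D S SA" using SA(3) U unfolding far_def by blast
    then show ?thesis using S by simp
  qed
  obtain c where c: "c \<in> I" using A.I by auto
  have "conn E (SA \<union> SB)" using conn_Un[OF SA(1) SB(1), of c] c SA(2) SB(2) A.sym by auto
  then have "system V E 1 D X Y {SA \<union> SB}"
    using SA SB A.I(1) W UV A.W(1) unfolding system_def by auto
  then have "system V E (card \<A> + card \<B> + 1) D X Y (\<P> \<union> \<Q> \<union> {SA \<union> SB})"
    using A.system_Un[OF A.system_Un[OF P(1) Q(1) PQ]] P0 Q0 by blast
  then show ?thesis by simp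
qed

text \<open>The given covers leave open only the direction from \<open>X\<close> in \<open>W\<close>
  to \<open>Y\<close> in \<open>U\<close>. With the contracted vertices as terminals, each side
  yields a full system, a cover blocking this direction, or a half set; two half sets are
  glued.\<close>

lemma menger_crossing:
  assumes mA: "menger A.V' A.E' (Suc (card \<A>)) D1 \<rho> (X - W \<union> {f}) (Y - W)"
    and mB: "menger B.V' B.E' (Suc (card \<B>)) D1 \<rho> (Y - U \<union> {f'}) (X - U)"
    and tA: "\<And>\<P>. system V E (Suc (card \<A>)) D X Y \<P> \<Longrightarrow> \<forall>S\<in>\<P>. S \<subseteq> V - W \<union> I \<Longrightarrow>
      menger V E (Suc (card \<A> + card \<B>)) D \<rho> X Y"
    and ZA: "ZA \<subseteq> V" "finite ZA" "card ZA \<le> card \<A>" "covers V E \<rho> (X - W) (Y - W) ZA"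
      "covers V E \<rho> (X - W) W ZA"
    and ZB: "ZB \<subseteq> V" "finite ZB" "card ZB \<le> card \<B>" "covers V E \<rho> (X - U) (Y - U) ZB"
      "covers V E \<rho> U (Y - U) ZB"
  shows "menger V E (Suc (card \<A> + card \<B>)) D \<rho> X Y"
  using A.side_one[OF mA]
proof (elim disjE exE conjE)
  fix \<P> assume "system V E (Suc (card \<A>)) D X Y \<P>" "\<forall>S\<in>\<P>. S \<subseteq> V - W \<union> I"
  then show ?thesis by (rule tA)
next
  fix Z assume Z: "Z \<subseteq> V" "finite Z" "card Z \<le> card \<A>" "covers V E \<rho> (X - W) (Y - W) Z"
    "covers V E \<rho> W (Y - W) Z"
  show ?thesis
    by (rule menger_covers[OF Z(1) ZB(1) Z(2) ZB(2) Z(3) ZB(3)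
        covers_Un[OF Z(4) ZB(4) disjI2[OF ZB(5)] disjI2[OF Z(5)]]])
next
  fix \<P> SA assume PA: "A.half \<P> SA"
  show ?thesis
    using B.side_one[OF mB]
  proof (elim disjE exE conjE)
    fix \<Q> assume Q: "system V E (Suc (card \<B>)) D Y X \<Q>" "\<forall>S\<in>\<Q>. S \<subseteq> V - U \<union> I"
    have "V - U = W" using U A.W by auto
    then have "system V E (card \<A> + Suc (card \<B>)) D X Y (\<A> \<union> \<Q>)"
      using add_tubes[OF system_sym[OF Q(1)]] Q(2) by auto
    then show ?thesis unfolding menger_def by auto
  next
    fix Z assume Z: "Z \<subseteq> V" "finite Z" "card Z \<le> card \<B>" "covers V E \<rho> (Y - U) (X - U) Z"
      "covers V E \<rho> U (X - U) Z"
    show ?thesis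
      by (rule menger_covers[OF ZA(1) Z(1) ZA(2) Z(2) ZA(3) Z(3)
          covers_Un[OF ZA(4) covers_sym[OF Z(4)] disjI1[OF ZA(5)] disjI1[OF covers_sym[OF Z(5)]]]])
  next
    fix \<Q> SB assume "B.half \<Q> SB"
    then show ?thesis using glue[OF PA] unfolding menger_def by blast
  qed
qed

end

lemma menger_step:
  fixes V :: "'a set"
  assumes G: "cgraph V E" "cut_conn l V E" "X \<subseteq> V" "Y \<subseteq> V" and m: "2 \<le> m"
    and IH: "\<And>k (V' :: 'a set) E' X' Y'. k \<le> m \<Longrightarrow> cgraph V' E' \<Longrightarrow> cut_conn l V' E' \<Longrightarrow> X' \<subseteq> V' \<Longrightarrow> Y' \<subseteq> V' \<Longrightarrow>
      menger V' E' k D1 \<rho> X' Y'"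
    and sys: "system V E m (2 * s) X Y \<T>"
    and c: "D + l + 1 \<le> D1" "2 * \<rho> < s" "D + l + 1 \<le> s"
  shows "menger V E (Suc m) D \<rho> X Y"
proof -
  interpret cgraph V E by (rule G)
  have fin: "finite \<T>" "card \<T> = m" using sys by (auto simp: system_def)
  have T: "T \<subseteq> V" "conn E T" "T \<inter> X \<noteq> {}" "T \<inter> Y \<noteq> {}" if "T \<in> \<T>" for T
    using sys that by (auto simp: system_def)
  have TT: "far E (2 * s) T T'" if "T \<in> \<T>" "T' \<in> \<T>" "T \<noteq> T'" for T T'
    using sys that by (auto simp: system_def)
  have "\<not> card \<T> \<le> Suc 0" using m fin by simp
  then obtain T0 T1 where T01: "T0 \<in> \<T>" "T1 \<in> \<T>" "T0 \<noteq> T1"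
    using card_le_Suc0_iff_eq[OF fin(1)] by blast
  \<comment> \<open>Neighbourhoods of radius \<open>s\<close>, pairwise disjoint as the members are
    more than \<open>2 * s\<close> apart. Being connected, each of them falls on one side of the
    bipartition.\<close>
  define nb where "nb T = (\<Union>t\<in>T. cball t s)" for T
  have nbV: "nb T \<subseteq> V" for T by (auto simp: nb_def cball_def)
  have nb_sub: "T \<subseteq> nb T" if "T \<in> \<T>" for T using T(1)[OF that] by (auto simp: nb_def cball_def)
  have nb_conn: "conn E (nb T)" if TT': "T \<in> \<T>" for T
  proof -
    obtain x where x: "x \<in> T" using T(3)[OF TT'] by auto
    have "conn E (\<Union>t\<in>T. cball t s \<union> T)"
    proof (rule conn_UN[OF sym, where c = x])
      fix t assume t: "t \<in> T"
      then have "t \<in> V" using T(1)[OF that] by auto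
      then show "conn E (cball t s \<union> T)" using conn_Un[OF conn_cball T(2)[OF that], of t t] t sym by auto
    qed (use x in auto)
    moreover have "(\<Union>t\<in>T. cball t s \<union> T) = nb T" using nb_sub[OF that] by (auto simp: nb_def)
    ultimately show ?thesis by simp
  qed
  have nb_disj: "nb T \<inter> nb T' = {}" if "T \<in> \<T>" "T' \<in> \<T>" "T \<noteq> T'" for T T'
  proof (rule ccontr)
    assume "nb T \<inter> nb T' \<noteq> {}"
    then obtain v t t' where v: "t \<in> T" "t' \<in> T'" "v \<in> V" "d t v \<le> s" "d t' v \<le> s"
      by (auto simp: nb_def cball_def)
    have V: "t \<in> V" "t' \<in> V" using v T(1)[OF that(1)] T(1)[OF that(2)] by auto
    show False using d_tri[OF V(1) v(3) V(2)] d_sym[OF V(2) v(3)] farD[OF TT[OF that] v(1,2)] v(4,5) by linarith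
  qed
  obtain v0 v1 where v01: "v0 \<in> T0" "v1 \<in> T1" using T(3)[OF T01(1)] T(3)[OF T01(2)] by auto
  let ?N = "nb T0"
  have v01': "v0 \<in> ?N" "v1 \<in> V - ?N"
    using v01 nb_sub[OF T01(1)] nb_sub[OF T01(2)] nbV nb_disj[OF T01] by auto
  define W where "W = ccomp (V - ?N) v1"
  define U where "U = V - W"
  have WN: "W \<subseteq> V - ?N" unfolding W_def by (rule ccomp_sub[OF v01'(2)])
  have WV: "W \<subseteq> V" "U \<subseteq> V" "V - U = W" "V - W = U" using WN by (auto simp: U_def)
  have cW: "conn E W" unfolding W_def by (rule conn_ccomp[OF v01'(2)])
  have cU: "conn E U" unfolding U_def W_def
    by (rule conn_Diff_ccomp[OF nb_conn[OF T01(1)] nbV _ v01'(2)]) (use v01' in auto)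
  have f: "v1 \<in> W" "v0 \<in> U" using v01' WN nbV by (auto simp: W_def U_def)
  have nb_side: "nb T \<subseteq> U \<or> nb T \<subseteq> W" if "T \<in> \<T>" for T
  proof (cases "T = T0")
    case True then show ?thesis using WN nbV by (auto simp: U_def)
  next
    case False
    have sub: "nb T \<subseteq> V - ?N" using nb_disj[OF that T01(1) False] nbV by auto
    show ?thesis
    proof (cases "nb T \<inter> W = {}")
      case True then show ?thesis using nbV by (auto simp: U_def)
    next
      case False
      then obtain z where z: "z \<in> nb T" "z \<in> W" by auto
      have "nb T \<subseteq> ccomp (V - ?N) z" by (rule conn_sub_ccomp[OF nb_conn[OF that] sub z(1)])
      also have "\<dots> \<subseteq> W" using z(2) unfolding W_def ccomp_def by auto
      finally show ?thesis by simp
    qed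
  qed
  define \<A> where "\<A> = {T \<in> \<T>. nb T \<subseteq> U}"
  define \<B> where "\<B> = {T \<in> \<T>. nb T \<subseteq> W}"
  have "\<A> \<union> \<B> = \<T>" using nb_side by (auto simp: \<A>_def \<B>_def)
  moreover have "\<A> \<inter> \<B> = {}"
  proof (rule ccontr)
    assume "\<A> \<inter> \<B> \<noteq> {}"
    then obtain T where T': "T \<in> \<T>" "nb T \<subseteq> U" "nb T \<subseteq> W" by (auto simp: \<A>_def \<B>_def)
    then show False using T(3)[OF T'(1)] nb_sub[OF T'(1)] by (auto simp: U_def)
  qed
  moreover have finAB: "finite \<A>" "finite \<B>" using fin by (auto simp: \<A>_def \<B>_def)
  ultimately have cardAB: "card \<A> + card \<B> = m" using fin card_Un_disjoint by metis
  have "T0 \<in> \<A>" using T01 WN nbV by (auto simp: \<A>_def U_def)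
  moreover have "T1 \<in> \<B>"
    using nb_side[OF T01(2)] v01 nb_sub[OF T01(2)] f T01 by (auto simp: \<B>_def U_def)
  \<comment> \<open>Both counts are below \<open>m\<close>, so on each side the induction hypothesis
    can be asked for one set more than there are members of \<open>\<T>\<close>.\<close>
  ultimately have pos: "0 < card \<A>" "0 < card \<B>" using finAB by (auto simp: card_gt_0_iff)
  have tube_far: "far E s T S" if "T \<in> \<T>" "nb T \<inter> S = {}" "S \<subseteq> V" for T S
  proof (rule farI, rule ccontr)
    fix t v assume "t \<in> T" "v \<in> S" "\<not> s < d t v"
    moreover from this have "v \<in> cball t s" using that(3) by (auto simp: cball_def)
    ultimately show False using that(2) unfolding nb_def by blast
  qed
  define I where "I = (\<Union>b\<in>bdry E W U. cball b l)"
  have bV: "bdry E W U \<subseteq> V" using WV by (auto simp: bdry_def)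
  have bU: "bdry E W (V - W) = bdry E W U" using WV by simp
  have "bdry E W U \<noteq> {}"
  proof -
    obtain x y where "x \<in> V" "x \<in> W" "y \<in> V" "y \<notin> W" "(x, y) \<in> E"
    proof (rule conn_exit[OF conn_V _ f(1)])
      show "v1 \<in> V" "v0 \<in> V" "v0 \<notin> W" using f WV(1) by (auto simp: U_def)
    qed
    then show ?thesis by (auto simp: bdry_def U_def)
  qed
  then obtain b0 where b0: "b0 \<in> bdry E W U" by auto
  have I: "I \<subseteq> V" "conn E I" "I \<noteq> {}" "bdry E W U \<subseteq> I"
  proof -
    show "I \<subseteq> V" by (auto simp: I_def cball_def)
    show "conn E I" unfolding I_def
    proof (rule conn_chain_balls[OF bV b0])
      fix z assume "z \<in> bdry E W U"
      then show "(b0, z) \<in> (near E l (bdry E W U))\<^sup>*"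
        using G(2)[unfolded cut_conn_def, rule_format, OF WV(1), of b0 z] cW cU WV bU b0 by simp
    qed
    show "bdry E W U \<subseteq> I" unfolding I_def using bV cball_self by blast
    then show "I \<noteq> {}" using b0 by auto
  qed
  have I_near: "\<exists>w\<in>W. d v w \<le> l + 1" "\<exists>u\<in>U. d v u \<le> l + 1" if v: "v \<in> I" for v
  proof -
    obtain b where b: "b \<in> bdry E W U" "v \<in> V" "d b v \<le> l" using v by (auto simp: I_def cball_def)
    then obtain u where u: "b \<in> W" "u \<in> U" "(b, u) \<in> E" by (auto simp: bdry_def)
    have V: "b \<in> V" "u \<in> V" using u WV by auto
    have vb: "d v b \<le> l" using b d_sym[OF V(1) b(2)] by simp
    then show "\<exists>w\<in>W. d v w \<le> l + 1" using u(1) by (intro bexI[of _ b]) auto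
    show "\<exists>u\<in>U. d v u \<le> l + 1" using d_tri[OF b(2) V] d_edge[OF u(3)] vb u(2) by (intro bexI[of _ u]) auto
  qed
  have side: "side V E W' f' I l D D1 s \<rho> {T \<in> \<T>. nb T \<subseteq> V - W'} X' Y'"
    if W': "W' \<subseteq> V" "conn E W'" "f' \<in> W'" "bdry E W' (V - W') \<subseteq> I \<or> bdry E (V - W') W' \<subseteq> I"
      "\<And>v. v \<in> I \<Longrightarrow> \<exists>w\<in>W'. d v w \<le> l + 1" and XY': "{X', Y'} = {X, Y}" for W' f' X' Y'
  proof
    show "W' \<subseteq> V" "conn E W'" "f' \<in> W'" "I \<subseteq> V" "conn E I" "I \<noteq> {}" by fact+
    show "D + l + 1 \<le> D1" "2 * \<rho> < s" by fact+
    show "finite {T \<in> \<T>. nb T \<subseteq> V - W'}" using fin by simp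
    show "X' \<subseteq> V" "Y' \<subseteq> V" using G(3,4) XY' by (auto simp: doubleton_eq_iff)
    show "u \<in> I \<or> w \<in> I" if "(u, w) \<in> E" "u \<notin> W'" "w \<in> W'" for u w
      using W'(4) that E_V[OF that(1)] E_sym[OF that(1)] unfolding bdry_def by blast
    show "\<exists>w\<in>W'. d v w \<le> l + 1" if "v \<in> I" for v using W'(5)[OF that] .
    fix T' assume "T' \<in> {T \<in> \<T>. nb T \<subseteq> V - W'}"
    then have TT': "T' \<in> \<T>" "nb T' \<subseteq> V - W'" by auto
    show "T' \<subseteq> V - W'" using nb_sub[OF TT'(1)] TT' by auto
    show "conn E T'" by (rule T(2)[OF TT'(1)])
    show "T' \<inter> X' \<noteq> {}" "T' \<inter> Y' \<noteq> {}" using T(3,4)[OF TT'(1)] XY' by (auto simp: doubleton_eq_iff)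
    show "far E s T' W'" using tube_far[OF TT'(1) _ W'(1)] TT'(2) by auto
    fix T'' assume "T'' \<in> {T \<in> \<T>. nb T \<subseteq> V - W'}" "T' \<noteq> T''"
    then show "far E s T' T''" using TT[OF TT'(1), of T''] far_mono[of E "2 * s" T' T'' s] by auto
  qed
  have sA: "side V E W v1 I l D D1 s \<rho> \<A> X' Y'" if "{X', Y'} = {X, Y}" for X' Y'
    using side[OF WV(1) cW f(1) _ I_near(1) that] I(4) WV(4) by (simp add: \<A>_def)
  have sB: "side V E U v0 I l D D1 s \<rho> \<B> X' Y'" if "{X', Y'} = {X, Y}" for X' Y'
    using side[OF WV(2) cU f(2) _ I_near(2) that] I(4) WV(3) by (simp add: \<B>_def)
  \<comment> \<open>Three readings of one bipartition: \<open>M'\<close> exchanges \<open>X\<close>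
    and \<open>Y\<close>, and \<open>M''\<close> exchanges the two sides.\<close>
  interpret M: two_sides V E W v1 I l D D1 s \<rho> \<A> X Y U v0 \<B>
    using sA[of X Y] sB[of Y X] c(3) by (auto simp: two_sides_def two_sides_axioms_def U_def)
  interpret M': two_sides V E W v1 I l D D1 s \<rho> \<A> Y X U v0 \<B>
    using sA[of Y X] sB[of X Y] c(3) by (auto simp: two_sides_def two_sides_axioms_def U_def)
  interpret M'': two_sides V E U v0 I l D D1 s \<rho> \<B> X Y W v1 \<A>
    using sA[of Y X] sB[of X Y] c(3) WV by (auto simp: two_sides_def two_sides_axioms_def)
  have k: "Suc (card \<A>) \<le> m" "Suc (card \<B>) \<le> m" using cardAB pos by auto
  have mA: "menger M.A.V' M.A.E' (Suc (card \<A>)) D1 \<rho> X' Y'" if "X' \<subseteq> M.A.V'" "Y' \<subseteq> M.A.V'" for X' Y'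
    by (rule IH[OF k(1) M.A.Q.cgraph_axioms M.A.cut_conn_contract[OF G(2)] that])
  have mB: "menger M.B.V' M.B.E' (Suc (card \<B>)) D1 \<rho> X' Y'" if "X' \<subseteq> M.B.V'" "Y' \<subseteq> M.B.V'" for X' Y'
    by (rule IH[OF k(2) M.B.Q.cgraph_axioms M.B.cut_conn_contract[OF G(2)] that])
  have subA: "X - W \<subseteq> M.A.V'" "Y - W \<subseteq> M.A.V'" "{v1} \<subseteq> M.A.V'" using G by (auto simp: M.A.V'_def)
  have subB: "X - U \<subseteq> M.B.V'" "Y - U \<subseteq> M.B.V'" "{v0} \<subseteq> M.B.V'" using G by (auto simp: M.B.V'_def)
  have tA: "menger V E (Suc (card \<A> + card \<B>)) D \<rho> X Y"
    if "system V E (Suc (card \<A>)) D X Y \<P>" "\<forall>S\<in>\<P>. S \<subseteq> V - W \<union> I" for \<P>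
  proof -
    have "system V E (card \<B> + Suc (card \<A>)) D X Y (\<B> \<union> \<P>)"
      using M''.add_tubes[OF that(1)] that(2) WV by auto
    then show ?thesis unfolding menger_def by (auto simp: add.commute)
  qed
  have tB: "menger V E (Suc (card \<A> + card \<B>)) D \<rho> X Y"
    if "system V E (Suc (card \<B>)) D X Y \<P>" "\<forall>S\<in>\<P>. S \<subseteq> V - U \<union> I" for \<P>
  proof -
    have "system V E (card \<A> + Suc (card \<B>)) D X Y (\<A> \<union> \<P>)"
      using M.add_tubes[OF that(1)] that(2) WV by auto
    then show ?thesis unfolding menger_def by auto
  qed
  have "menger V E (Suc (card \<A> + card \<B>)) D \<rho> X Y"
    using M.A.side_both[OF mA[OF subA(1,2)]]
  proof (elim disjE[of "\<exists>\<P>. P \<P>" for P] exE conjE)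
    fix \<P> assume "system V E (Suc (card \<A>)) D X Y \<P>" "\<forall>S\<in>\<P>. S \<subseteq> V - W \<union> I"
    then show ?thesis by (rule tA)
  next
    fix ZA assume ZA: "ZA \<subseteq> V" "finite ZA" "card ZA \<le> card \<A>" "covers V E \<rho> (X - W) (Y - W) ZA"
      "covers V E \<rho> (X - W) W ZA \<or> covers V E \<rho> W (Y - W) ZA"
    show ?thesis
      using M'.B.side_both[OF mB[OF subB(1,2)]]
    proof (elim disjE[of "\<exists>\<P>. P \<P>" for P] exE conjE)
      fix \<P> assume "system V E (Suc (card \<B>)) D X Y \<P>" "\<forall>S\<in>\<P>. S \<subseteq> V - U \<union> I"
      then show ?thesis by (rule tB)
    next
      fix ZB assume ZB: "ZB \<subseteq> V" "finite ZB" "card ZB \<le> card \<B>" "covers V E \<rho> (X - U) (Y - U) ZB"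
        "covers V E \<rho> (X - U) U ZB \<or> covers V E \<rho> U (Y - U) ZB"
      note mc = M.menger_covers[OF ZA(1) ZB(1) ZA(2) ZB(2) ZA(3) ZB(3)]
      \<comment> \<open>If both covers block the side of \<open>X\<close>, or both that of
        \<open>Y\<close>, then their union covers everything. In the mixed cases one direction of
        crossing stays open.\<close>
      from ZA(5) ZB(5) consider
        "covers V E \<rho> (X - W) W ZA" "covers V E \<rho> (X - U) U ZB" |
        "covers V E \<rho> W (Y - W) ZA" "covers V E \<rho> U (Y - U) ZB" |
        "covers V E \<rho> (X - W) W ZA" "covers V E \<rho> U (Y - U) ZB" |
        "covers V E \<rho> W (Y - W) ZA" "covers V E \<rho> (X - U) U ZB" by blast
      then show ?thesis
      proof cases
        case 1 then show ?thesis using mc M.covers_Un[OF ZA(4) ZB(4)] by blast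
      next
        case 2 then show ?thesis using mc M.covers_Un[OF ZA(4) ZB(4)] by blast
      next
        case 3
        show ?thesis
          by (rule M.menger_crossing[OF mA mB tA ZA(1-4) 3(1) ZB(1-4) 3(2)]) (use subA subB in auto)
      next
        case 4
        have "menger V E (Suc (card \<A> + card \<B>)) D \<rho> Y X"
        proof (rule M'.menger_crossing[OF mA mB _ ZA(1-3) covers_sym[OF ZA(4)] covers_sym[OF 4(1)]
              ZB(1-3) covers_sym[OF ZB(4)] covers_sym[OF 4(2)]])
          fix \<P> assume "system V E (Suc (card \<A>)) D Y X \<P>" "\<forall>S\<in>\<P>. S \<subseteq> V - W \<union> I"
          then show "menger V E (Suc (card \<A> + card \<B>)) D \<rho> Y X"
            using menger_sym[OF tA[OF system_sym]] by blast
        qed (use subA subB in auto)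
        then show ?thesis by (rule menger_sym)
      qed
    qed
  qed
  then show ?thesis using cardAB by simp
qed

text \<open>The radius is chosen before the graph, so the hypothesis applies to quotients;
  \<open>D\<close> is arbitrary, so it applies to the larger distance \<open>2 * s\<close>.\<close>

theorem coarse_menger:
  fixes l :: nat
  shows "\<exists>r. \<forall>(V :: 'a set) E X Y. cgraph V E \<longrightarrow> cut_conn l V E \<longrightarrow> X \<subseteq> V \<longrightarrow> Y \<subseteq> V \<longrightarrow> menger V E k D r X Y"
proof (induction k arbitrary: D rule: less_induct)
  case (less k)
  consider "k = 0" | "k = 1" | "k = 2" | m where "k = Suc m" "2 \<le> m"
    by (metis One_nat_def Suc_1 Suc_le_eq less_one not_less_eq nat_neq_iff not0_implies_Suc)
  then show ?case
  proof cases
    case 1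
    then show ?thesis unfolding menger_def system_def by (intro exI[of _ 0]) auto
  next
    case 2
    have "menger V E 1 D 0 X Y" for V :: "'a set" and E X Y
    proof (cases "\<exists>S\<subseteq>V. conn E S \<and> S \<inter> X \<noteq> {} \<and> S \<inter> Y \<noteq> {}")
      case True
      then obtain S where "S \<subseteq> V" "conn E S" "S \<inter> X \<noteq> {}" "S \<inter> Y \<noteq> {}" by blast
      then show ?thesis unfolding menger_def system_def by (intro disjI1 exI[of _ "{S}"]) auto
    next
      case False
      then show ?thesis unfolding menger_def covers_def by (intro disjI2 exI[of _ "{}"]) auto
    qed
    then show ?thesis using 2 by blast
  next
    case 3
    then show ?thesis using menger2[of l D] by simp
  next
    case (4 m)
    have "\<forall>k' D. \<exists>r. k' < k \<longrightarrow> (\<forall>(V :: 'a set) E X Y. cgraph V E \<longrightarrow> cut_conn l V E \<longrightarrow> X \<subseteq> V \<longrightarrow> Y \<subseteq> V \<longrightarrow>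
        menger V E k' D r X Y)"
      using less by blast
    then obtain R where R: "\<And>k' D (V :: 'a set) E X Y. k' < k \<Longrightarrow> cgraph V E \<Longrightarrow> cut_conn l V E \<Longrightarrow> X \<subseteq> V \<Longrightarrow> Y \<subseteq> V \<Longrightarrow>
        menger V E k' D (R k' D) X Y"
      by metis
    define D1 where "D1 = D + l + 1"
    \<comment> \<open>The sum bounds the radii for all smaller numbers at once. Then
      \<open>s\<close> is chosen beyond it.\<close>
    define \<rho>0 where "\<rho>0 = (\<Sum>k'<k. R k' D1)"
    define s where "s = 2 * \<rho>0 + D + l + 2"
    have R1: "menger V E k' D1 \<rho>0 X Y" if "k' \<le> m" "cgraph V E" "cut_conn l V E" "X \<subseteq> V" "Y \<subseteq> V"
      for k' and V :: "'a set" and E X Y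
    proof -
      have "k' < k" using that(1) 4 by simp
      moreover from this have "R k' D1 \<le> \<rho>0" unfolding \<rho>0_def by (intro member_le_sum) auto
      ultimately show ?thesis using menger_mono[OF R] that(2-5) by blast
    qed
    have "menger V E k D (max \<rho>0 (R m (2 * s))) X Y"
      if G: "cgraph V E" "cut_conn l V E" "X \<subseteq> V" "Y \<subseteq> V" for V :: "'a set" and E X Y
    proof -
      have "menger V E m (2 * s) (R m (2 * s)) X Y" using R G 4 by simp
      then consider \<T> where "system V E m (2 * s) X Y \<T>"
        | Z where "Z \<subseteq> V" "finite Z" "card Z < m" "covers V E (R m (2 * s)) X Y Z"
        unfolding menger_def by blast
      then show ?thesis
      proof cases
        case 1
        have "menger V E (Suc m) D \<rho>0 X Y"
          by (rule menger_step[OF G 4(2) R1 1]) (simp_all add: D1_def s_def)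
        then show ?thesis using menger_mono[OF _ max.cobounded1] 4(1) by blast
      next
        case 2
        then have "menger V E k D (R m (2 * s)) X Y"
          unfolding menger_def 4(1) by (intro disjI2 exI[of _ Z]) simp
        then show ?thesis using menger_mono[OF _ max.cobounded2] by blast
      qed
    qed
    then show ?thesis by blast
  qed
qed

section \<open>Paths in simple graphs\<close>

definition adj :: "'a sgraph \<Rightarrow> ('a \<times> 'a) set" where
  "adj G = {(u, v). {u, v} \<in> edges G}"

lemma walk_relpow: "is_walk G p \<Longrightarrow> (hd p, last p) \<in> adj G ^^ (length p - 1)"
proof (induction p)
  case (Cons u p)
  show ?case
  proof (cases p)
    case (Cons v q)
    then have "is_walk G p" "(u, v) \<in> adj G" using Cons.prems by (auto simp: is_walk_def adj_def)
    then have "(u, last p) \<in> adj G ^^ Suc (length q)"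
      using Cons.IH Cons relpow_Suc_I2[of u v "adj G"] by auto
    then show ?thesis using Cons by simp
  qed auto
qed (simp add: is_walk_def)

lemma relpow_walk:
  assumes "(u, v) \<in> adj G ^^ n" "u \<in> verts G" "adj G \<subseteq> verts G \<times> verts G"
  shows "\<exists>p. is_walk G p \<and> hd p = u \<and> last p = v \<and> length p = Suc n"
  using assms(1)
proof (induction n arbitrary: v)
  case 0
  then show ?case using assms by (intro exI[of _ "[u]"]) (auto simp: is_walk_def)
next
  case (Suc n)
  then obtain y where y: "(u, y) \<in> adj G ^^ n" "(y, v) \<in> adj G" by auto
  then obtain p where p: "is_walk G p" "hd p = u" "last p = y" "length p = Suc n" using Suc.IH by blast
  then have "is_walk G (p @ [v])"
    using y assms(3) by (auto simp: is_walk_def successively_append_iff adj_def)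
  then show ?case using p by (intro exI[of _ "p @ [v]"]) (auto simp: is_walk_def)
qed

locale connected_sgraph = cgraph "verts G" "adj G" for G :: "'a sgraph"
begin

lemma vdist_eq: assumes "u \<in> verts G" "v \<in> verts G" shows "vdist G u v = enat (d u v)"
  unfolding vdist_def
proof (rule antisym)
  obtain p where "is_walk G p" "hd p = u" "last p = v" "length p = Suc (d u v)"
    using relpow_walk[OF relpow_d[OF assms] assms(1) E_sub] by blast
  then show "(INF p\<in>{p. is_walk G p \<and> hd p = u \<and> last p = v}. enat (length p - 1)) \<le> enat (d u v)"
    by (intro INF_lower2[of p]) auto
  show "enat (d u v) \<le> (INF p\<in>{p. is_walk G p \<and> hd p = u \<and> last p = v}. enat (length p - 1))"
    by (rule INF_greatest) (use d_le[OF walk_relpow] in auto)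
qed

lemma conn_walk: "is_walk G p \<Longrightarrow> conn (adj G) (set p)"
proof (induction p)
  case (Cons u p)
  show ?case
  proof (cases p)
    case (Cons v q)
    then have "is_walk G p" "(u, v) \<in> adj G" using Cons.prems by (auto simp: is_walk_def adj_def)
    then have "conn (adj G) ({u} \<union> set p)"
      using conn_Un_edge[of "adj G" "{u}" "set p" u v] Cons.IH Cons sym by auto
    then show ?thesis by simp
  qed simp
qed simp

text \<open>A shortest connection of \<open>X\<close> and \<open>Y\<close> inside \<open>S\<close>
  repeats no vertex and meets \<open>X\<close> and \<open>Y\<close> only at its ends.\<close>

lemma conn_XY_path:
  assumes S: "S \<subseteq> verts G" "conn (adj G) S" "S \<inter> X \<noteq> {}" "S \<inter> Y \<noteq> {}"
  obtains p where "is_XY_path G X Y p" "set p \<subseteq> S"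
proof -
  let ?R = "adj G \<inter> S \<times> S"
  let ?P = "\<lambda>n. \<exists>x\<in>S \<inter> X. \<exists>y\<in>S \<inter> Y. (x, y) \<in> ?R ^^ n"
  define n where "n = (LEAST n. ?P n)"
  obtain x y where "x \<in> S \<inter> X" "y \<in> S \<inter> Y" using S by auto
  moreover from this have "(x, y) \<in> ?R\<^sup>*" using S(2) by (auto simp: conn_def)
  ultimately have "\<exists>n. ?P n" by (meson rtrancl_imp_relpow)
  then have "?P n" unfolding n_def by (rule LeastI_ex)
  then obtain x y where xy: "x \<in> S \<inter> X" "y \<in> S \<inter> Y" "(x, y) \<in> ?R ^^ n" by blast
  have min: "n \<le> m" if "?P m" for m unfolding n_def using that by (rule Least_le)
  obtain f where f: "f 0 = x" "f n = y" "\<And>i. i < n \<Longrightarrow> (f i, f (Suc i)) \<in> ?R"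
    using xy(3) unfolding relpow_fun_conv by blast
  have fS: "f i \<in> S" if "i \<le> n" for i
    using f(3)[of i] f(2) xy(2) that by (cases "i = n") auto
  have sub: "(f i, f j) \<in> ?R ^^ (j - i)" if "i \<le> j" "j \<le> n" for i j
    using that
  proof (induction j rule: dec_induct)
    case (step j)
    then have "(f i, f j) \<in> ?R ^^ (j - i)" "(f j, f (Suc j)) \<in> ?R" using f(3) by auto
    then show ?case using step by (auto simp: Suc_diff_le)
  qed simp
  have fX: "i = 0" if "i \<le> n" "f i \<in> X" for i
  proof -
    have "?P (n - i)" using sub[of i n] fS[of i] that xy f(2) by blast
    then show ?thesis using min that by fastforce
  qed
  have fY: "i = n" if "i \<le> n" "f i \<in> Y" for i
  proof -
    have "?P i" using sub[of 0 i] fS[of i] that xy f(1) by auto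
    then show ?thesis using min that by fastforce
  qed
  have inj: "inj_on f {..n}"
  proof (rule linorder_inj_onI)
    fix i j assume ij: "i < j" "i \<in> {..n}" "j \<in> {..n}"
    show "f i \<noteq> f j"
    proof
      assume "f i = f j"
      then have "(x, y) \<in> ?R ^^ (i + (n - j))"
        using sub[of 0 i] sub[of j n] ij f(1,2) relpow_add[of i "n - j" ?R] by auto
      then show False using min[of "i + (n - j)"] xy ij by fastforce
    qed
  qed auto
  let ?p = "map f [0..<Suc n]"
  have set_p: "set ?p = f ` {..n}" by (simp only: set_map set_upt atLeastLessThanSuc_atLeastAtMost atLeast0AtMost)
  have "hd ?p = x" using f(1) by (simp add: hd_map del: upt_Suc)
  moreover have "last ?p = y" using f(2) by simp
  ultimately have hl: "hd ?p = x" "last ?p = y" .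
  have "successively (\<lambda>u v. {u, v} \<in> edges G) ?p"
    using f(3) by (auto simp: successively_conv_nth adj_def simp del: upt_Suc)
  then have "is_path G ?p"
    using fS S(1) inj by (auto simp: is_path_def is_walk_def distinct_map set_p atLeast0LessThan lessThan_Suc_atMost simp del: upt_Suc)
  moreover have "set ?p \<inter> X = {hd ?p}" "set ?p \<inter> Y = {last ?p}"
    unfolding hl set_p using fX fY f(1,2) xy by fastforce+
  ultimately have "is_XY_path G X Y ?p" by (simp add: is_XY_path_def)
  moreover have "set ?p \<subseteq> S" unfolding set_p using fS by auto
  ultimately show thesis by (rule that)
qed

lemma XY_paths:
  assumes "menger (verts G) (adj G) k dd r X Y" and XY: "X \<subseteq> verts G" "Y \<subseteq> verts G"
  shows "(\<exists>P :: nat \<Rightarrow> 'a list.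
            (\<forall>i<k. is_XY_path G X Y (P i)) \<and>
            (\<forall>i<k. \<forall>j<k. i \<noteq> j \<longrightarrow>
               set (P i) \<inter> set (P j) = {} \<and> sdist G (set (P i)) (set (P j)) \<ge> enat dd)) \<or>
        (\<exists>Z \<subseteq> verts G. finite Z \<and> card Z < k \<and>
            (\<forall>p. is_XY_path G X Y p \<longrightarrow> sdist G (set p) Z \<le> enat r))"
  using assms(1) unfolding menger_def
proof (elim disjE exE conjE)
  fix \<P> assume P: "system (verts G) (adj G) k dd X Y \<P>"
  then have "finite \<P>" "card \<P> = k" by (auto simp: system_def)
  then obtain h where h: "bij_betw h {0..<k} \<P>" using ex_bij_betw_nat_finite by blast
  have hP: "h i \<in> \<P>" if "i < k" for i using h that by (auto simp: bij_betw_def)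
  have "\<exists>p. is_XY_path G X Y p \<and> set p \<subseteq> h i" if "i < k" for i
    using conn_XY_path[of "h i" X Y] P hP[OF that] unfolding system_def by metis
  then obtain p where p: "\<And>i. i < k \<Longrightarrow> is_XY_path G X Y (p i) \<and> set (p i) \<subseteq> h i" by metis
  have "set (p i) \<inter> set (p j) = {} \<and> sdist G (set (p i)) (set (p j)) \<ge> enat dd"
    if ij: "i < k" "j < k" "i \<noteq> j" for i j
  proof -
    have "h i \<noteq> h j" using h ij by (auto simp: bij_betw_def inj_on_def)
    then have far: "far (adj G) dd (h i) (h j)" using P hP ij by (auto simp: system_def)
    have V: "set (p i) \<subseteq> verts G" "set (p j) \<subseteq> verts G"
      using p ij by (auto simp: is_XY_path_def is_path_def is_walk_def)
    have lt: "dd < d u v" if "u \<in> set (p i)" "v \<in> set (p j)" for u v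
      using farD[OF far] p ij that by blast
    then have "set (p i) \<inter> set (p j) = {}" using d_refl by fastforce
    moreover have "enat dd \<le> vdist G u v" if "u \<in> set (p i)" "v \<in> set (p j)" for u v
      using lt[OF that] vdist_eq[OF subsetD[OF V(1) that(1)] subsetD[OF V(2) that(2)]] by simp
    then have "sdist G (set (p i)) (set (p j)) \<ge> enat dd"
      unfolding sdist_def by (intro INF_greatest)
    ultimately show ?thesis by blast
  qed
  then show ?thesis using p by blast
next
  fix Z assume Z: "Z \<subseteq> verts G" "finite Z" "card Z < k" "covers (verts G) (adj G) r X Y Z"
  have "sdist G (set p) Z \<le> enat r" if p: "is_XY_path G X Y p" for p
  proof -
    have w: "is_walk G p" "set p \<subseteq> verts G" using p by (auto simp: is_XY_path_def is_path_def is_walk_def)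
    have "set p \<inter> X \<noteq> {}" "set p \<inter> Y \<noteq> {}" using p by (auto simp: is_XY_path_def)
    then obtain v z where vz: "v \<in> set p" "z \<in> Z" "d v z \<le> r"
      using Z(4) conn_walk[OF w(1)] w(2) unfolding covers_def hits_def by blast
    then have "vdist G v z \<le> enat r"
      using vdist_eq[OF subsetD[OF w(2) vz(1)] subsetD[OF Z(1) vz(2)]] by simp
    then show ?thesis unfolding sdist_def
      by (intro INF_lower2[OF vz(1)] INF_lower2[OF vz(2)])
  qed
  then show ?thesis using Z(1-3) by (intro disjI2 exI[of _ Z]) simp
qed

end

theorem coarse_Menger_property_cut_conn:
  assumes "\<And>G. G \<in> \<G> \<Longrightarrow> cgraph (verts G) (adj G) \<and> cut_conn l (verts G) (adj G)"
  shows "coarse_Menger_property (\<G> :: 'a sgraph set)"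
proof -
  define Q where "Q k dd r \<longleftrightarrow> (\<forall>(V :: 'a set) E X Y. cgraph V E \<longrightarrow> cut_conn l V E \<longrightarrow>
      X \<subseteq> V \<longrightarrow> Y \<subseteq> V \<longrightarrow> menger V E k dd r X Y)" for k dd r
  have "\<forall>k dd. \<exists>r. Q k dd r" unfolding Q_def using coarse_menger by blast
  then obtain g where "\<And>k dd. Q k dd (g k dd)" by metis
  then have g: "menger V E k dd (g k dd) X Y"
    if "cgraph V E" "cut_conn l V E" "X \<subseteq> V" "Y \<subseteq> V" for k dd and V :: "'a set" and E X Y
    using that unfolding Q_def by blast
  show ?thesis
    unfolding coarse_Menger_property_def
  proof (intro exI[of _ g] allI ballI impI, goal_cases)
    case (1 k dd G X Y)
    interpret connected_sgraph G using assms[OF 1(1)] by (simp add: connected_sgraph_def)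
    show ?case using XY_paths[OF g[OF _ _ 1(2,3)] 1(2,3)] assms[OF 1(1)] by simp
  qed
qed

section \<open>Cayley graphs of presentations\<close>

lemma words_Cons [simp]: "x # w \<in> words S \<longleftrightarrow> x \<in> S \<times> UNIV \<and> w \<in> words S"
  and words_Nil [simp]: "[] \<in> words S"
  and words_append [simp]: "u @ v \<in> words S \<longleftrightarrow> u \<in> words S \<and> v \<in> words S"
  by (auto simp: words_def)

locale presentation = group \<Gamma> for \<Gamma> :: "('a, 'b) monoid_scheme" (structure) +
  fixes S :: "'s set" and R :: "'s word set" and \<phi> :: "'s word set \<Rightarrow> 'a"
  assumes pres: "finite_presentation \<Gamma> S R \<phi>"
begin

abbreviation "F \<equiv> free_group S"
abbreviation "K \<equiv> relator_subgroup S R"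
abbreviation "gen s \<equiv> \<phi> (presented_gen S R s)"

lemma RS: "R \<subseteq> words S" and iso: "\<phi> \<in> iso (presented_group S R) \<Gamma>"
  using pres by (auto simp: finite_presentation_def)

lemma group_F: "group F" by (rule group_free_group)

lemma normal_K: "K \<lhd> F" by (rule relator_subgroup_normal[OF RS])

lemma mult_F: "u \<otimes>\<^bsub>F\<^esub> v = free_reduce (u @ v)" by (simp add: free_group_def)
lemma one_F: "\<one>\<^bsub>F\<^esub> = []" by (simp add: free_group_def)
lemma carrier_F: "w \<in> carrier F \<longleftrightarrow> w \<in> words S \<and> freely_reduced w" by (simp add: free_group_def)

text \<open>Evaluation of a word in the group; \<open>free_reduce\<close> extends it to unreduced
  words, such as the relators.\<close>

definition q :: "'s word \<Rightarrow> 'a" where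
  "q w = \<phi> (K #>\<^bsub>F\<^esub> free_reduce w)"

lemma coset_carrier: "u \<in> carrier F \<Longrightarrow> K #>\<^bsub>F\<^esub> u \<in> carrier (presented_group S R)"
  by (auto simp: presented_group_def FactGroup_def RCOSETS_def)

lemma q_closed: "w \<in> words S \<Longrightarrow> q w \<in> carrier \<Gamma>"
  using iso coset_carrier[OF free_reduce_in] by (auto simp: q_def iso_def hom_def)

lemma q_append:
  assumes "u \<in> words S" "v \<in> words S" shows "q (u @ v) = q u \<otimes> q v"
proof -
  note c = free_reduce_in[OF assms(1)] free_reduce_in[OF assms(2)]
  have "(K #>\<^bsub>F\<^esub> free_reduce u) \<otimes>\<^bsub>presented_group S R\<^esub> (K #>\<^bsub>F\<^esub> free_reduce v) =
      K #>\<^bsub>F\<^esub> (free_reduce u \<otimes>\<^bsub>F\<^esub> free_reduce v)"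
    using normal.rcos_sum[OF normal_K c] by (simp add: presented_group_def FactGroup_def)
  also have "free_reduce u \<otimes>\<^bsub>F\<^esub> free_reduce v = free_reduce (u @ v)"
    by (simp add: mult_F free_reduce_append_left free_reduce_append_right)
  finally have "q (u @ v) = \<phi> ((K #>\<^bsub>F\<^esub> free_reduce u) \<otimes>\<^bsub>presented_group S R\<^esub> (K #>\<^bsub>F\<^esub> free_reduce v))"
    by (simp add: q_def)
  also have "\<dots> = q u \<otimes> q v"
    using iso coset_carrier[OF c(1)] coset_carrier[OF c(2)] by (auto simp: iso_def hom_def q_def)
  finally show ?thesis .
qed

lemma free_reduce_idem: "free_reduce (free_reduce w) = free_reduce w"
  by (rule free_reduce_id[OF freely_reduced_free_reduce])

lemma q_free_reduce: "q (free_reduce w) = q w"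
  by (simp add: q_def free_reduce_idem)

lemma q_Nil [simp]: "q [] = \<one>"
proof -
  have "q [] = q [] \<otimes> q []" using q_append[of "[]" "[]"] by simp
  then show ?thesis using q_closed[of "[]"] by (metis l_cancel_one' words_Nil)
qed

lemma q_Cons: "x \<in> S \<times> UNIV \<Longrightarrow> w \<in> words S \<Longrightarrow> q (x # w) = q [x] \<otimes> q w"
  using q_append[of "[x]" w] by simp

lemma q_inv_letter:
  assumes "x \<in> S \<times> UNIV" shows "q [x] \<otimes> q [inv_letter x] = \<one>"
proof -
  have x': "inv_letter x \<in> S \<times> UNIV" using assms by (auto simp: inv_letter_def)
  have "free_reduce [x, inv_letter x] = []" by (simp add: free_reduce_def)
  then have "q [x, inv_letter x] = \<one>" using q_free_reduce[of "[x, inv_letter x]"] by simp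
  then show ?thesis using q_append[of "[x]" "[inv_letter x]"] assms x' by simp
qed

text \<open>Injectivity of \<open>\<phi>\<close> makes words that are trivial in the group
  consequences of the relators.\<close>

lemma q_K: "w \<in> words S \<Longrightarrow> free_reduce w \<in> K \<longleftrightarrow> q w = \<one>"
proof
  assume w: "w \<in> words S"
  have sub: "subgroup K F" using normal_K by (rule normal_imp_subgroup)
  have Nil: "K #>\<^bsub>F\<^esub> [] = K"
    using group.coset_mult_one[OF group_F subgroup.subset[OF sub]] by (simp add: one_F)
  then have q0: "\<phi> K = \<one>" using q_Nil by (simp add: q_def free_reduce_def)
  note c = free_reduce_in[OF w]
  show "q w = \<one>" if "free_reduce w \<in> K"
    using subgroup.rcos_const[OF sub group_F that] q0 by (simp add: q_def)
  assume "q w = \<one>"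
  then have "\<phi> (K #>\<^bsub>F\<^esub> free_reduce w) = \<phi> K" using q0 by (simp add: q_def)
  moreover have "inj_on \<phi> (carrier (presented_group S R))" using iso by (auto simp: iso_def bij_betw_def)
  moreover have "K \<in> carrier (presented_group S R)"
    using coset_carrier[of "[]"] Nil by (simp add: carrier_F)
  ultimately have "K #>\<^bsub>F\<^esub> free_reduce w = K" using coset_carrier[OF c] by (auto dest: inj_onD)
  then show "free_reduce w \<in> K" using group.rcos_self[OF group_F c sub] by simp
qed

lemma relator_one: "r \<in> R \<Longrightarrow> q r = \<one>"
proof -
  assume r: "r \<in> R"
  interpret F: group F by (rule group_F)
  have rS: "r \<in> words S" and rF: "free_reduce r \<in> carrier F" using r RS free_reduce_in by auto
  have "\<one>\<^bsub>F\<^esub> \<otimes>\<^bsub>F\<^esub> free_reduce r \<otimes>\<^bsub>F\<^esub> inv\<^bsub>F\<^esub> \<one>\<^bsub>F\<^esub> = free_reduce r" using rF by simp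
  then have "free_reduce r \<in> {u \<otimes>\<^bsub>F\<^esub> a \<otimes>\<^bsub>F\<^esub> inv\<^bsub>F\<^esub> u | u a. u \<in> carrier F \<and> a \<in> free_reduce ` R}"
    using r F.one_closed by (smt (verit) imageI mem_Collect_eq)
  then have "free_reduce r \<in> K" unfolding relator_subgroup_def normal_closure_def by (rule generate.incl)
  then show "q r = \<one>" using q_K[OF rS] by simp
qed

lemma ex_word: assumes "a \<in> carrier \<Gamma>" obtains w where "w \<in> words S" "q w = a"
proof -
  have "a \<in> \<phi> ` carrier (presented_group S R)" using iso assms by (simp add: iso_def bij_betw_def)
  then obtain C where C: "C \<in> carrier (presented_group S R)" "\<phi> C = a" by auto
  then obtain u where "u \<in> carrier F" "C = K #>\<^bsub>F\<^esub> u"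
    by (auto simp: presented_group_def FactGroup_def RCOSETS_def)
  then show thesis using that[of u] C by (auto simp: q_def carrier_F free_reduce_id)
qed

lemma q_gen: "s \<in> S \<Longrightarrow> q [(s, True)] = gen s" "s \<in> S \<Longrightarrow> q [(s, False)] = inv (gen s)"
proof -
  assume s: "s \<in> S"
  show 1: "q [(s, True)] = gen s" by (simp add: q_def presented_gen_def free_reduce_def)
  have "q [(s, False)] \<otimes> q [(s, True)] = \<one>" using q_inv_letter[of "(s, False)"] s by (simp add: inv_letter_def)
  then show "q [(s, False)] = inv (gen s)"
    using inv_equality[of "q [(s, False)]" "q [(s, True)]"] q_closed[of "[(s, False)]"]
      q_closed[of "[(s, True)]"] s 1 by simp
qed

section \<open>Parities of edge crossings along words\<close>

fun parity :: "('a \<Rightarrow> 'a \<Rightarrow> bool) \<Rightarrow> 'a \<Rightarrow> 's word \<Rightarrow> bool" where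
  "parity c a [] = False"
| "parity c a (x # w) = (c a (a \<otimes> q [x]) \<noteq> parity c (a \<otimes> q [x]) w)"

fun visited :: "'a \<Rightarrow> 's word \<Rightarrow> 'a set" where
  "visited a [] = {a}"
| "visited a (x # w) = insert a (visited (a \<otimes> q [x]) w)"

lemma visited_self [simp]: "a \<in> visited a w" by (cases w) auto

lemma visited_carrier: "a \<in> carrier \<Gamma> \<Longrightarrow> w \<in> words S \<Longrightarrow> visited a w \<subseteq> carrier \<Gamma>"
  by (induction w arbitrary: a) (auto simp: q_closed)

lemma parity_append:
  "a \<in> carrier \<Gamma> \<Longrightarrow> u \<in> words S \<Longrightarrow> v \<in> words S \<Longrightarrow>
    parity c a (u @ v) = (parity c a u \<noteq> parity c (a \<otimes> q u) v)"
proof (induction u arbitrary: a)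
  case (Cons x u)
  have "a \<otimes> q (x # u) = a \<otimes> q [x] \<otimes> q u" using Cons q_Cons[of x u] by (simp add: m_assoc q_closed)
  then show ?case using Cons by (auto simp: q_closed)
qed simp

lemma visited_append:
  "a \<in> carrier \<Gamma> \<Longrightarrow> u \<in> words S \<Longrightarrow> v \<in> words S \<Longrightarrow>
    visited a (u @ v) = visited a u \<union> visited (a \<otimes> q u) v"
proof (induction u arbitrary: a)
  case (Cons x u)
  have "a \<otimes> q (x # u) = a \<otimes> q [x] \<otimes> q u" using Cons q_Cons[of x u] by (simp add: m_assoc q_closed)
  then show ?case using Cons by (auto simp: q_closed)
qed auto

lemma parity_cong:
  assumes "a \<in> carrier \<Gamma>" "w \<in> words S"
    and "\<And>u x. u \<in> visited a w \<Longrightarrow> x \<in> S \<times> UNIV \<Longrightarrow> u \<otimes> q [x] \<in> visited a w \<Longrightarrow> c u (u \<otimes> q [x]) = c' u (u \<otimes> q [x])"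
  shows "parity c a w = parity c' a w"
  using assms
proof (induction w arbitrary: a)
  case (Cons x w)
  have "parity c (a \<otimes> q [x]) w = parity c' (a \<otimes> q [x]) w"
    using Cons.prems by (intro Cons.IH) (auto simp: q_closed)
  moreover have "c a (a \<otimes> q [x]) = c' a (a \<otimes> q [x])" using Cons.prems(2) by (intro Cons.prems(3)) auto
  ultimately show ?case by simp
qed simp

lemma parity_False: "parity (\<lambda>_ _. False) a w = False"
  by (induction w arbitrary: a) auto

lemma parity_cut:
  "a \<in> carrier \<Gamma> \<Longrightarrow> w \<in> words S \<Longrightarrow>
    parity (\<lambda>u v. (u \<in> U) \<noteq> (v \<in> U)) a w = ((a \<in> U) \<noteq> (a \<otimes> q w \<in> U))"
proof (induction w arbitrary: a)
  case (Cons x w)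
  have "a \<otimes> q (x # w) = a \<otimes> q [x] \<otimes> q w" using Cons q_Cons[of x w] by (simp add: m_assoc q_closed)
  then show ?case using Cons by (auto simp: q_closed)
qed simp

text \<open>A cancelling pair of letters crosses one edge back and forth.\<close>

lemma parity_free_reduce:
  assumes c: "\<And>u v. c u v = c v u" and a: "a \<in> carrier \<Gamma>" and w: "w \<in> words S"
  shows "parity c a (free_reduce w) = parity c a w"
  using a w
proof (induction w arbitrary: a)
  case (Cons x w)
  have x: "x \<in> S \<times> UNIV" "w \<in> words S" using Cons by auto
  have ax: "a \<otimes> q [x] \<in> carrier \<Gamma>" using Cons by (simp add: q_closed)
  have IH: "parity c (a \<otimes> q [x]) (free_reduce w) = parity c (a \<otimes> q [x]) w" using Cons.IH[OF ax x(2)] .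
  have eq: "free_reduce (x # w) = cons_reduce x (free_reduce w)" by (simp add: free_reduce_def)
  show ?case
  proof (cases "free_reduce w")
    case (Cons y u)
    show ?thesis
    proof (cases "y = inv_letter x")
      case True
      have x': "inv_letter x \<in> S \<times> UNIV" using x by (auto simp: inv_letter_def)
      have "a \<otimes> q [x] \<otimes> q [y] = a" using q_inv_letter[OF x(1)] a True x x' \<open>a \<in> carrier \<Gamma>\<close>
        by (simp add: m_assoc q_closed)
      then show ?thesis using IH eq Cons True c by auto
    qed (use IH eq Cons in auto)
  qed (use IH eq in \<open>auto simp: free_reduce_def\<close>)
qed (simp add: free_reduce_def)

text \<open>After reduction, a trivial word is a product of conjugates of relators and their
  inverses. In a conjugate, the outer parts cross the same edges in opposite directions and cancel,
  which leaves a relator read from another base point.\<close>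

lemma parity_closed:
  assumes c: "\<And>u v. c u v = c v u"
    and R: "\<And>a r. a \<in> carrier \<Gamma> \<Longrightarrow> r \<in> R \<Longrightarrow> \<not> parity c a r"
    and w: "w \<in> words S" "q w = \<one>" and a: "a \<in> carrier \<Gamma>"
  shows "\<not> parity c a w"
proof -
  interpret F: group F by (rule group_F)
  have sub: "subgroup K F" using normal_K by (rule normal_imp_subgroup)
  have KF: "h \<in> carrier F" if "h \<in> K" for h using subgroup.subset[OF sub] that by auto
  have Kq: "q h = \<one>" if "h \<in> K" for h
    using q_K[of h] that KF[OF that] by (simp add: carrier_F free_reduce_id)
  have pm: "parity c a (u \<otimes>\<^bsub>F\<^esub> v) = (parity c a u \<noteq> parity c (a \<otimes> q u) v)"
    if "u \<in> carrier F" "v \<in> carrier F" "a \<in> carrier \<Gamma>" for u v a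
    using that by (simp add: mult_F parity_free_reduce[OF c] parity_append carrier_F)
  have qm: "q (u \<otimes>\<^bsub>F\<^esub> v) = q u \<otimes> q v" if "u \<in> carrier F" "v \<in> carrier F" for u v
    using that by (simp add: mult_F q_free_reduce q_append carrier_F)
  have qc: "q u \<in> carrier \<Gamma>" if "u \<in> carrier F" for u using that by (simp add: q_closed carrier_F)
  have pinv: "parity c (a \<otimes> q u) (inv\<^bsub>F\<^esub> u) = parity c a u" if "u \<in> carrier F" "a \<in> carrier \<Gamma>" for u a
    using pm[of u "inv\<^bsub>F\<^esub> u" a] that by (simp add: one_F)
  let ?C = "{u \<otimes>\<^bsub>F\<^esub> r \<otimes>\<^bsub>F\<^esub> inv\<^bsub>F\<^esub> u | u r. u \<in> carrier F \<and> r \<in> free_reduce ` R}"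
  have K: "K = generate F ?C" by (simp add: relator_subgroup_def normal_closure_def)
  have conj: "\<not> parity c a h" if h: "h \<in> ?C" and a: "a \<in> carrier \<Gamma>" for h a
  proof -
    obtain u r where h: "h = u \<otimes>\<^bsub>F\<^esub> free_reduce r \<otimes>\<^bsub>F\<^esub> inv\<^bsub>F\<^esub> u" "u \<in> carrier F" "r \<in> R" using h by auto
    have rS: "r \<in> words S" and rF: "free_reduce r \<in> carrier F" using h RS free_reduce_in by auto
    have au: "a \<otimes> q u \<in> carrier \<Gamma>" using a qc[OF h(2)] by simp
    have "parity c a h = ((parity c a u \<noteq> parity c (a \<otimes> q u) (free_reduce r)) \<noteq>
        parity c (a \<otimes> q (u \<otimes>\<^bsub>F\<^esub> free_reduce r)) (inv\<^bsub>F\<^esub> u))"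
      unfolding h(1) using pm h(2) rF a by simp
    also have "q (u \<otimes>\<^bsub>F\<^esub> free_reduce r) = q u" using qm[OF h(2) rF] relator_one[OF h(3)] qc[OF h(2)] by (simp add: q_free_reduce)
    finally show ?thesis
      using pinv[OF h(2) a] R[OF au h(3)] parity_free_reduce[OF c au rS] by simp
  qed
  have "\<forall>a\<in>carrier \<Gamma>. \<not> parity c a h" if "h \<in> generate F ?C" for h
    using that
  proof (induction h rule: generate.induct)
    case one
    then show ?case by (simp add: one_F)
  next
    case (incl h)
    then show ?case using conj by blast
  next
    case (inv h)
    have hK: "h \<in> K" unfolding K using inv by (rule generate.incl)
    show ?case
    proof
      fix a assume a: "a \<in> carrier \<Gamma>"
      show "\<not> parity c a (inv\<^bsub>F\<^esub> h)" using pinv[OF KF[OF hK] a] Kq[OF hK] conj[OF inv a] a by simp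
    qed
  next
    case (eng h1 h2)
    then have "h1 \<in> K" "h2 \<in> K" by (simp_all only: K)
    then show ?case using eng pm[OF KF KF, of h1 h2] Kq[of h1] by auto
  qed
  then have "\<not> parity c a (free_reduce w)" using q_K[OF w(1)] w(2) a unfolding K by blast
  then show ?thesis using parity_free_reduce[OF c a w(1)] by simp
qed

section \<open>The cut property of the Cayley graph\<close>

abbreviation "letters \<equiv> S \<times> (UNIV :: bool set)"
abbreviation "Cay \<equiv> Cayley_graph \<Gamma> (gen ` S)"

lemma verts_Cay: "verts Cay = carrier \<Gamma>" by (simp add: Cayley_graph_def)

lemma letter_cases:
  "(\<exists>x\<in>letters. b = a \<otimes> q [x]) \<longleftrightarrow>
    (\<exists>t \<in> gen ` S \<union> m_inv \<Gamma> ` gen ` S. b = a \<otimes> t)"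
proof
  assume "\<exists>x\<in>letters. b = a \<otimes> q [x]"
  then obtain s p where "s \<in> S" "b = a \<otimes> q [(s, p)]" by auto
  then show "\<exists>t \<in> gen ` S \<union> m_inv \<Gamma> ` gen ` S. b = a \<otimes> t"
    using q_gen[of s] by (cases p) auto
next
  assume "\<exists>t \<in> gen ` S \<union> m_inv \<Gamma> ` gen ` S. b = a \<otimes> t"
  then obtain s where "s \<in> S" "b = a \<otimes> gen s \<or> b = a \<otimes> inv (gen s)" by auto
  then show "\<exists>x\<in>letters. b = a \<otimes> q [x]" using q_gen[of s] by (metis SigmaI UNIV_I)
qed

lemma letter_back:
  assumes "a \<in> carrier \<Gamma>" "x \<in> letters"
  shows "inv_letter x \<in> letters" "a \<otimes> q [x] \<otimes> q [inv_letter x] = a"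
proof -
  show x': "inv_letter x \<in> letters" using assms by (auto simp: inv_letter_def)
  show "a \<otimes> q [x] \<otimes> q [inv_letter x] = a"
    using q_inv_letter[OF assms(2)] q_closed[of "[x]"] q_closed[of "[inv_letter x]"] assms x'
    by (simp add: m_assoc)
qed

lemma adj_Cay:
  "(a, b) \<in> adj Cay \<longleftrightarrow> a \<in> carrier \<Gamma> \<and> b \<in> carrier \<Gamma> \<and> a \<noteq> b \<and> (\<exists>x\<in>letters. b = a \<otimes> q [x])"
proof -
  have "(a, b) \<in> adj Cay \<longleftrightarrow> (\<exists>g h. {a, b} = {g, h} \<and> g \<in> carrier \<Gamma> \<and> h \<in> carrier \<Gamma> \<and> g \<noteq> h \<and>
      (\<exists>x\<in>letters. h = g \<otimes> q [x]))"
    unfolding letter_cases by (simp add: adj_def Cayley_graph_def)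
  moreover have "\<exists>x\<in>letters. b = a \<otimes> q [x]" if "b \<in> carrier \<Gamma>" "x \<in> letters" "a = b \<otimes> q [x]" for x
    using letter_back[OF that(1,2)] that(3) by metis
  ultimately show ?thesis by (auto simp: doubleton_eq_iff)
qed

lemma word_path:
  "a \<in> carrier \<Gamma> \<Longrightarrow> w \<in> words S \<Longrightarrow> (a, a \<otimes> q w) \<in> (adj Cay)\<^sup>*"
proof (induction w arbitrary: a)
  case (Cons x w)
  have x: "x \<in> letters" "w \<in> words S" using Cons by auto
  have ax: "a \<otimes> q [x] \<in> carrier \<Gamma>" using Cons.prems x by (simp add: q_closed)
  have "a \<otimes> q (x # w) = a \<otimes> q [x] \<otimes> q w" using Cons.prems x q_Cons[OF x] by (simp add: m_assoc q_closed)
  moreover have "(a, a \<otimes> q [x]) \<in> (adj Cay)\<^sup>*"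
    using ax Cons.prems(1) x adj_Cay[of a "a \<otimes> q [x]"] by (cases "a = a \<otimes> q [x]") auto
  ultimately show ?case using Cons.IH[OF ax x(2)] by (metis rtrancl_trans)
qed simp

lemma cgraph_Cay: "cgraph (carrier \<Gamma>) (adj Cay)"
proof
  show "adj Cay \<subseteq> carrier \<Gamma> \<times> carrier \<Gamma>" using adj_Cay by auto
  show "sym (adj Cay)" by (auto simp: sym_def adj_def insert_commute)
  fix a b assume ab: "a \<in> carrier \<Gamma>" "b \<in> carrier \<Gamma>"
  obtain w where "w \<in> words S" "q w = inv a \<otimes> b" using ex_word[of "inv a \<otimes> b"] ab by auto
  then show "(a, b) \<in> (adj Cay)\<^sup>*" using word_path[OF ab(1)] ab by (metis inv_solve_left m_closed inv_closed)
qed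

interpretation C: cgraph "carrier \<Gamma>" "adj Cay" by (rule cgraph_Cay)

lemma visited_dist:
  assumes "a \<in> carrier \<Gamma>" "w \<in> words S" "v \<in> visited a w"
  shows "C.d a v \<le> length w"
  using assms
proof (induction w arbitrary: a)
  case (Cons x w)
  have x: "x \<in> letters" "w \<in> words S" using Cons by auto
  have ax: "a \<otimes> q [x] \<in> carrier \<Gamma>" using Cons.prems x by (simp add: q_closed)
  have "C.d a (a \<otimes> q [x]) \<le> 1"
    using C.d_edge[of a "a \<otimes> q [x]"] ax Cons.prems(1) x adj_Cay[of a "a \<otimes> q [x]"]
    by (cases "a = a \<otimes> q [x]") auto
  show ?case
  proof (cases "v = a")
    case False
    then have v: "v \<in> visited (a \<otimes> q [x]) w" using Cons.prems by simp
    have "v \<in> carrier \<Gamma>" using visited_carrier[OF ax x(2)] v by auto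
    then show ?thesis using C.d_tri[OF Cons.prems(1) ax] Cons.IH[OF ax x(2) v] \<open>C.d a (a \<otimes> q [x]) \<le> 1\<close> by fastforce
  qed simp
qed simp

lemma visited_diam:
  assumes "a \<in> carrier \<Gamma>" "w \<in> words S" "u \<in> visited a w" "v \<in> visited a w"
  shows "C.d u v \<le> length w"
  using assms
proof (induction w arbitrary: a)
  case (Cons x w)
  have x: "x \<in> letters" "w \<in> words S" using Cons by auto
  have ax: "a \<otimes> q [x] \<in> carrier \<Gamma>" using Cons.prems x by (simp add: q_closed)
  have V: "u \<in> carrier \<Gamma>" "v \<in> carrier \<Gamma>" using visited_carrier[OF Cons.prems(1,2)] Cons.prems by auto
  consider "u = a" | "v = a" | "u \<in> visited (a \<otimes> q [x]) w" "v \<in> visited (a \<otimes> q [x]) w"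
    using Cons.prems by auto
  then show ?case
  proof cases
    case 1 then show ?thesis using visited_dist[OF Cons.prems(1,2,4)] by simp
  next
    case 2 then show ?thesis using visited_dist[OF Cons.prems(1,2,3)] C.d_sym[OF V] by simp
  next
    case 3 then show ?thesis using Cons.IH[OF ax x(2)] by fastforce
  qed
qed simp

lemma conn_word:
  assumes "conn (adj Cay) A" "A \<subseteq> carrier \<Gamma>" "u \<in> A" "v \<in> A"
  obtains w where "w \<in> words S" "u \<otimes> q w = v" "visited u w \<subseteq> A"
proof -
  have "(u, v) \<in> (adj Cay \<inter> A \<times> A)\<^sup>*" using assms by (auto simp: conn_def)
  then have "\<exists>w. w \<in> words S \<and> u \<otimes> q w = v \<and> visited u w \<subseteq> A"
  proof (induction rule: rtrancl_induct)
    case base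
    have "u \<in> carrier \<Gamma>" using assms by auto
    then show ?case using assms by (intro exI[of _ "[]"]) simp
  next
    case (step y z)
    then obtain w where w: "w \<in> words S" "u \<otimes> q w = y" "visited u w \<subseteq> A" by blast
    obtain x where x: "x \<in> letters" "z = y \<otimes> q [x]" using step(2) adj_Cay by blast
    have uV: "u \<in> carrier \<Gamma>" using assms by auto
    have "u \<otimes> q (w @ [x]) = u \<otimes> q w \<otimes> q [x]"
      using q_append[of w "[x]"] q_closed[of w] q_closed[of "[x]"] w(1) x(1) uV by (simp add: m_assoc)
    then have "u \<otimes> q (w @ [x]) = z" by (simp only: w(2) x(2))
    moreover have "visited u (w @ [x]) \<subseteq> A"
      using visited_append[OF uV w(1), of "[x]"] w(2,3) x step(2) by auto
    ultimately show ?case using w x by (intro exI[of _ "w @ [x]"]) simp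
  qed
  then show thesis using that by blast
qed

lemma cut_conn_Cay:
  assumes l: "\<And>r. r \<in> R \<Longrightarrow> length r \<le> l"
  shows "cut_conn l (carrier \<Gamma>) (adj Cay)"
  unfolding cut_conn_def
proof (intro allI impI ballI)
  fix U b b'
  let ?W = "carrier \<Gamma> - U" and ?D = "bdry (adj Cay) U (carrier \<Gamma> - U)"
  assume U: "U \<subseteq> carrier \<Gamma>" "conn (adj Cay) U \<and> conn (adj Cay) ?W" and b: "b \<in> ?D" "b' \<in> ?D"
  show "(b, b') \<in> (near (adj Cay) l ?D)\<^sup>*"
  proof (rule ccontr)
    assume neg: "(b, b') \<notin> (near (adj Cay) l ?D)\<^sup>*"
    define B where "B = {z. (b, z) \<in> (near (adj Cay) l ?D)\<^sup>*}"
    have BD: "B \<subseteq> ?D"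
    proof
      fix z assume "z \<in> B"
      then have "(b, z) \<in> (near (adj Cay) l ?D)\<^sup>*" by (simp add: B_def)
      then show "z \<in> ?D" by (induction rule: rtrancl_induct) (use b in \<open>auto simp: near_def\<close>)
    qed
    have DU: "?D \<subseteq> U" by (auto simp: bdry_def)
    have BU: "B \<subseteq> U" using BD DU by blast
    have bB: "b \<in> B" "b' \<notin> B" using neg by (auto simp: B_def)
    have B_near: "z' \<in> B" if "z \<in> B" "z' \<in> ?D" "C.d z z' \<le> l" for z z'
    proof -
      have "(z, z') \<in> near (adj Cay) l ?D" using that BD by (auto simp: near_def)
      then show ?thesis using that(1) by (auto simp: B_def intro: rtrancl_into_rtrancl)
    qed
    define c where "c u v \<longleftrightarrow> (u \<in> B \<and> v \<notin> U) \<or> (v \<in> B \<and> u \<notin> U)" for u v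
    have c_sym: "c u v = c v u" for u v by (auto simp: c_def)
    have relator: "\<not> parity c a r" if a: "a \<in> carrier \<Gamma>" and r: "r \<in> R" for a r
    proof -
      have rS: "r \<in> words S" using r RS by auto
      have "q r = \<one>" by (rule relator_one[OF r])
      show ?thesis
      proof (cases "\<exists>z\<in>visited a r. z \<in> B")
        case False
        have "parity c a r = parity (\<lambda>_ _. False) a r"
          by (rule parity_cong[OF a rS]) (use False in \<open>auto simp: c_def\<close>)
        then show ?thesis using parity_False by simp
      next
        case True
        then obtain z where z: "z \<in> visited a r" "z \<in> B" by blast
        \<comment> \<open>The relator stays within \<open>l\<close> of \<open>z\<close>, so every
          boundary vertex at which it crosses the cut belongs to \<open>B\<close>. For this relator
          \<open>c\<close> is the whole cut, which a closed walk crosses an even number of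
          times.\<close>
        have "parity c a r = parity (\<lambda>u v. (u \<in> U) \<noteq> (v \<in> U)) a r"
        proof (rule parity_cong[OF a rS])
          fix u x assume u: "u \<in> visited a r" "x \<in> letters" "u \<otimes> q [x] \<in> visited a r"
          let ?v = "u \<otimes> q [x]"
          have V: "u \<in> carrier \<Gamma>" "?v \<in> carrier \<Gamma>" using visited_carrier[OF a rS] u by auto
          have zl: "C.d z y \<le> l" if "y \<in> visited a r" for y
            using visited_diam[OF a rS z(1) that] l[OF r] by simp
          have "u \<in> B" if "u \<in> U" "?v \<notin> U"
          proof (rule B_near[OF z(2) _ zl[OF u(1)]])
            have "(u, ?v) \<in> adj Cay" using adj_Cay[of u ?v] V u(2) that by auto
            then show "u \<in> ?D" using that V by (auto simp: bdry_def)
          qed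
          moreover have "?v \<in> B" if "u \<notin> U" "?v \<in> U"
          proof (rule B_near[OF z(2) _ zl[OF u(3)]])
            have "(u, ?v) \<in> adj Cay" using adj_Cay[of u ?v] V u(2) that by auto
            then have "(?v, u) \<in> adj Cay" by (rule C.E_sym)
            then show "?v \<in> ?D" using that V by (auto simp: bdry_def)
          qed
          ultimately show "c u ?v = ((u \<in> U) \<noteq> (?v \<in> U))" using BU by (auto simp: c_def)
        qed
        then show ?thesis using parity_cut[OF a rS] \<open>q r = \<one>\<close> a by simp
      qed
    qed
    have bV: "b \<in> carrier \<Gamma>" "b' \<in> carrier \<Gamma>" "b \<in> U" "b' \<in> U" using b DU U by auto
    obtain y where y: "y \<in> ?W" "(b, y) \<in> adj Cay" using b(1) by (auto simp: bdry_def)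
    obtain y' where y': "y' \<in> ?W" "(b', y') \<in> adj Cay" using b(2) by (auto simp: bdry_def)
    obtain x where x: "x \<in> letters" "y = b \<otimes> q [x]" using y(2) adj_Cay by blast
    obtain x' where x': "x' \<in> letters" "b' = y' \<otimes> q [x']" using C.E_sym[OF y'(2)] adj_Cay by blast
    obtain w where w: "w \<in> words S" "y \<otimes> q w = y'" "visited y w \<subseteq> ?W"
      using conn_word[of ?W y y'] U y y' by blast
    obtain w' where w': "w' \<in> words S" "b' \<otimes> q w' = b" "visited b' w' \<subseteq> U"
      using conn_word[of U b' b] U bV by blast
    \<comment> \<open>The closed walk leaves \<open>U\<close> at \<open>b\<close>, runs through the
      complement, re-enters at \<open>b'\<close> and returns inside \<open>U\<close>. Only its first
      edge counts for \<open>c\<close>, as \<open>b'\<close> is not in \<open>B\<close>.\<close>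
    let ?w = "x # (w @ (x' # w'))"
    have W: "?w \<in> words S" using x x' w w' by simp
    have yV: "y \<in> carrier \<Gamma>" "y' \<in> carrier \<Gamma>" using y y' by auto
    have qc: "q w \<in> carrier \<Gamma>" "q w' \<in> carrier \<Gamma>" "q [x] \<in> carrier \<Gamma>" "q [x'] \<in> carrier \<Gamma>"
      using q_closed w(1) w'(1) x(1) x'(1) by auto
    have "b \<otimes> q ?w = b"
    proof -
      have "q ?w = q [x] \<otimes> (q w \<otimes> (q [x'] \<otimes> q w'))"
        using q_Cons[of x "w @ (x' # w')"] q_append[of w "x' # w'"] q_Cons[of x' w'] x(1) x'(1) w(1) w'(1) by simp
      then have "b \<otimes> q ?w = b \<otimes> q [x] \<otimes> q w \<otimes> q [x'] \<otimes> q w'"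
        using bV(1) qc by (simp add: m_assoc)
      then show ?thesis by (simp only: x(2)[symmetric] w(2) x'(2)[symmetric] w'(2))
    qed
    then have one: "q ?w = \<one>" using bV q_closed[OF W] by (metis l_cancel_one)
    have in_W: "\<not> parity c y w"
    proof -
      have "parity c y w = parity (\<lambda>_ _. False) y w"
        by (rule parity_cong[OF yV(1) w(1)]) (use w(3) BU in \<open>auto simp: c_def\<close>)
      then show ?thesis using parity_False by simp
    qed
    have in_U: "\<not> parity c b' w'"
    proof -
      have "parity c b' w' = parity (\<lambda>_ _. False) b' w'"
        by (rule parity_cong[OF bV(2) w'(1)]) (use w'(3) in \<open>auto simp: c_def\<close>)
      then show ?thesis using parity_False by simp
    qed
    have "c b y" "\<not> c y' b'" using bB y y' BU by (auto simp: c_def)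
    moreover have "parity c b ?w = (c b y \<noteq> (parity c y w \<noteq> (c y' b' \<noteq> parity c b' w')))"
      using parity_append[OF yV(1) w(1), of "x' # w'"] x x' w w' by simp
    ultimately have "parity c b ?w" using in_W in_U by simp
    then show False using parity_closed[OF c_sym relator W one bV(1)] by simp
  qed
qed

end

theorem corollary4:
  fixes l :: nat
  shows "coarse_Menger_property (finpres_Cayley_graphs l :: 'a sgraph set)"
proof (rule coarse_Menger_property_cut_conn[where l = l])
  fix G :: "'a sgraph" assume "G \<in> finpres_Cayley_graphs l"
  then obtain \<Gamma> :: "'a monoid" and T and S :: "nat set" and R \<phi> where
    G: "G = Cayley_graph \<Gamma> T" "group \<Gamma>" "finite_presentation \<Gamma> S R \<phi>"
      "\<And>r. r \<in> R \<Longrightarrow> length r \<le> l" "T = (\<phi> \<circ> presented_gen S R) ` S"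
    unfolding finpres_Cayley_graphs_def by blast
  interpret presentation \<Gamma> S R \<phi>
    using G by (simp add: presentation_def presentation_axioms_def)
  have "G = Cay" unfolding G(1,5) by (simp add: comp_def)
  then show "cgraph (verts G) (adj G) \<and> cut_conn l (verts G) (adj G)"
    using cgraph_Cay cut_conn_Cay[OF G(4)] by (simp add: verts_Cay)
qed

end
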